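(* Let $0<\alpha<1$ and $T>0$. Assume that the functions $g$ and $f$ on $[0,1]$ are differentiable $4$ times such that $g^{(i)}(0)=f^{(i)}(0)=0$ for $i=0,1,2,3$, $g^{(j)}(1)=f^{(j)}(1)=0$ for $j=0,1,2$, and $g^{(4)}(x)$ and $f^{(4)}(x)$ are bounded. Then the inverse problem of finding a pair of functions $\{u(x,t),h(x)\}$ such that $$ \begin{array}{ll} {}^cD^{\alpha}_{0|t}u=\dfrac{\partial^2 u}{\partial x^2}+\dfrac{1}{x}\dfrac{\partial u}{\partial x}+h(x), & 0<x<1,\ 0<t<T,\\[2mm] \displaystyle\lim_{x\to 0}x\,\dfrac{\partial u}{\partial x}=0,\quad u(1,t)=0, & 0<t<T,\\[2mm] u(x,0)=g(x),\quad u(x,T)=f(x), & 0<x<1, \end{array} $$ has a unique solution given by $$u(x,t)=g(x)-\sum_{k=1}^{\infty}\frac{1-E_\alpha(-\lambda_k^2t^\alpha)}{1-E_\alpha(-\lambda_k^2T^\alpha)}\,(g_k-f_k)\,J_0(\lambda_kx),$$ $$h(x)=g''(x)-\sum_{k=1}^{\infty}\frac{\lambda_k^2\,(g_k-f_k)}{1-E_\alpha(-\lambda_k^2T^\alpha)}\,J_0(\lambda_kx),$$ where $$f_k=\frac{2}{J_1^2(\lambda_k)}\int_0^1 x\,f(x)\,J_0(\lambda_kx)\,dx\quad\text{and}\quad g_k=\frac{2}{J_1^2(\lambda_k)}\int_0^1 x\,g(x)\,J_0(\lambda_kx)\,dx .$$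
   Context: $J_\nu$ denotes the Bessel function of the first kind of order $\nu$, and $0<\lambda_1<\lambda_2<\cdots$ are the positive zeros of $J_0$ in ascending order. $E_\alpha(z)=\sum_{k=0}^\infty \frac{z^k}{\Gamma(\alpha k+1)}$ is the one-parameter Mittag-Leffler function. For $0<\alpha<1$ the Caputo fractional derivative is $${}^cD^\alpha_{0|t}\varphi(t)=\frac{1}{\Gamma(1-\alpha)}\int_0^t\frac{\varphi'(\tau)}{(t-\tau)^\alpha}\,d\tau,$$ and for $u(x,t)$ it is applied in the variable $t$ with $x$ fixed. The functions $g$ and $f$ are given; $u$ and the source term $h$ are both unknown.
   Formalization: The printed formula for h is false (f=g=x^4(1-x)^3 would force 2g''+g'/x=0), so its term g''(x) is corrected to -(g''(x)+g'(x)/x); a solution is read as classical, with u continuous on [0,1]×[0,T] and u_x, u_xx, h continuous in the interior. *)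

theory Defs
  imports "HOL-Analysis.Analysis"
begin

text \<open>
  Only the natural orders are needed below, so Gamma (m + n + 1) is written as a factorial and
  the power as a natural one (with \<open>powr\<close> the value at 0 would be wrong, since \<open>0 powr 0 = 0\<close>).
\<close>

definition bessel_J :: "nat \<Rightarrow> real \<Rightarrow> real" where
  "bessel_J n x = (\<Sum>m. (- 1) ^ m / (fact m * fact (m + n)) * (x / 2) ^ (2 * m + n))"

definition mittag_leffler :: "real \<Rightarrow> real \<Rightarrow> real" where
  "mittag_leffler \<alpha> z = (\<Sum>k. z ^ k / Gamma (\<alpha> * real k + 1))"

definition fourier_bessel_coeff :: "real \<Rightarrow> (real \<Rightarrow> real) \<Rightarrow> real" where
  "fourier_bessel_coeff l \<phi> =
     2 / (bessel_J 1 l)\<^sup>2 * (LBINT x:{0..1}. x * \<phi> x * bessel_J 0 (l * x))"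

definition caputo :: "real \<Rightarrow> (real \<Rightarrow> real) \<Rightarrow> real \<Rightarrow> real" where
  "caputo \<alpha> \<phi> t =
     1 / Gamma (1 - \<alpha>) * (LBINT \<tau>:{0<..<t}. deriv \<phi> \<tau> / (t - \<tau>) powr \<alpha>)"

text \<open>
  The integral in \<^const>\<open>caputo\<close> is a total operation; the following says that the Caputo
  derivative of order \<open>\<alpha>\<close> really exists throughout the open interval from 0 to \<open>T\<close>.
\<close>

definition caputo_differentiable :: "real \<Rightarrow> real \<Rightarrow> (real \<Rightarrow> real) \<Rightarrow> bool" where
  "caputo_differentiable \<alpha> T \<phi> \<longleftrightarrow>
     (\<forall>\<tau>\<in>{0<..<T}. \<phi> field_differentiable at \<tau>) \<and>
     (\<forall>t\<in>{0<..<T}. set_integrable lborel {0<..<t} (\<lambda>\<tau>. deriv \<phi> \<tau> / (t - \<tau>) powr \<alpha>))"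

definition dx :: "(real \<Rightarrow> real \<Rightarrow> real) \<Rightarrow> real \<Rightarrow> real \<Rightarrow> real" where
  "dx u x t = deriv (\<lambda>y. u y t) x"

text \<open>
  Solutions are understood in the classical sense: \<open>u\<close> is continuous on the closed rectangle (this
  is what ties the values prescribed on its sides to the equation in the interior), the derivatives
  in the equation exist in the open rectangle, and the first and second derivatives in \<open>x\<close> and
  the source \<open>h\<close> are continuous there. By the equation, the Caputo derivative of \<open>u\<close> is then
  continuous in the open rectangle as well.
\<close>

definition inverse_problem_solution ::
  "real \<Rightarrow> real \<Rightarrow> (real \<Rightarrow> real) \<Rightarrow> (real \<Rightarrow> real) \<Rightarrow> (real \<Rightarrow> real \<Rightarrow> real) \<Rightarrow> (real \<Rightarrow> real) \<Rightarrow> bool"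
where
  "inverse_problem_solution \<alpha> T g f u h \<longleftrightarrow>
     continuous_on ({0..1} \<times> {0..T}) (\<lambda>(x, t). u x t) \<and>
     (\<forall>x\<in>{0<..<1}. caputo_differentiable \<alpha> T (u x)) \<and>
     (\<forall>x\<in>{0<..<1}. \<forall>t\<in>{0<..<T}.
        (\<lambda>y. u y t) field_differentiable at x \<and> (\<lambda>y. dx u y t) field_differentiable at x) \<and>
     continuous_on ({0<..<1} \<times> {0<..<T}) (\<lambda>(x, t). dx u x t) \<and>
     continuous_on ({0<..<1} \<times> {0<..<T}) (\<lambda>(x, t). dx (dx u) x t) \<and>
     continuous_on {0<..<1} h \<and>
     (\<forall>x\<in>{0<..<1}. \<forall>t\<in>{0<..<T}.
        caputo \<alpha> (u x) t = dx (dx u) x t + 1 / x * dx u x t + h x) \<and>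
     (\<forall>t\<in>{0<..<T}. ((\<lambda>x. x * dx u x t) \<longlongrightarrow> 0) (at_right 0) \<and> u 1 t = 0) \<and>
     (\<forall>x\<in>{0<..<1}. u x 0 = g x \<and> u x T = f x)"

end

(*
  The Bessel operator L w = w'' + w' / x with w 1 = 0 has an explicit inverse, an integral operator that
  is symmetric, positive and maps bounded sets of the weighted L2 space to equicontinuous sets. On the
  orthogonal complement of all modes J_0 (l k x) a maximizing sequence of its Rayleigh quotient would
  therefore converge to an eigenfunction, which is again a mode: the modes are complete. The sup-norm
  bound on the inverse also gives absolute uniform convergence of all series that occur, so no asymptotics
  of Bessel functions or of their zeros is needed.

  If a function attains its maximum at t, its Caputo derivative there is at least (phi t - phi 0) t^(-a) / Gamma (1 - a).
  Applied to E (- c t^a), this yields 0 <= E <= 1, monotonicity in c, and hence all estimates on the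
  coefficients in t.

  For uniqueness, the equation for the difference of two solutions is integrated in time, which leaves only
  data continuous up to the boundary, and the unknown source is eliminated by comparing time intervals.
  Projecting on a mode gives the equation I^(1-a) u_k + l_k^2 I^1 u_k = kappa t, whose solution is a multiple
  of 1 - E by the maximum principle; since it vanishes at T and 1 - E does not, u_k = 0.
*)
theory Submission
  imports Defs "HOL-Complex_Analysis.Great_Picard"
begin


section \<open>The Bessel functions \<open>J\<^sub>0\<close> and \<open>J\<^sub>1\<close>\<close>

text \<open>The four derivatives and the boundary values of g - f serve one purpose: the square of
  the Bessel operator applied to g - f is a bounded function whose coefficients are l_k^4 (g_k -
  f_k), with no boundary terms. Bessel's inequality makes these square summable against the squared
  norms of the modes, and the sup-norm bound on the inverse turns this into absolute uniform
  convergence at the price of l_k^(-2). One factor l_k^2 is left over, which is what the second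
  x-derivative, the Caputo derivative and the source require. The obstacle to uniqueness is the weak
  boundary behaviour of a solution: its derivatives are continuous only in the open rectangle and
  the source only in the open interval, so the equation cannot be tested against a mode directly.
  Time integrals over intervals compactly inside (0,T) can be differentiated in x, and integration
  by parts in x is replaced by the uniqueness of bounded solutions of the Bessel problem.\<close>

definition bessel_coeff :: "nat \<Rightarrow> nat \<Rightarrow> real" where
  "bessel_coeff n m = (- 1) ^ m / (fact m * fact (m + n))"

text \<open>The variable s stands for (x/2)^2. With the power (x/2)^n split off, differentiation
  becomes a pure shift of the order n.\<close>

definition bessel_series :: "nat \<Rightarrow> real \<Rightarrow> real" where
  "bessel_series n s = (\<Sum>m. bessel_coeff n m * s ^ m)"

lemma summable_bessel_series: "summable (\<lambda>m. bessel_coeff n m * s ^ m)"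
proof (rule summable_comparison_test')
  show "summable (\<lambda>m. inverse (fact m) * \<bar>s\<bar> ^ m)"
    by (rule summable_exp)
  fix m :: nat
  have "inverse (fact m * fact (m + n)) \<le> inverse (fact m :: real)"
    by (rule le_imp_inverse_le) (simp_all add: mult_le_cancel_left1)
  then have "inverse (fact m * fact (m + n)) * \<bar>s\<bar> ^ m \<le> inverse (fact m) * \<bar>s\<bar> ^ m"
    by (rule mult_right_mono) simp
  then show "norm (bessel_coeff n m * s ^ m) \<le> inverse (fact m) * \<bar>s\<bar> ^ m"
    by (simp add: bessel_coeff_def abs_mult power_abs divide_inverse)
qed

lemma bessel_coeff_Suc: "real (Suc m) * bessel_coeff n (Suc m) = - bessel_coeff (Suc n) m"
proof -
  have "(fact (Suc m) :: real) = real (Suc m) * fact m"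
    by simp
  then show ?thesis
    unfolding bessel_coeff_def by (simp del: of_nat_Suc fact_Suc)
qed

lemma bessel_coeff_contiguous:
  "bessel_coeff 1 (Suc m) - bessel_coeff 2 m = bessel_coeff 0 (Suc m)"
  by (simp add: bessel_coeff_def divide_simps eval_nat_numeral) (simp add: algebra_simps)

lemma bessel_series_deriv:
  "(bessel_series n has_real_derivative - bessel_series (Suc n) s) (at s)"
proof -
  have "((\<lambda>s. \<Sum>m. bessel_coeff n m * s ^ m) has_field_derivative
      (\<Sum>m. diffs (bessel_coeff n) m * s ^ m)) (at s)"
    by (rule termdiffs_strong_converges_everywhere) (rule summable_bessel_series)
  moreover have "diffs (bessel_coeff n) m = - bessel_coeff (Suc n) m" for m
    unfolding diffs_def by (rule bessel_coeff_Suc)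
  ultimately show ?thesis
    by (simp add: bessel_series_def[abs_def] suminf_minus summable_bessel_series)
qed

text \<open>For s = (x/2)^2 this is the recurrence J_0(x) + J_2(x) = (2/x) J_1(x), free of the
  division by x.\<close>

lemma bessel_series_contiguous:
  "bessel_series 1 s - s * bessel_series 2 s = bessel_series 0 s"
proof -
  let ?a = "\<lambda>n m. bessel_coeff n m * s ^ m"
  note sm = summable_bessel_series
  have sm': "summable (\<lambda>m. ?a n (Suc m))" for n
    using sm[of n s] by (subst summable_Suc_iff)
  have "bessel_series 0 s = ?a 0 0 + (\<Sum>m. ?a 0 (Suc m))"
    unfolding bessel_series_def by (subst suminf_split_head[OF sm]) simp
  also have "(\<Sum>m. ?a 0 (Suc m)) = (\<Sum>m. ?a 1 (Suc m) - s * ?a 2 m)"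
    by (simp add: bessel_coeff_contiguous[symmetric] algebra_simps)
  also have "\<dots> = (\<Sum>m. ?a 1 (Suc m)) - s * (\<Sum>m. ?a 2 m)"
    by (subst suminf_diff[symmetric]) (use sm' sm in \<open>simp_all add: suminf_mult summable_mult\<close>)
  finally show ?thesis
    using suminf_split_head[OF sm, of 1 s] unfolding bessel_series_def
    by (simp add: bessel_coeff_def)
qed

lemma bessel_J_eq: "bessel_J n x = (x / 2) ^ n * bessel_series n ((x / 2)\<^sup>2)"
  unfolding bessel_J_def bessel_series_def bessel_coeff_def
  apply (subst suminf_mult[symmetric])
  apply (use summable_bessel_series[of n "(x / 2)\<^sup>2"] in \<open>simp add: bessel_coeff_def\<close>)
  apply (simp add: power_add power_mult[symmetric] mult_ac)
  done

lemma bessel_J_0_0: "bessel_J 0 0 = 1"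
proof -
  have "bessel_series 0 0 = bessel_coeff 0 0"
    unfolding bessel_series_def by (rule powser_zero)
  then show ?thesis
    by (simp add: bessel_J_eq bessel_coeff_def)
qed

lemma bessel_J_0_deriv: "(bessel_J 0 has_real_derivative - bessel_J 1 x) (at x)"
proof -
  have "((\<lambda>x. bessel_series 0 ((x / 2)\<^sup>2)) has_real_derivative
      - bessel_series (Suc 0) ((x / 2)\<^sup>2) * (x / 2)) (at x)"
    by (rule DERIV_chain2[OF bessel_series_deriv]) (auto intro!: derivative_eq_intros)
  then show ?thesis
    by (simp add: bessel_J_eq[abs_def] mult_ac)
qed

text \<open>Together with J_0' = - J_1 this is Bessel's equation of order 0 in flux form. These two
  identities and J_0(0) = 1 are what the later sections use about the Bessel functions.\<close>

lemma bessel_J_1_deriv: "((\<lambda>x. x * bessel_J 1 x) has_real_derivative x * bessel_J 0 x) (at x)"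
proof -
  have "((\<lambda>x. x\<^sup>2 / 2 * bessel_series 1 ((x / 2)\<^sup>2)) has_real_derivative
      x * (bessel_series 1 ((x / 2)\<^sup>2) - (x / 2)\<^sup>2 * bessel_series 2 ((x / 2)\<^sup>2))) (at x)"
    by (auto intro!: derivative_eq_intros DERIV_chain2[OF bessel_series_deriv]
        simp: power2_eq_square field_simps numeral_2_eq_2)
  then show ?thesis
    unfolding bessel_series_contiguous by (simp add: bessel_J_eq[abs_def] power2_eq_square mult_ac)
qed

lemma continuous_on_bessel_J_0: "continuous_on A (bessel_J 0)"
  by (meson DERIV_isCont bessel_J_0_deriv continuous_at_imp_continuous_on)

section \<open>The inverse of the Bessel operator\<close>

text \<open>The inner product for the measure x dx, with respect to which the Bessel operator is
  symmetric.\<close>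

definition wip :: "(real \<Rightarrow> real) \<Rightarrow> (real \<Rightarrow> real) \<Rightarrow> real" where
  "wip v w = integral {0..1} (\<lambda>x. x * v x * w x)"

text \<open>
  \<open>w = green v\<close> is the solution of \<open>- (w'' + w' / x) = v\<close> that is bounded at 0 and has \<open>w 1 = 0\<close>;
  \<open>prim v\<close> is its flux \<open>- x * w'\<close>. At 0 the integrand \<open>prim v s / s\<close> has the junk value 0, which
  is also its limit.
\<close>

definition prim :: "(real \<Rightarrow> real) \<Rightarrow> real \<Rightarrow> real" where
  "prim v s = integral {0..s} (\<lambda>y. y * v y)"

definition green :: "(real \<Rightarrow> real) \<Rightarrow> real \<Rightarrow> real" where
  "green v x = integral {x..1} (\<lambda>s. prim v s / s)"

text \<open>A function that is not integrable has integral 0 by default, so the sign is right in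
  every case and \<open>wip_nonneg\<close> covers arbitrary arguments.\<close>

lemma integral_nonneg_total:
  fixes f :: "real \<Rightarrow> real"
  assumes "\<And>x. x \<in> S \<Longrightarrow> 0 \<le> f x"
  shows "0 \<le> integral S f"
  by (cases "f integrable_on S") (simp_all add: integral_nonneg assms not_integrable_integral)

lemma wip_commute: "wip v w = wip w v"
  by (simp add: wip_def mult_ac)

lemma wip_integrable:
  assumes "continuous_on {0..1} v" "continuous_on {0..1} w"
  shows "(\<lambda>x. x * v x * w x) integrable_on {0..1::real}"
  by (intro integrable_continuous_real continuous_intros assms)

lemma wip_lincomb_left:
  assumes "continuous_on {0..1} u" "continuous_on {0..1} v" "continuous_on {0..1} w"
  shows "wip (\<lambda>x. a * u x + b * v x) w = a * wip u w + b * wip v w"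
proof -
  have "wip (\<lambda>x. a * u x + b * v x) w
      = integral {0..1} (\<lambda>x. a * (x * u x * w x) + b * (x * v x * w x))"
    unfolding wip_def by (rule arg_cong[of _ _ "integral _"]) (auto simp: algebra_simps)
  also have "\<dots> = a * wip u w + b * wip v w"
    unfolding wip_def using assms
    by (subst integral_add) (auto intro!: integrable_on_mult_right wip_integrable)
  finally show ?thesis .
qed

lemma wip_lincomb_right:
  assumes "continuous_on {0..1} u" "continuous_on {0..1} v" "continuous_on {0..1} w"
  shows "wip w (\<lambda>x. a * u x + b * v x) = a * wip w u + b * wip w v"
  using wip_lincomb_left[OF assms] by (simp add: wip_commute[of w])

lemma wip_sum_left:
  assumes "finite F" "\<And>k. k \<in> F \<Longrightarrow> continuous_on {0..1} (v k)" "continuous_on {0..1} w"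
  shows "wip (\<lambda>x. \<Sum>k\<in>F. c k * v k x) w = (\<Sum>k\<in>F. c k * wip (v k) w)"
proof -
  have "wip (\<lambda>x. \<Sum>k\<in>F. c k * v k x) w = integral {0..1} (\<lambda>x. \<Sum>k\<in>F. c k * (x * v k x * w x))"
    unfolding wip_def by (simp add: sum_distrib_left sum_distrib_right mult_ac)
  also have "\<dots> = (\<Sum>k\<in>F. c k * wip (v k) w)"
    unfolding wip_def using assms
    by (subst integral_sum) (auto intro!: integrable_on_mult_right wip_integrable)
  finally show ?thesis .
qed

lemma wip_cong:
  assumes "\<And>x. x \<in> {0..1} \<Longrightarrow> v x = v' x" "\<And>x. x \<in> {0..1} \<Longrightarrow> w x = w' x"
  shows "wip v w = wip v' w'"
  unfolding wip_def by (rule integral_cong) (use assms in auto)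

lemma wip_nonneg: "0 \<le> wip v v"
  unfolding wip_def
  by (rule integral_nonneg_total) (auto simp: mult.assoc)

lemma wip_bound:
  assumes "continuous_on {0..1} v" "continuous_on {0..1} w"
    and "\<And>x. x \<in> {0..1} \<Longrightarrow> \<bar>v x\<bar> \<le> A" "\<And>x. x \<in> {0..1} \<Longrightarrow> \<bar>w x\<bar> \<le> B"
  shows "\<bar>wip v w\<bar> \<le> A * B"
proof -
  have "0 \<le> A" using assms(3)[of 0] by simp
  have "norm (integral {0..1} (\<lambda>x. x * v x * w x)) \<le> integral {0..1} (\<lambda>x::real. A * B)"
  proof (rule integral_norm_bound_integral)
    fix x :: real assume x: "x \<in> {0..1}"
    have "\<bar>x * v x\<bar> * \<bar>w x\<bar> \<le> (1 * A) * B"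
      using x assms(3,4)[OF x] \<open>0 \<le> A\<close> unfolding abs_mult by (intro mult_mono) auto
    then show "norm (x * v x * w x) \<le> A * B" by (simp add: abs_mult)
  qed (auto intro!: wip_integrable assms)
  then show ?thesis by (simp add: wip_def)
qed

text \<open>The weight kills the integrand at 0, so \<open>v\<close> is first seen to vanish on the
  open interval and then at the endpoints by continuity.\<close>

lemma wip_eq_0D:
  assumes v: "continuous_on {0..1} v" and 0: "wip v v = 0" and x: "x \<in> {0..1}"
  shows "v x = 0"
proof -
  have "v y = 0" if "y \<in> {0<..<1}" for y
  proof -
    have "\<forall>x\<in>{0..1}. x * v x * v x = 0"
    proof (subst integral_eq_0_iff[symmetric])
      show "continuous_on {0..1} (\<lambda>x. x * v x * v x)"
        by (intro continuous_intros v)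
    qed (use 0 in \<open>auto simp: wip_def mult.assoc\<close>)
    then have "y * v y * v y = 0"
      using that by (meson atLeastAtMost_iff greaterThanLessThan_iff less_imp_le)
    then show ?thesis using that by simp
  qed
  then show ?thesis
    using continuous_constant_on_closure[of "{0<..<1}" v 0 x] v x by simp
qed

lemma continuous_bounded_01:
  fixes v :: "real \<Rightarrow> real"
  assumes "continuous_on {0..1} v"
  obtains B where "0 \<le> B" "\<And>x. x \<in> {0..1} \<Longrightarrow> \<bar>v x\<bar> \<le> B"
proof -
  have "bounded (v ` {0..1})"
    by (intro compact_imp_bounded compact_continuous_image assms) simp
  then obtain B where "\<forall>x\<in>v ` {0..1}. norm x \<le> B" unfolding bounded_iff by blast
  moreover from this have "0 \<le> B" by (force intro: order_trans[OF abs_ge_zero])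
  ultimately show ?thesis using that by auto
qed

context
  fixes v :: "real \<Rightarrow> real"
  assumes v: "continuous_on {0..1} v"
begin

lemma prim_deriv:
  "x \<in> {0..1} \<Longrightarrow> (prim v has_real_derivative x * v x) (at x within {0..1})"
  unfolding prim_def by (rule integral_has_real_derivative) (auto intro!: continuous_intros v)

lemma continuous_on_prim: "continuous_on {0..1} (prim v)"
  by (rule DERIV_continuous_on[OF prim_deriv])

lemma prim_bound:
  assumes B: "\<And>x. x \<in> {0..1} \<Longrightarrow> \<bar>v x\<bar> \<le> B" and s: "s \<in> {0..1}"
  shows "\<bar>prim v s\<bar> \<le> s\<^sup>2 * B"
proof -
  have "norm (integral {0..s} (\<lambda>y. y * v y)) \<le> integral {0..s} (\<lambda>y. s * B)"
  proof (rule integral_norm_bound_integral)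
    show "(\<lambda>y. y * v y) integrable_on {0..s}"
      using s by (auto intro!: integrable_continuous_real continuous_intros
          continuous_on_subset[OF v])
    fix y assume "y \<in> {0..s}"
    then show "norm (y * v y) \<le> s * B"
      using s B[of y] by (auto simp: abs_mult intro!: mult_mono)
  qed auto
  then show ?thesis using s by (simp add: prim_def power2_eq_square mult_ac)
qed

text \<open>Cauchy-Schwarz between \<open>v\<close> and a constant in the measure y dy on [0,s],
  whose mass is s^2/2. Control of the flux by the weighted norm alone is the source of every bound
  on \<open>green\<close>.\<close>

lemma prim_square_bound:
  assumes s: "s \<in> {0..1}"
  shows "(prim v s)\<^sup>2 \<le> s\<^sup>2 * wip v v"
proof (cases "s = 0")
  case True
  then show ?thesis by (simp add: prim_def)
next
  case False
  with s have s: "0 < s" "s \<le> 1" by auto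
  \<comment> \<open>The mean of \<open>v\<close> over [0,s] in the measure y dy: among all constants
    it makes the integral of y (v - c)^2 smallest.\<close>
  define c where "c = 2 * prim v s / s\<^sup>2"
  have vs: "continuous_on {0..s} v" using s by (intro continuous_on_subset[OF v]) auto
  have int: "(\<lambda>y. y * v y) integrable_on {0..s}" "(\<lambda>y. y * v y * v y) integrable_on {0..s}"
    "(\<lambda>y::real. y) integrable_on {0..s}"
    by (intro integrable_continuous_real continuous_intros vs)+
  have "0 \<le> integral {0..s} (\<lambda>y. y * (v y - c)\<^sup>2)"
    by (rule integral_nonneg_total) auto
  also have "\<dots> = integral {0..s} (\<lambda>y. y * v y * v y + (- 2 * c) * (y * v y) + c\<^sup>2 * y)"
    by (rule arg_cong[of _ _ "integral _"]) (auto simp: power2_eq_square algebra_simps)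
  also have "\<dots> = integral {0..s} (\<lambda>y. y * v y * v y) - 2 * c * prim v s + c\<^sup>2 * (s\<^sup>2 / 2)"
  proof (rule integral_unique)
    have "((\<lambda>y. y * v y * v y + (- 2 * c) * (y * v y) + c\<^sup>2 * y) has_integral
        integral {0..s} (\<lambda>y. y * v y * v y) + (- 2 * c) * prim v s + c\<^sup>2 * ((s\<^sup>2 - 0\<^sup>2) / 2)) {0..s}"
      unfolding prim_def using s int
      by (intro has_integral_add has_integral_mult_right ident_has_integral integrable_integral) auto
    then show "((\<lambda>y. y * v y * v y + (- 2 * c) * (y * v y) + c\<^sup>2 * y) has_integral
        integral {0..s} (\<lambda>y. y * v y * v y) - 2 * c * prim v s + c\<^sup>2 * (s\<^sup>2 / 2)) {0..s}"
      by simp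
  qed
  also have "\<dots> = integral {0..s} (\<lambda>y. y * v y * v y) - 2 * (prim v s)\<^sup>2 / s\<^sup>2"
    using s by (simp add: c_def field_simps power2_eq_square)
  also have "integral {0..s} (\<lambda>y. y * v y * v y) \<le> wip v v"
    unfolding wip_def using s
    by (intro integral_subset_le wip_integrable v int) (auto simp: mult.assoc)
  finally show ?thesis
    using s wip_nonneg[of v] by (simp add: field_simps) (smt (verit) mult_nonneg_nonneg zero_le_power2)
qed

lemma continuous_on_prim_div: "continuous_on {0..1} (\<lambda>s. prim v s / s)"
proof -
  obtain B where B: "0 \<le> B" "\<And>x. x \<in> {0..1} \<Longrightarrow> \<bar>v x\<bar> \<le> B"
    using continuous_bounded_01[OF v] by metis
  have "((\<lambda>s. prim v s / s) \<longlongrightarrow> prim v x / x) (at x within {0..1})" if x: "x \<in> {0..1}" for x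
  proof (cases "x = 0")
    case False
    then show ?thesis
      using continuous_on_prim x by (auto intro!: tendsto_intros simp: continuous_on_def)
  next
    case True
    have "((\<lambda>s. prim v s / s) \<longlongrightarrow> 0) (at 0 within {0..1})"
    proof (rule Lim_null_comparison)
      show "((\<lambda>s. B * s) \<longlongrightarrow> 0) (at 0 within {0..1})"
        by (auto intro!: tendsto_eq_intros)
      show "\<forall>\<^sub>F s in at 0 within {0..1}. norm (prim v s / s) \<le> B * s"
        using prim_bound[of B] B(2)
        by (auto simp: eventually_at_filter divide_simps power2_eq_square mult_ac)
    qed
    then show ?thesis using True by simp
  qed
  then show ?thesis by (simp add: continuous_on_def)
qed

lemma green_deriv:
  "x \<in> {0..1} \<Longrightarrow> (green v has_real_derivative - (prim v x / x)) (at x within {0..1})"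
  unfolding green_def by (rule integral_has_real_derivative') (auto intro!: continuous_on_prim_div)

lemma continuous_on_green: "continuous_on {0..1} (green v)"
  by (rule DERIV_continuous_on[OF green_deriv])

lemma green_1: "green v 1 = 0"
  by (simp add: green_def)

lemma abs_prim_div: "s \<in> {0..1} \<Longrightarrow> \<bar>prim v s / s\<bar> \<le> sqrt (wip v v)"
proof (cases "s = 0")
  case False
  assume "s \<in> {0..1}"
  then have "(prim v s / s)\<^sup>2 \<le> wip v v"
    using prim_square_bound[of s] False by (simp add: power_divide field_simps)
  then show ?thesis using real_sqrt_le_mono by fastforce
qed (simp add: wip_nonneg)

text \<open>The slope of \<open>green v\<close> is bounded by the weighted norm of \<open>v\<close>,
  uniformly in x. This is the equicontinuity fed into Arzela-Ascoli, and with
  \<open>green v 1 = 0\<close> it yields the sup-norm bound.\<close>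

lemma green_lipschitz:
  assumes "x \<in> {0..1}" "x' \<in> {0..1}"
  shows "\<bar>green v x - green v x'\<bar> \<le> sqrt (wip v v) * \<bar>x - x'\<bar>"
proof -
  have "norm (green v x - green v x') \<le> sqrt (wip v v) * norm (x - x')"
    by (rule field_differentiable_bound[of "{0..1}" _ "\<lambda>x. - (prim v x / x)"])
      (use assms green_deriv abs_prim_div in \<open>auto simp: divide_inverse\<close>)
  then show ?thesis by simp
qed

lemma green_bound:
  assumes "x \<in> {0..1}"
  shows "\<bar>green v x\<bar> \<le> sqrt (wip v v)"
proof -
  have "\<bar>green v x\<bar> \<le> sqrt (wip v v) * \<bar>x - 1\<bar>"
    using green_lipschitz[of x 1] assms by (simp add: green_1)
  also have "\<dots> \<le> sqrt (wip v v) * 1"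
    using assms by (intro mult_left_mono) (auto simp: wip_nonneg)
  finally show ?thesis by simp
qed

end

text \<open>The product \<open>green v x * prim w x\<close> vanishes at both ends, so integrating
  its derivative leaves an energy form that is visibly symmetric and positive.\<close>

lemma wip_green:
  assumes v: "continuous_on {0..1} v" and w: "continuous_on {0..1} w"
  shows "wip (green v) w = integral {0..1} (\<lambda>x. prim v x * prim w x / x)"
proof -
  have "((\<lambda>x. - (prim v x / x) * prim w x + green v x * (x * w x)) has_integral
      green v 1 * prim w 1 - green v 0 * prim w 0) {0..1}"
    by (rule fundamental_theorem_of_calculus)
      (auto simp: has_real_derivative_iff_has_vector_derivative[symmetric]
        intro!: derivative_eq_intros prim_deriv v w green_deriv)
  then have "integral {0..1} (\<lambda>x. - (prim v x / x) * prim w x + green v x * (x * w x)) = 0"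
    by (simp add: integral_unique green_1 v prim_def)
  moreover have "(\<lambda>x. prim v x / x * prim w x) integrable_on {0..1}"
    "(\<lambda>x. green v x * (x * w x)) integrable_on {0..1}"
    by (intro integrable_continuous_real continuous_intros continuous_on_prim_div
        continuous_on_prim continuous_on_green v w)+
  ultimately show ?thesis
    using integral_diff[of "\<lambda>x. green v x * (x * w x)" "{0..1}" "\<lambda>x. prim v x / x * prim w x"]
    by (simp add: wip_def mult_ac)
qed

lemma wip_green_sym:
  assumes "continuous_on {0..1} v" "continuous_on {0..1} w"
  shows "wip (green v) w = wip v (green w)"
  using wip_green[OF assms] wip_green[OF assms(2,1)] by (simp add: wip_commute[of v] mult_ac)

lemma wip_green_nonneg:
  assumes "continuous_on {0..1} v"
  shows "0 \<le> wip (green v) v"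
  unfolding wip_green[OF assms assms] by (rule integral_nonneg_total) (auto simp: mult.assoc)

lemma prim_mult_div_integrable:
  assumes v: "continuous_on {0..1} v" and w: "continuous_on {0..1} w"
  shows "continuous_on {0..1} (\<lambda>x. prim v x * prim w x / x)"
proof -
  have "continuous_on {0..1} (\<lambda>x. prim v x / x * prim w x)"
    by (intro continuous_intros continuous_on_prim_div continuous_on_prim assms)
  then show ?thesis by (simp add: mult_ac)
qed

lemma wip_green_le:
  assumes v: "continuous_on {0..1} v"
  shows "wip (green v) v \<le> wip v v"
proof -
  have "integral {0..1} (\<lambda>x. prim v x * prim v x / x) \<le> integral {0..1} (\<lambda>x::real. wip v v)"
  proof (rule integral_le)
    fix x :: real assume x: "x \<in> {0..1}"
    show "prim v x * prim v x / x \<le> wip v v"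
    proof (cases "x = 0")
      case False
      then have "prim v x * prim v x / x \<le> x * wip v v"
        using prim_square_bound[OF v x] x by (simp add: power2_eq_square field_simps)
      also have "\<dots> \<le> 1 * wip v v" using x by (intro mult_right_mono) (auto simp: wip_nonneg)
      finally show ?thesis by simp
    qed (simp add: wip_nonneg)
  qed (auto intro!: integrable_continuous_real prim_mult_div_integrable v)
  then show ?thesis by (simp add: wip_green v)
qed

text \<open>Zero energy forces the flux to vanish, and the derivative of the flux is x v(x).\<close>

lemma wip_green_eq_0D:
  assumes v: "continuous_on {0..1} v" and 0: "wip (green v) v = 0" and x: "x \<in> {0..1}"
  shows "v x = 0"
proof -
  have p0: "prim v y = 0" if "y \<in> {0<..<1}" for y
  proof -
    have "\<forall>x\<in>{0..1}. prim v x * prim v x / x = 0"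
      by (subst integral_eq_0_iff[symmetric])
        (use 0 in \<open>auto intro: prim_mult_div_integrable[OF v v] simp: wip_green[OF v v]\<close>)
    then have "prim v y * prim v y / y = 0"
      using that by (meson atLeastAtMost_iff greaterThanLessThan_iff less_imp_le)
    then show ?thesis using that by simp
  qed
  have "v y = 0" if y: "y \<in> {0<..<1}" for y
  proof -
    have "(prim v has_real_derivative 0) (at y)"
      by (rule has_field_derivative_transform_within_open[where f = "\<lambda>_. 0" and S = "{0<..<1}"])
        (use y p0 in auto)
    moreover have "(prim v has_real_derivative y * v y) (at y)"
      using prim_deriv[OF v, of y] y by (simp add: at_within_Icc_at)
    ultimately have "y * v y = 0" by (rule DERIV_unique[symmetric])
    then show ?thesis using y by simp
  qed
  then show ?thesis
    using continuous_constant_on_closure[of "{0<..<1}" v 0 x] v x by simp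
qed

lemma prim_lincomb:
  assumes "continuous_on {0..1} u" "continuous_on {0..1} v" "s \<in> {0..1}"
  shows "prim (\<lambda>x. a * u x + b * v x) s = a * prim u s + b * prim v s"
proof -
  have c: "continuous_on {0..s} u" "continuous_on {0..s} v"
    using assms by (auto intro: continuous_on_subset)
  have "prim (\<lambda>x. a * u x + b * v x) s
      = integral {0..s} (\<lambda>x. a * (x * u x) + b * (x * v x))"
    unfolding prim_def by (rule arg_cong[of _ _ "integral _"]) (auto simp: algebra_simps)
  also have "\<dots> = a * prim u s + b * prim v s"
    unfolding prim_def
    by (subst integral_add)
      (auto intro!: integrable_on_mult_right integrable_continuous_real continuous_intros c)
  finally show ?thesis .
qed

lemma green_lincomb:
  assumes u: "continuous_on {0..1} u" and v: "continuous_on {0..1} v" and x: "x \<in> {0..1}"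
  shows "green (\<lambda>x. a * u x + b * v x) x = a * green u x + b * green v x"
proof -
  have c: "continuous_on {x..1} (\<lambda>s. prim u s / s)" "continuous_on {x..1} (\<lambda>s. prim v s / s)"
    using x by (auto intro: continuous_on_subset[OF continuous_on_prim_div] u v)
  have "green (\<lambda>x. a * u x + b * v x) x
      = integral {x..1} (\<lambda>s. a * (prim u s / s) + b * (prim v s / s))"
    unfolding green_def
    by (rule integral_cong) (use x in \<open>auto simp: prim_lincomb u v add_divide_distrib\<close>)
  also have "\<dots> = a * green u x + b * green v x"
    unfolding green_def
    by (subst integral_add) (auto intro!: integrable_on_mult_right integrable_continuous_real c
        continuous_on_mult_const continuous_on_mult simp del: times_divide_eq_right)
  finally show ?thesis .
qed

lemma green_sum:
  assumes "finite F" "\<And>k. k \<in> F \<Longrightarrow> continuous_on {0..1} (v k)" "x \<in> {0..1}"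
  shows "green (\<lambda>x. \<Sum>k\<in>F. c k * v k x) x = (\<Sum>k\<in>F. c k * green (v k) x)"
  using assms
proof (induction F rule: finite_induct)
  case empty
  then show ?case by (simp add: green_def prim_def)
next
  case (insert k F)
  then show ?case
    using green_lincomb[of "v k" "\<lambda>x. \<Sum>k\<in>F. c k * v k x" x "c k" 1]
    by (simp add: continuous_on_sum continuous_on_mult)
qed

section \<open>Eigenfunctions\<close>

lemma continuous_on_bessel_mode: "continuous_on A (\<lambda>x. bessel_J 0 (l * x))"
  by (rule continuous_on_compose2[OF continuous_on_bessel_J_0[of UNIV]]) (auto intro!: continuous_intros)

lemma bessel_mode_deriv:
  "((\<lambda>x. bessel_J 0 (l * x)) has_real_derivative - l * bessel_J 1 (l * x)) (at x within A)"
proof -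
  have "((\<lambda>x. bessel_J 0 (l * x)) has_real_derivative - bessel_J 1 (l * x) * l) (at x within A)"
    by (rule DERIV_chain2[OF bessel_J_0_deriv]) (auto intro!: derivative_eq_intros)
  then show ?thesis by (simp add: mult_ac)
qed

lemma bessel_mode_flux_deriv:
  assumes "l \<noteq> 0"
  shows "((\<lambda>x. x * bessel_J 1 (l * x)) has_real_derivative l * x * bessel_J 0 (l * x)) (at x within A)"
proof -
  have "((\<lambda>x. (l * x) * bessel_J 1 (l * x)) has_real_derivative
      ((l * x) * bessel_J 0 (l * x)) * l) (at x within A)"
    by (rule DERIV_chain2[OF bessel_J_1_deriv]) (auto intro!: derivative_eq_intros)
  then have "((\<lambda>x. (l * x) * bessel_J 1 (l * x) / l) has_real_derivative
      ((l * x) * bessel_J 0 (l * x)) * l / l) (at x within A)"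
    by (rule DERIV_cdivide)
  then show ?thesis using assms by (simp add: mult_ac)
qed

lemma prim_bessel_mode:
  assumes "l \<noteq> 0" "0 \<le> s"
  shows "prim (\<lambda>x. bessel_J 0 (l * x)) s = s * bessel_J 1 (l * s) / l"
proof -
  have "((\<lambda>y. l * y * bessel_J 0 (l * y)) has_integral
      s * bessel_J 1 (l * s) - 0 * bessel_J 1 (l * 0)) {0..s}"
    using assms by (intro fundamental_theorem_of_calculus)
      (auto simp: has_real_derivative_iff_has_vector_derivative[symmetric]
        intro!: bessel_mode_flux_deriv simp del: One_nat_def)
  then have "integral {0..s} (\<lambda>y. l * (y * bessel_J 0 (l * y))) = s * bessel_J 1 (l * s)"
    unfolding mult.assoc by (metis diff_zero integral_unique mult_zero_left)
  then have "l * prim (\<lambda>x. bessel_J 0 (l * x)) s = s * bessel_J 1 (l * s)"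
    unfolding prim_def integral_mult_right .
  then show ?thesis using assms by (simp add: field_simps)
qed

lemma green_bessel_mode:
  assumes l: "l \<noteq> 0" "bessel_J 0 l = 0" and x: "x \<in> {0..1}"
  shows "green (\<lambda>x. bessel_J 0 (l * x)) x = bessel_J 0 (l * x) / l\<^sup>2"
proof -
  have "((\<lambda>s. - l * bessel_J 1 (l * s)) has_integral
      bessel_J 0 (l * 1) - bessel_J 0 (l * x)) {x..1}"
    using x by (intro fundamental_theorem_of_calculus)
      (auto simp: has_real_derivative_iff_has_vector_derivative[symmetric]
        intro!: bessel_mode_deriv[simplified])
  then have *: "integral {x..1} (\<lambda>s. - (l * bessel_J 1 (l * s))) = - bessel_J 0 (l * x)"
    unfolding mult_minus_left mult_1_right l(2) diff_0 by (rule integral_unique)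
  have "green (\<lambda>x. bessel_J 0 (l * x)) x
      = integral {x..1} (\<lambda>s. - (1 / l\<^sup>2) * - (l * bessel_J 1 (l * s)))"
    unfolding green_def
  proof (rule integral_spike[of "{0}"])
    fix s assume "s \<in> {x..1} - {0}"
    then show "- (1 / l\<^sup>2) * - (l * bessel_J 1 (l * s)) = prim (\<lambda>x. bessel_J 0 (l * x)) s / s"
      using x l by (simp add: prim_bessel_mode power2_eq_square)
  qed auto
  also have "\<dots> = - (1 / l\<^sup>2) * - bessel_J 0 (l * x)"
    by (simp only: integral_mult_right *)
  finally show ?thesis by simp
qed

lemma wip_green_bessel_mode:
  assumes l: "l \<noteq> 0" "bessel_J 0 l = 0" and v: "continuous_on {0..1} v"
  shows "wip (green v) (\<lambda>x. bessel_J 0 (l * x)) = wip v (\<lambda>x. bessel_J 0 (l * x)) / l\<^sup>2"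
proof -
  have "wip (green v) (\<lambda>x. bessel_J 0 (l * x)) = wip v (green (\<lambda>x. bessel_J 0 (l * x)))"
    by (rule wip_green_sym[OF v continuous_on_bessel_mode])
  also have "\<dots> = wip v (\<lambda>x. (1 / l\<^sup>2) * bessel_J 0 (l * x) + 0 * bessel_J 0 (l * x))"
    by (rule wip_cong) (auto simp: green_bessel_mode l)
  also have "\<dots> = wip v (\<lambda>x. bessel_J 0 (l * x)) / l\<^sup>2"
    by (subst wip_lincomb_right) (auto intro!: v continuous_on_bessel_mode)
  finally show ?thesis .
qed

text \<open>The antiderivative is Lommel's x^2 (J_0^2 + J_1^2) / 2 at l x; at x = 1 the term with
  J_0 drops out. It shows that the factor 2 / J_1(l)^2 in \<open>fourier_bessel_coeff\<close> is the
  inverse squared norm of the mode.\<close>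

lemma wip_bessel_mode_self:
  assumes "l \<noteq> 0" "bessel_J 0 l = 0"
  shows "wip (\<lambda>x. bessel_J 0 (l * x)) (\<lambda>x. bessel_J 0 (l * x)) = (bessel_J 1 l)\<^sup>2 / 2"
proof -
  let ?F = "\<lambda>x. (x\<^sup>2 * (bessel_J 0 (l * x))\<^sup>2 + (x * bessel_J 1 (l * x))\<^sup>2) / 2"
  have "((\<lambda>x. x * bessel_J 0 (l * x) * bessel_J 0 (l * x)) has_integral ?F 1 - ?F 0) {0..1}"
  proof (rule fundamental_theorem_of_calculus)
    fix x :: real
    have "((\<lambda>x. (x\<^sup>2 * (bessel_J 0 (l * x))\<^sup>2 + (x * bessel_J 1 (l * x))\<^sup>2) / 2)
      has_real_derivative
        ((2 * x) * (bessel_J 0 (l * x))\<^sup>2 + (2 * ((- l * bessel_J 1 (l * x)) * bessel_J 0 (l * x))) * x\<^sup>2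
          + 2 * ((l * x * bessel_J 0 (l * x)) * (x * bessel_J 1 (l * x)))) / 2) (at x within {0..1})"
      using DERIV_power[OF bessel_mode_deriv[of l x "{0..1}"], of 2]
        DERIV_power[OF bessel_mode_flux_deriv[OF assms(1), of x "{0..1}"], of 2]
        DERIV_power[OF DERIV_ident[of "at x within {0..1}"], of 2]
      by (intro DERIV_cdivide DERIV_add DERIV_mult) (simp_all del: One_nat_def)
    then have "(?F has_real_derivative x * bessel_J 0 (l * x) * bessel_J 0 (l * x)) (at x within {0..1})"
      by (rule DERIV_cong) (simp add: power2_eq_square algebra_simps)
    then show "(?F has_vector_derivative x * bessel_J 0 (l * x) * bessel_J 0 (l * x))
        (at x within {0..1})"
      by (simp add: has_real_derivative_iff_has_vector_derivative)
  qed simp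
  then show ?thesis using assms by (simp add: wip_def integral_unique)
qed

text \<open>Positivity comes from the value 1 of the mode at the origin and continuity, for every
  \<open>l\<close>.\<close>

lemma wip_bessel_mode_pos: "0 < wip (\<lambda>x. bessel_J 0 (l * x)) (\<lambda>x. bessel_J 0 (l * x))"
proof -
  have "wip (\<lambda>x. bessel_J 0 (l * x)) (\<lambda>x. bessel_J 0 (l * x)) \<noteq> 0"
    using wip_eq_0D[OF continuous_on_bessel_mode, of l 0] by (auto simp: bessel_J_0_0)
  then show ?thesis
    using wip_nonneg[of "\<lambda>x. bessel_J 0 (l * x)"] by linarith
qed

lemma bessel_modes_orthogonal:
  assumes "0 < l" "0 < m" "bessel_J 0 l = 0" "bessel_J 0 m = 0" "l \<noteq> m"
  shows "wip (\<lambda>x. bessel_J 0 (l * x)) (\<lambda>x. bessel_J 0 (m * x)) = 0"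
proof -
  let ?w = "wip (\<lambda>x. bessel_J 0 (l * x)) (\<lambda>x. bessel_J 0 (m * x))"
  have "?w / m\<^sup>2 = wip (green (\<lambda>x. bessel_J 0 (l * x))) (\<lambda>x. bessel_J 0 (m * x))"
    using assms by (subst wip_green_bessel_mode) (auto intro!: continuous_on_bessel_mode)
  also have "\<dots> = wip (green (\<lambda>x. bessel_J 0 (m * x))) (\<lambda>x. bessel_J 0 (l * x))"
    by (subst wip_green_sym) (auto intro!: continuous_on_bessel_mode simp: wip_commute)
  also have "\<dots> = ?w / l\<^sup>2"
    using assms by (subst wip_green_bessel_mode) (auto intro!: continuous_on_bessel_mode simp: wip_commute)
  finally have "?w * (l\<^sup>2 - m\<^sup>2) = 0"
    using assms by (simp add: field_simps)
  moreover have "l\<^sup>2 \<noteq> m\<^sup>2" using assms by (simp add: power2_eq_iff)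
  ultimately show ?thesis by simp
qed


section \<open>Completeness\<close>

text \<open>
  The energy \<open>D'\<^sup>2 + D\<^sup>2 / r\<close> of the difference \<open>D\<close> of two eigenfunctions with the same value
  at 0 is nonincreasing and starts at 0.
\<close>

lemma green_eigenfunction:
  assumes y: "continuous_on {0..1} y" and r: "0 < r"
    and eig: "\<And>x. x \<in> {0..1} \<Longrightarrow> green y x = r * y x" and x: "x \<in> {0..1}"
  shows "y x = y 0 * bessel_J 0 (x / sqrt r)"
proof -
  define \<mu> where "\<mu> = 1 / sqrt r"
  have \<mu>: "\<mu> \<noteq> 0" "\<mu> * \<mu> = 1 / r" using r by (simp_all add: \<mu>_def)
  let ?\<phi> = "\<lambda>x. bessel_J 0 (\<mu> * x)"
  \<comment> \<open>The factor 1 gives the shape a * u + b * v of the linearity lemmas; the same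
    device recurs below.\<close>
  define D where "D = (\<lambda>x. 1 * y x + (- y 0) * ?\<phi> x)"
  have D: "continuous_on {0..1} D"
    unfolding D_def by (intro continuous_intros y continuous_on_bessel_mode)
  \<comment> \<open>By the eigenvalue equation this is - r times the derivative of \<open>D\<close>,
    but defined and continuous up to 0.\<close>
  define K where "K = (\<lambda>x. prim D x / x)"
  have K: "continuous_on {0..1} K"
    unfolding K_def by (rule continuous_on_prim_div[OF D])
  have dD: "(D has_real_derivative - K x / r) (at x)" if x: "x \<in> {0<..<1}" for x
  proof -
    have at: "at x within {0..1} = at x" using x by (simp add: at_within_Icc_at)
    have "((\<lambda>x. green y x / r) has_real_derivative - (prim y x / x) / r) (at x)"
      using DERIV_cdivide[OF green_deriv[OF y, of x]] x at by simp
    then have "(y has_real_derivative - (prim y x / x) / r) (at x)"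
      by (rule has_field_derivative_transform_within_open[where S = "{0<..<1}"])
        (use x r eig in auto)
    moreover have "(?\<phi> has_real_derivative - (prim ?\<phi> x / x) / r) (at x)"
    proof (rule DERIV_cong[OF bessel_mode_deriv])
      have "\<mu> * r * \<mu> = (\<mu> * \<mu>) * r" by (simp add: mult_ac)
      also have "\<dots> = 1" using \<mu> r by simp
      finally have "\<mu> * r * \<mu> = 1" .
      then show "- \<mu> * bessel_J 1 (\<mu> * x) = - (prim ?\<phi> x / x) / r"
        using x \<mu> r by (subst prim_bessel_mode) (auto simp: field_simps simp del: One_nat_def)
    qed
    ultimately have "(D has_real_derivative 1 * (- (prim y x / x) / r) + (- y 0) * (- (prim ?\<phi> x / x) / r)) (at x)"
      unfolding D_def by (intro DERIV_add DERIV_cmult)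
    moreover have "prim D x = 1 * prim y x + (- y 0) * prim ?\<phi> x"
      unfolding D_def using x by (intro prim_lincomb y continuous_on_bessel_mode) auto
    ultimately show ?thesis
      by (elim DERIV_cong) (simp add: K_def diff_divide_distrib)
  qed
  have dK: "(K has_real_derivative D x - K x / x) (at x)" if x: "x \<in> {0<..<1}" for x
  proof -
    have at: "at x within {0..1} = at x" using x by (simp add: at_within_Icc_at)
    have "(K has_real_derivative (x * D x * x - prim D x * 1) / (x * x)) (at x)"
      unfolding K_def using prim_deriv[OF D, of x] x at by (intro DERIV_divide) auto
    then show ?thesis
      by (rule DERIV_cong) (use x in \<open>simp add: K_def field_simps\<close>)
  qed
  \<comment> \<open>This is r times the energy D'^2 + D^2 / r. The term with 1/x acts as friction,
    which is why its derivative is - 2 K^2 / (r x).\<close>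
  define E where "E = (\<lambda>x. (K x)\<^sup>2 / r + (D x)\<^sup>2)"
  have "E x \<le> E 0"
  proof (cases "x = 0")
    case False
    then have x0: "0 < x" using x by simp
    have cE: "continuous_on {0..x} E"
      unfolding E_def by (rule continuous_on_subset[of "{0..1}"])
        (use x r in \<open>auto intro!: continuous_intros K D\<close>)
    have dE: "(E has_real_derivative - 2 * (K z)\<^sup>2 / (r * z)) (at z)" if z: "0 < z" "z < x" for z
    proof -
      have z': "z \<in> {0<..<1}" using z x by auto
      have "(E has_real_derivative
          2 * ((D z - K z / z) * K z) / r + 2 * (- K z / r * D z)) (at z)"
        unfolding E_def
        using DERIV_power[OF dK[OF z'], of 2] DERIV_power[OF dD[OF z'], of 2]
        by (intro DERIV_add DERIV_cdivide) simp_all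
      then show ?thesis
        by (rule DERIV_cong) (use z r in \<open>simp add: field_simps power2_eq_square\<close>)
    qed
    obtain l z where z: "0 < z" "z < x" "DERIV E z :> l" "E x - E 0 = (x - 0) * l"
      using MVT[OF x0 cE] dE by (metis real_differentiable_def)
    then have "l = - 2 * (K z)\<^sup>2 / (r * z)" using dE DERIV_unique by blast
    then have "l \<le> 0" using z r by (simp add: divide_nonpos_pos)
    then show ?thesis using z(4) x0 mult_nonneg_nonpos[of x l] by simp
  qed simp
  \<comment> \<open>\<open>K 0\<close> is a quotient by 0, hence 0, in agreement with the limit;
    \<open>D 0 = 0\<close> since the mode equals 1 at the origin.\<close>
  also have "E 0 = 0" by (simp add: E_def K_def D_def bessel_J_0_0)
  finally have "(D x)\<^sup>2 \<le> 0"
    unfolding E_def using r by (smt (verit) divide_nonneg_pos zero_le_power2)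
  then have "D x = 0" by simp
  then show ?thesis by (simp add: D_def \<mu>_def)
qed

text \<open>Continuous functions with the weighted norm are not complete, so a maximizing sequence
  itself need not converge there; its images under \<open>green\<close> do, uniformly along a
  subsequence. The limit is an eigenfunction, hence a multiple of a mode. Since
  \<open>green y\<close> vanishes at 1, the frequency of that mode is a zero of J_0, and the limit
  would be orthogonal to itself.\<close>

lemma bessel_modes_complete:
  assumes v: "continuous_on {0..1} v"
    and orth: "\<And>l. 0 < l \<Longrightarrow> bessel_J 0 l = 0 \<Longrightarrow> wip v (\<lambda>x. bessel_J 0 (l * x)) = 0"
    and x: "x \<in> {0..1}"
  shows "v x = 0"
proof (rule ccontr)
  assume vx: "v x \<noteq> 0"
  define M where "M = {v. continuous_on {0..1} v \<and>
    (\<forall>l. 0 < l \<longrightarrow> bessel_J 0 l = 0 \<longrightarrow> wip v (\<lambda>x. bessel_J 0 (l * x)) = 0)}"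
  have M_cont: "continuous_on {0..1} u" if "u \<in> M" for u
    using that by (simp add: M_def)
  have M_lin: "(\<lambda>x. a * u x + b * w x) \<in> M" if "u \<in> M" "w \<in> M" for a b u w
    using that by (auto simp: M_def wip_lincomb_left continuous_on_bessel_mode intro!: continuous_intros)
  have M_green: "green u \<in> M" if "u \<in> M" for u
    using that by (auto simp: M_def wip_green_bessel_mode continuous_on_green)
  have vM: "v \<in> M" using v orth by (simp add: M_def)
  define S where "S = {wip (green u) u | u. u \<in> M \<and> wip u u = 1}"
  define r where "r = Sup S"
  have bdd: "bdd_above S"
    unfolding S_def by (rule bdd_aboveI[of _ 1]) (use wip_green_le M_cont in fastforce)
  have scale: "wip (green u) u / wip u u \<in> S" if u: "u \<in> M" "wip u u \<noteq> 0" for u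
  proof -
    define c where "c = 1 / sqrt (wip u u)"
    have cc: "c * c = 1 / wip u u" using wip_nonneg[of u] by (simp add: c_def)
    let ?u = "\<lambda>x. c * u x + 0 * u x"
    note cu = M_cont[OF u(1)]
    have cu': "continuous_on {0..1} ?u" by (intro continuous_intros cu)
    have "wip ?u ?u = c * c * wip u u"
      using cu cu' by (simp only: wip_lincomb_left wip_lincomb_right) simp
    moreover have "wip (green ?u) ?u = wip (\<lambda>x. c * green u x + 0 * green u x) ?u"
      using green_lincomb[OF cu cu, of _ c 0] by (intro wip_cong) auto
    then have "wip (green ?u) ?u = c * c * wip (green u) u"
      using cu cu' continuous_on_green[OF cu] by (simp only: wip_lincomb_left wip_lincomb_right) simp
    ultimately show ?thesis
      unfolding S_def using u M_lin[OF u(1) u(1), of c 0] cc by (auto intro!: exI[of _ ?u])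
  qed
  have Q: "wip (green u) u \<le> r * wip u u" if u: "u \<in> M" for u
  proof (cases "wip u u = 0")
    case True
    then show ?thesis using wip_green_le[OF M_cont[OF u]] by simp
  next
    case False
    then have "0 < wip u u" using wip_nonneg[of u] by simp
    then show ?thesis
      using cSup_upper[OF scale[OF u False] bdd] by (simp add: r_def field_simps)
  qed
  have vv: "0 < wip v v"
    using wip_eq_0D[OF v _ x] vx wip_nonneg[of v] by fastforce
  have "0 < wip (green v) v"
    using wip_green_eq_0D[OF v _ x] vx wip_green_nonneg[OF v] by fastforce
  then have r: "0 < r"
    using Q[OF vM] vv by (metis less_le_trans zero_less_mult_pos2)
  \<comment> \<open>Positivity of \<open>green\<close> at the residual itself, combined with the
    Rayleigh bound at \<open>green u\<close>, gives |green u|^2 \<le> r <green u, u>. The residual r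
    u - green u therefore tends to 0 along a maximizing sequence.\<close>
  have residual: "wip (\<lambda>x. r * u x + (- 1) * green u x) (\<lambda>x. r * u x + (- 1) * green u x)
      \<le> r * (r - wip (green u) u)" (is "wip ?w ?w \<le> _")
    if u: "u \<in> M" and uu: "wip u u = 1" for u
  proof -
    define b where "b = wip (green u) u"
    define c where "c = wip (green u) (green u)"
    define d where "d = wip (green (green u)) (green u)"
    note cu = M_cont[OF u] and cg = continuous_on_green[OF M_cont[OF u]]
    note cgg = continuous_on_green[OF cg]
    have cw: "continuous_on {0..1} ?w" by (intro continuous_intros cu cg)
    have ww: "wip ?w ?w = r * r - 2 * r * b + c"
      using cu cg cw uu unfolding b_def c_def
      by (simp only: wip_lincomb_left wip_lincomb_right)
        (simp add: wip_commute[of u "green u"] algebra_simps)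
    have "wip (green ?w) ?w = wip (\<lambda>x. r * green u x + (- 1) * green (green u) x) ?w"
      using green_lincomb[OF cu cg, of _ r "- 1"] by (intro wip_cong) auto
    also have "\<dots> = r * r * b - 2 * r * c + d"
      using cu cg cgg cw wip_green_sym[OF cg cu] unfolding b_def c_def d_def
      by (simp only: wip_lincomb_left wip_lincomb_right) (simp add: algebra_simps)
    finally have "0 \<le> r * r * b - 2 * r * c + d"
      using wip_green_nonneg[OF cw] by simp
    moreover have "d \<le> r * c"
      using Q[OF M_green[OF u]] by (simp add: c_def d_def)
    ultimately have "0 \<le> r * (r * b - c)" by (simp add: algebra_simps)
    then have "c \<le> r * b" using r by (simp add: zero_le_mult_iff)
    then show ?thesis unfolding ww b_def[symmetric] by (simp add: algebra_simps)
  qed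
  have "\<exists>u. u \<in> M \<and> wip u u = 1 \<and> r - 1 / real (Suc n) < wip (green u) u" for n
  proof -
    have "\<exists>s\<in>S. r - 1 / real (Suc n) < s"
      using scale[OF vM] vv by (subst less_cSup_iff[symmetric]) (auto simp: bdd r_def)
    then show ?thesis by (auto simp: S_def)
  qed
  then obtain u where u: "\<And>n. u n \<in> M" "\<And>n. wip (u n) (u n) = 1"
    "\<And>n. r - 1 / real (Suc n) < wip (green (u n)) (u n)"
    by metis
  note uc = M_cont[OF u(1)]
  obtain y k where y: "continuous_on {0..1} y" and k: "strict_mono (k :: nat \<Rightarrow> nat)"
    and lim: "\<And>e. 0 < e \<Longrightarrow> \<exists>N. \<forall>n x. n \<ge> N \<and> x \<in> {0..1::real} \<longrightarrow> norm (green (u (k n)) x - y x) < e"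
  proof (rule Arzela_Ascoli[of "{0..1::real}" "\<lambda>n. green (u n)" 1])
    show "norm (green (u n) x) \<le> 1" if "x \<in> {0..1}" for n x
      using green_bound[OF uc that, of n] by (simp add: u(2))
    show "\<exists>d>0. \<forall>n y. y \<in> {0..1} \<and> norm (x - y) < d \<longrightarrow> norm (green (u n) x - green (u n) y) < e"
      if "x \<in> {0..1}" "0 < e" for x e
      using green_lipschitz[OF uc that(1)] that(2)
      by (intro exI[of _ e]) (auto simp: u(2) intro: le_less_trans)
  qed auto
  have approx: "\<exists>n. (\<forall>x\<in>{0..1}. \<bar>green (u n) x - y x\<bar> < e) \<and> 1 / real (Suc n) < e'"
    if "0 < e" "0 < e'" for e e'
  proof -
    obtain N where N: "\<forall>n x. n \<ge> N \<and> x \<in> {0..1::real} \<longrightarrow> norm (green (u (k n)) x - y x) < e"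
      using lim[OF \<open>0 < e\<close>] by blast
    obtain N' where N': "1 / real (Suc N') < e'"
      using nat_approx_posE[OF \<open>0 < e'\<close>] by blast
    let ?n = "max N N'"
    have "N' \<le> k ?n" using seq_suble[OF k, of ?n] by simp
    then have "1 / real (Suc (k ?n)) \<le> 1 / real (Suc N')"
      by (intro divide_left_mono) auto
    then show ?thesis using N N' by (intro exI[of _ "k ?n"]) auto
  qed
  have yM: "wip y (\<lambda>x. bessel_J 0 (l * x)) = 0" if l: "0 < l" "bessel_J 0 l = 0" for l
  proof -
    obtain B where B: "0 \<le> B" "\<And>x. x \<in> {0..1} \<Longrightarrow> \<bar>bessel_J 0 (l * x)\<bar> \<le> B"
      using continuous_bounded_01[OF continuous_on_bessel_mode] by metis
    have bnd: "\<bar>wip y (\<lambda>x. bessel_J 0 (l * x))\<bar> \<le> e * B" if e: "0 < e" for e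
    proof -
      obtain n where n: "\<forall>x\<in>{0..1}. \<bar>green (u n) x - y x\<bar> < e"
        using approx[OF e zero_less_one] by blast
      have "wip (\<lambda>x. 1 * y x + (- 1) * green (u n) x) (\<lambda>x. bessel_J 0 (l * x))
          = wip y (\<lambda>x. bessel_J 0 (l * x))"
        using M_green[OF u(1)[of n]] l
        by (subst wip_lincomb_left) (auto simp: M_def y continuous_on_bessel_mode)
      moreover have "\<bar>wip (\<lambda>x. 1 * y x + (- 1) * green (u n) x) (\<lambda>x. bessel_J 0 (l * x))\<bar> \<le> e * B"
      proof (rule wip_bound)
        show "\<bar>1 * y x + - 1 * green (u n) x\<bar> \<le> e" if "x \<in> {0..1}" for x
          using n that by (auto simp: abs_minus_commute less_imp_le)
      qed (use B in \<open>auto intro!: continuous_intros y continuous_on_green uc continuous_on_bessel_mode\<close>)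
      ultimately show ?thesis by simp
    qed
    have "\<bar>wip y (\<lambda>x. bessel_J 0 (l * x))\<bar> \<le> 0 + e" if e: "0 < e" for e
    proof -
      have "\<bar>wip y (\<lambda>x. bessel_J 0 (l * x))\<bar> \<le> e / (B + 1) * B"
        using e B(1) by (intro bnd) simp
      also have "\<dots> \<le> e" using e B(1) by (simp add: field_simps)
      finally show ?thesis by simp
    qed
    then show ?thesis using field_le_epsilon[of "\<bar>wip y (\<lambda>x. bessel_J 0 (l * x))\<bar>" 0] by auto
  qed
  have eig: "green y x = r * y x" if x: "x \<in> {0..1}" for x
  proof -
    have "\<bar>green y x - r * y x\<bar> \<le> 0 + e" if e: "0 < e" for e
    proof -
      \<comment> \<open>The error is split as green z - green w + r (green u - y), with z = y -
        green u and w = r u - green u; the parts are at most e1, e1 and r e1.\<close>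
      define e1 where "e1 = e / (2 + r)"
      have e1: "0 < e1" using e r by (simp add: e1_def)
      obtain n where n: "\<forall>x\<in>{0..1}. \<bar>green (u n) x - y x\<bar> < e1" "1 / real (Suc n) < e1\<^sup>2 / r"
        using approx[OF e1, of "e1\<^sup>2 / r"] e1 r by auto
      let ?g = "green (u n)"
      let ?w = "\<lambda>x. r * u n x + (- 1) * ?g x"
      let ?z = "\<lambda>x. 1 * y x + (- 1) * ?g x"
      have cg: "continuous_on {0..1} ?g" by (rule continuous_on_green[OF uc])
      have cw: "continuous_on {0..1} ?w" and cz: "continuous_on {0..1} ?z"
        by (intro continuous_intros cg uc y)+
      have "wip ?w ?w \<le> r * (r - wip ?g (u n))" by (rule residual) (rule u)+
      also have "\<dots> \<le> r * (1 / real (Suc n))"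
        using u(3)[of n] r by (intro mult_left_mono) auto
      also have "\<dots> \<le> e1\<^sup>2" using n(2) r by (simp add: field_simps)
      finally have "sqrt (wip ?w ?w) \<le> e1" using e1 by (simp add: real_le_lsqrt)
      then have w: "\<bar>green ?w x\<bar> \<le> e1" using green_bound[OF cw x] by simp
      have "wip ?z ?z \<le> \<bar>wip ?z ?z\<bar>" by simp
      also have "\<dots> \<le> e1 * e1"
        using n(1) by (intro wip_bound cz) (auto simp: abs_minus_commute less_imp_le)
      finally have "sqrt (wip ?z ?z) \<le> e1" using e1 by (simp add: real_le_lsqrt power2_eq_square)
      then have z: "\<bar>green ?z x\<bar> \<le> e1" using green_bound[OF cz x] by simp
      have "green ?w x = r * ?g x - green ?g x"
        using green_lincomb[OF uc cg x, of r n "- 1"] by simp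
      moreover have "green ?z x = green y x - green ?g x"
        using green_lincomb[OF y cg x, of 1 "- 1"] by simp
      ultimately have "green y x - r * y x = green ?z x - green ?w x + r * (?g x - y x)"
        by (simp add: algebra_simps)
      also have "\<bar>\<dots>\<bar> \<le> e1 + e1 + r * e1"
      proof -
        have "\<bar>r * (?g x - y x)\<bar> \<le> r * e1"
          using n(1) x r by (auto simp: abs_mult intro!: mult_left_mono less_imp_le)
        then show ?thesis using w z by linarith
      qed
      also have "\<dots> = (2 + r) * e1" by (simp add: algebra_simps)
      also have "\<dots> = e" using r by (simp add: e1_def)
      finally show ?thesis by simp
    qed
    then show ?thesis using field_le_epsilon[of "\<bar>green y x - r * y x\<bar>" 0] by auto
  qed
  \<comment> \<open>If \<open>y\<close> vanished, \<open>green u\<close> would have norm at most r/2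
    for some late \<open>u\<close>. Nonnegativity of |r u - green u|^2 would then force <green u, u>
    \<le> 5r/8, although it exceeds 3r/4.\<close>
  have y_nz: "y 0 \<noteq> 0"
  proof
    assume "y 0 = 0"
    then have y0: "y x = 0" if "x \<in> {0..1}" for x
      using green_eigenfunction[OF y r eig that] by simp
    obtain n where n: "\<forall>x\<in>{0..1}. \<bar>green (u n) x - y x\<bar> < r / 2" "1 / real (Suc n) < r / 4"
      using approx[of "r / 2" "r / 4"] r by auto
    let ?g = "green (u n)"
    have cg: "continuous_on {0..1} ?g" by (rule continuous_on_green[OF uc])
    have "wip ?g ?g \<le> \<bar>wip ?g ?g\<bar>" by simp
    also have "\<dots> \<le> (r / 2) * (r / 2)"
      using n(1) y0 by (intro wip_bound cg) (auto simp: less_imp_le)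
    finally have c: "wip ?g ?g \<le> r * r / 4" by simp
    have "0 \<le> wip (\<lambda>x. r * u n x + (- 1) * ?g x) (\<lambda>x. r * u n x + (- 1) * ?g x)"
      by (rule wip_nonneg)
    also have "\<dots> = r * r - 2 * r * wip ?g (u n) + wip ?g ?g"
      using uc cg by (simp only: wip_lincomb_left wip_lincomb_right continuous_intros)
        (simp add: wip_commute[of "u n" ?g] u(2) algebra_simps)
    finally have "2 * r * wip ?g (u n) \<le> r * r * 5 / 4" using c by simp
    moreover have "2 * r * (3 / 4 * r) < 2 * r * wip ?g (u n)"
      using u(3)[of n] n(2) r by (intro mult_strict_left_mono) auto
    ultimately show False using mult_pos_pos[OF r r] by (simp add: algebra_simps)
  qed
  define \<mu> where "\<mu> = 1 / sqrt r"
  have \<mu>: "0 < \<mu>" using r by (simp add: \<mu>_def)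
  have y_eq: "y x = y 0 * bessel_J 0 (\<mu> * x)" if "x \<in> {0..1}" for x
    using green_eigenfunction[OF y r eig that] by (simp add: \<mu>_def)
  have "r * y 1 = 0" using eig[of 1] green_1[OF y] by simp
  then have J\<mu>: "bessel_J 0 \<mu> = 0" using y_eq[of 1] y_nz r by simp
  let ?\<phi> = "\<lambda>x. bessel_J 0 (\<mu> * x)"
  have "0 = wip y ?\<phi>" using yM[OF \<mu> J\<mu>] by simp
  also have "\<dots> = wip (\<lambda>x. y 0 * ?\<phi> x + 0 * ?\<phi> x) ?\<phi>" 
  proof (rule wip_cong)
    show "y x = y 0 * ?\<phi> x + 0 * ?\<phi> x" if "x \<in> {0..1}" for x
      using y_eq[OF that] by linarith
  qed simp
  also have "\<dots> = y 0 * wip ?\<phi> ?\<phi>" by (subst wip_lincomb_left) (auto intro: continuous_on_bessel_mode)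
  finally show False using y_nz wip_bessel_mode_pos[of \<mu>] by simp
qed

section \<open>Uniform convergence of Fourier--Bessel series\<close>

lemma wip_modes_sum:
  fixes l :: "nat \<Rightarrow> real"
  assumes fin: "finite F" and inj: "inj_on l F"
    and l: "\<And>k. k \<in> F \<Longrightarrow> 0 < l k" "\<And>k. k \<in> F \<Longrightarrow> bessel_J 0 (l k) = 0"
  defines "\<phi> \<equiv> \<lambda>k x. bessel_J 0 (l k * x)"
  shows "wip (\<lambda>x. \<Sum>k\<in>F. c k * \<phi> k x) (\<lambda>x. \<Sum>k\<in>F. c k * \<phi> k x)
    = (\<Sum>k\<in>F. c k * (c k * wip (\<phi> k) (\<phi> k)))"
proof -
  define s where "s = (\<lambda>x. \<Sum>k\<in>F. c k * \<phi> k x)"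
  have c\<phi>: "continuous_on {0..1} (\<phi> k)" for k
    unfolding \<phi>_def by (rule continuous_on_bessel_mode)
  have "wip s s = (\<Sum>k\<in>F. c k * wip (\<phi> k) s)"
    unfolding s_def using fin c\<phi> by (subst wip_sum_left) (auto intro!: continuous_intros)
  also have "\<dots> = (\<Sum>k\<in>F. c k * (c k * wip (\<phi> k) (\<phi> k)))"
  proof (rule sum.cong[OF refl])
    fix k assume k: "k \<in> F"
    have "wip (\<phi> k) s = (\<Sum>j\<in>F. c j * wip (\<phi> j) (\<phi> k))"
      unfolding wip_commute[of "\<phi> k"] s_def using fin c\<phi> by (subst wip_sum_left) auto
    also have "\<dots> = (\<Sum>j\<in>F. if j = k then c k * wip (\<phi> k) (\<phi> k) else 0)"
      using k l inj by (intro sum.cong) (auto simp: \<phi>_def inj_on_def intro!: bessel_modes_orthogonal)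
    finally show "c k * wip (\<phi> k) s = c k * (c k * wip (\<phi> k) (\<phi> k))"
      using k fin by simp
  qed
  finally show ?thesis unfolding s_def .
qed

text \<open>Integrability is assumed instead of continuity because the lemma is applied to a
  \<open>q\<close> containing a fourth derivative that is merely bounded. The proof expands the
  squared distance from \<open>q\<close> to its projection \<open>s\<close> on the modes.\<close>

lemma bessel_inequality:
  fixes l :: "nat \<Rightarrow> real"
  assumes fin: "finite F" and inj: "inj_on l F"
    and l: "\<And>k. k \<in> F \<Longrightarrow> 0 < l k" "\<And>k. k \<in> F \<Longrightarrow> bessel_J 0 (l k) = 0"
    and qq: "(\<lambda>x. x * q x * q x) integrable_on {0..1}"
    and q: "\<And>w. continuous_on {0..1} w \<Longrightarrow> (\<lambda>x. x * q x * w x) integrable_on {0..1}"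
  defines "\<phi> \<equiv> \<lambda>k x. bessel_J 0 (l k * x)"
  shows "(\<Sum>k\<in>F. (wip q (\<phi> k))\<^sup>2 / wip (\<phi> k) (\<phi> k)) \<le> wip q q"
proof -
  define c where "c k = wip q (\<phi> k) / wip (\<phi> k) (\<phi> k)" for k
  define s where "s = (\<lambda>x. \<Sum>k\<in>F. c k * \<phi> k x)"
  have c\<phi>: "continuous_on {0..1} (\<phi> k)" for k
    unfolding \<phi>_def by (rule continuous_on_bessel_mode)
  have cs: "continuous_on {0..1} s"
    unfolding s_def by (intro continuous_intros c\<phi>)
  have N: "wip (\<phi> k) (\<phi> k) > 0" for k
    unfolding \<phi>_def by (rule wip_bessel_mode_pos)
  have "wip q s = integral {0..1} (\<lambda>x. \<Sum>k\<in>F. c k * (x * q x * \<phi> k x))"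
    unfolding wip_def s_def by (simp add: sum_distrib_left mult_ac)
  also have "\<dots> = (\<Sum>k\<in>F. c k * wip q (\<phi> k))"
    unfolding wip_def by (subst integral_sum[OF fin])
      (auto intro!: integrable_on_mult_right q c\<phi>)
  also have "\<dots> = (\<Sum>k\<in>F. (wip q (\<phi> k))\<^sup>2 / wip (\<phi> k) (\<phi> k))"
    by (simp add: c_def power2_eq_square)
  finally have qs: "wip q s = (\<Sum>k\<in>F. (wip q (\<phi> k))\<^sup>2 / wip (\<phi> k) (\<phi> k))" .
  have "wip s s = (\<Sum>k\<in>F. c k * (c k * wip (\<phi> k) (\<phi> k)))"
    unfolding s_def \<phi>_def by (rule wip_modes_sum[OF fin inj l])
  also have "\<dots> = wip q s"
    unfolding qs by (rule sum.cong) (use N in \<open>auto simp: c_def power2_eq_square\<close>)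
  finally have ss: "wip s s = wip q s" .
  have "0 \<le> integral {0..1} (\<lambda>x. x * (q x - s x)\<^sup>2)"
    by (rule integral_nonneg_total) auto
  also have "\<dots> = integral {0..1} (\<lambda>x. (x * q x * q x + (- 2) * (x * q x * s x)) + x * s x * s x)"
    by (rule arg_cong[of _ _ "integral _"]) (auto simp: power2_eq_square algebra_simps)
  also have "\<dots> = wip q q - 2 * wip q s + wip s s"
    unfolding wip_def
    by (subst integral_add integral_mult_right;
        (intro integrable_add integrable_on_mult_right qq q[OF cs] wip_integrable cs)?)+ simp
  finally show ?thesis using ss qs by simp
qed

text \<open>
  Both sides come from the bound on \<^const>\<open>green\<close>, applied to the combination of modes whose signs
  make every term at \<open>x\<close> nonnegative.
\<close>

lemma sum_bessel_modes_bound: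
  fixes l :: "nat \<Rightarrow> real"
  assumes fin: "finite F" and inj: "inj_on l F"
    and l: "\<And>k. k \<in> F \<Longrightarrow> 0 < l k" "\<And>k. k \<in> F \<Longrightarrow> bessel_J 0 (l k) = 0"
    and x: "x \<in> {0..1}"
  defines "\<phi> \<equiv> \<lambda>k x. bessel_J 0 (l k * x)"
  shows "(\<Sum>k\<in>F. \<bar>a k * \<phi> k x\<bar> / (l k)\<^sup>2) \<le> sqrt (\<Sum>k\<in>F. (a k)\<^sup>2 * wip (\<phi> k) (\<phi> k))"
proof -
  define c where "c k = sgn (a k * \<phi> k x) * a k" for k
  define s where "s = (\<lambda>x. \<Sum>k\<in>F. c k * \<phi> k x)"
  have c\<phi>: "continuous_on {0..1} (\<phi> k)" for k
    unfolding \<phi>_def by (rule continuous_on_bessel_mode)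
  have cs: "continuous_on {0..1} s"
    unfolding s_def by (intro continuous_intros c\<phi>)
  have "wip s s = (\<Sum>k\<in>F. c k * (c k * wip (\<phi> k) (\<phi> k)))"
    unfolding s_def \<phi>_def by (rule wip_modes_sum[OF fin inj l])
  also have "\<dots> \<le> (\<Sum>k\<in>F. (a k)\<^sup>2 * wip (\<phi> k) (\<phi> k))"
  proof (rule sum_mono)
    fix k
    have "c k * c k \<le> (a k)\<^sup>2" by (auto simp: c_def sgn_if power2_eq_square)
    from mult_right_mono[OF this wip_nonneg]
    show "c k * (c k * wip (\<phi> k) (\<phi> k)) \<le> (a k)\<^sup>2 * wip (\<phi> k) (\<phi> k)"
      by (simp add: mult.assoc)
  qed
  finally have ss: "wip s s \<le> (\<Sum>k\<in>F. (a k)\<^sup>2 * wip (\<phi> k) (\<phi> k))" .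
  have "(\<Sum>k\<in>F. \<bar>a k * \<phi> k x\<bar> / (l k)\<^sup>2) = (\<Sum>k\<in>F. c k * green (\<phi> k) x)"
  proof (rule sum.cong[OF refl])
    fix k assume k: "k \<in> F"
    have "green (\<phi> k) x = \<phi> k x / (l k)\<^sup>2"
      unfolding \<phi>_def using l(1)[OF k] l(2)[OF k] x by (intro green_bessel_mode) auto
    moreover have "c k * \<phi> k x = \<bar>a k * \<phi> k x\<bar>"
      by (simp add: c_def abs_sgn mult_ac)
    ultimately show "\<bar>a k * \<phi> k x\<bar> / (l k)\<^sup>2 = c k * green (\<phi> k) x" by simp
  qed
  also have "\<dots> = green s x"
    unfolding s_def using fin c\<phi> x by (subst green_sum) auto
  also have "\<dots> \<le> sqrt (wip s s)" using green_bound[OF cs x] by simp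
  also have "\<dots> \<le> sqrt (\<Sum>k\<in>F. (a k)\<^sup>2 * wip (\<phi> k) (\<phi> k))" using ss by simp
  finally show ?thesis .
qed


section \<open>Fractional integrals of powers\<close>

lemma Beta_integral_scaled:
  fixes b c t :: real
  assumes "0 < b" "0 < c" "0 < t"
  shows "set_integrable lborel {0<..<t} (\<lambda>s. s powr (b - 1) * (t - s) powr (c - 1))"
    and "(LBINT s:{0<..<t}. s powr (b - 1) * (t - s) powr (c - 1))
      = t powr (b + c - 1) * (Gamma b * Gamma c / Gamma (b + c))"
proof -
  let ?f = "\<lambda>s. indicator {0<..<t} s * (s powr (b - 1) * (t - s) powr (c - 1))"
  let ?g = "\<lambda>s. indicator {0<..<1} s * (s powr (b - 1) * (1 - s) powr (c - 1))"
  have eq: "?f (0 + t * r) = t powr (b + c - 2) * ?g r" for r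
  proof (cases "r \<in> {0<..<1}")
    case True
    then have "t - t * r = t * (1 - r)" "t * r \<in> {0<..<t}" using assms by (auto simp: algebra_simps)
    moreover have "t powr (b + c - 2) = t powr (b - 1) * t powr (c - 1)"
      by (simp add: powr_add[symmetric])
    ultimately show ?thesis using True assms by (simp add: powr_mult)
  next
    case False
    then have "t * r \<notin> {0<..<t}" using assms by (auto simp: zero_less_mult_iff)
    then show ?thesis using False by simp
  qed
  have g: "set_integrable lborel {0<..<1} (\<lambda>s. s powr (b - 1) * (1 - s) powr (c - 1))"
    using integrable_Beta[OF assms(1,2)] by (rule set_integrable_subset) auto
  then have gi: "integrable lborel ?g" by (simp add: set_integrable_def)
  then have "integrable lborel (\<lambda>r. ?f (0 + t * r))"
    unfolding eq by (rule integrable_mult_right)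
  then have fi: "integrable lborel ?f"
    using assms by (subst (asm) lborel_integrable_real_affine_iff) auto
  then show "set_integrable lborel {0<..<t} (\<lambda>s. s powr (b - 1) * (t - s) powr (c - 1))"
    by (simp add: set_integrable_def)
  have "integral\<^sup>L lborel ?g = integral {0<..<1} (\<lambda>s. s powr (b - 1) * (1 - s) powr (c - 1))"
    using set_borel_integral_eq_integral(2)[OF g] by (simp add: set_lebesgue_integral_def)
  also have "\<dots> = Beta b c"
    using has_integral_Beta_real[OF assms(1,2)]
    by (simp add: integral_unique has_integral_Icc_iff_Ioo)
  finally have "integral\<^sup>L lborel ?g = Gamma b * Gamma c / Gamma (b + c)"
    by (simp add: Beta_altdef rGamma_inverse_Gamma divide_inverse)
  then have "integral\<^sup>L lborel ?f = t * (t powr (b + c - 2) * (Gamma b * Gamma c / Gamma (b + c)))"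
    using assms by (subst lborel_integral_real_affine[of t _ 0]) (simp_all only: eq integral_mult_right_zero, simp_all)
  also have "t * (t powr (b + c - 2) * (Gamma b * Gamma c / Gamma (b + c)))
      = t powr (1 + (b + c - 2)) * (Gamma b * Gamma c / Gamma (b + c))"
    using assms by (simp only: powr_add) simp
  finally show "(LBINT s:{0<..<t}. s powr (b - 1) * (t - s) powr (c - 1))
      = t powr (b + c - 1) * (Gamma b * Gamma c / Gamma (b + c))"
    by (simp add: set_lebesgue_integral_def)
qed

lemma power_kernel_right:
  fixes a b c :: real
  assumes "0 < c" "a < b"
  shows "set_integrable lborel {a<..<b} (\<lambda>s. (b - s) powr (c - 1))"
    and "(LBINT s:{a<..<b}. (b - s) powr (c - 1)) = (b - a) powr c / c"
proof -
  let ?f = "\<lambda>s. indicator {a<..<b} s * (b - s) powr (c - 1)"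
  have eq: "?f (a + 1 * s) = indicator {0<..<b - a} s * (s powr (1 - 1) * ((b - a) - s) powr (c - 1))" for s
    by (auto simp: indicator_def algebra_simps)
  note B = Beta_integral_scaled[of 1 c "b - a", OF zero_less_one assms(1)]
  have "integrable lborel (\<lambda>s. ?f (a + 1 * s))"
    unfolding eq using B(1) assms by (simp add: set_integrable_def)
  then show "set_integrable lborel {a<..<b} (\<lambda>s. (b - s) powr (c - 1))"
    by (subst (asm) lborel_integrable_real_affine_iff) (auto simp: set_integrable_def)
  have "integral\<^sup>L lborel ?f = integral\<^sup>L lborel (\<lambda>s. ?f (a + 1 * s))"
    by (subst lborel_integral_real_affine[of 1 _ a]) auto
  also have "\<dots> = (b - a) powr c * (Gamma c / Gamma (1 + c))"
    unfolding eq using B(2) assms by (simp add: set_lebesgue_integral_def)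
  also have "\<dots> = (b - a) powr c / c"
  proof -
    have "Gamma c \<noteq> 0" using Gamma_real_pos[OF assms(1)] by simp
    moreover have "Gamma (1 + c) = c * Gamma c"
      using assms by (subst add.commute) (auto intro!: Gamma_plus1 elim!: nonpos_Ints_cases)
    ultimately show ?thesis by simp
  qed
  finally show "(LBINT s:{a<..<b}. (b - s) powr (c - 1)) = (b - a) powr c / c"
    by (simp add: set_lebesgue_integral_def)
qed

lemma power_kernel_left:
  fixes a b c :: real
  assumes "0 < c" "a < b"
  shows "set_integrable lborel {a<..<b} (\<lambda>s. (s - a) powr (c - 1))"
    and "(LBINT s:{a<..<b}. (s - a) powr (c - 1)) = (b - a) powr c / c"
proof -
  let ?f = "\<lambda>s. indicator {a<..<b} s * (s - a) powr (c - 1)"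
  have eq: "?f ((a + b) + (-1) * s) = indicator {a<..<b} s * (b - s) powr (c - 1)" for s
    by (auto simp: indicator_def algebra_simps)
  note B = power_kernel_right[OF assms]
  have "integrable lborel (\<lambda>s. ?f ((a + b) + (-1) * s))"
    unfolding eq using B(1) assms by (simp add: set_integrable_def)
  then show "set_integrable lborel {a<..<b} (\<lambda>s. (s - a) powr (c - 1))"
    by (subst (asm) lborel_integrable_real_affine_iff) (auto simp: set_integrable_def)
  have "integral\<^sup>L lborel ?f = integral\<^sup>L lborel (\<lambda>s. ?f ((a + b) + (-1) * s))"
    by (subst lborel_integral_real_affine[of "-1" _ "a + b"]) auto
  also have "\<dots> = (b - a) powr c / c"
    unfolding eq using B(2) by (simp add: set_lebesgue_integral_def)
  finally show "(LBINT s:{a<..<b}. (s - a) powr (c - 1)) = (b - a) powr c / c"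
    by (simp add: set_lebesgue_integral_def)
qed

section \<open>The Mittag-Leffler function\<close>

text \<open>On t \<ge> M the factor t^(x-1) in Euler's integral is at least M^(x-1). As M is free,
  Gamma is seen to outgrow every geometric sequence, which stands in for Stirling's formula.\<close>

lemma Gamma_lower_bound:
  fixes x M :: real
  assumes x: "1 \<le> x" and M: "0 < M"
  shows "M powr (x - 1) * exp (- M) \<le> Gamma x"
proof -
  have G: "((\<lambda>t. t powr (x - 1) / exp t) has_integral Gamma x) {0..}"
    using x by (intro Gamma_integral_real) auto
  have ai: "(\<lambda>t. t powr (x - 1) / exp t) absolutely_integrable_on {0..}"
    using G by (intro nonnegative_absolutely_integrable_1) (auto simp: integrable_on_def)
  have i: "(\<lambda>t. t powr (x - 1) / exp t) integrable_on {M..}"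
    using set_integrable_subset[OF ai, of "{M..}"] M
    by (auto intro!: set_lebesgue_integral_eq_integral(1))
  have E: "((\<lambda>t. M powr (x - 1) * exp (- 1 * t)) has_integral M powr (x - 1) * (exp (- 1 * M) / 1)) {M..}"
    by (intro has_integral_mult_right has_integral_exp_minus_to_infinity) simp
  have "M powr (x - 1) * (exp (- 1 * M) / 1) \<le> integral {M..} (\<lambda>t. t powr (x - 1) / exp t)"
  proof (rule has_integral_le[OF E integrable_integral[OF i]])
    fix t assume "t \<in> {M..}"
    then have "M powr (x - 1) \<le> t powr (x - 1)"
      using x M by (intro powr_mono2) auto
    then show "M powr (x - 1) * exp (- 1 * t) \<le> t powr (x - 1) / exp t"
      by (simp add: exp_minus divide_inverse)
  qed
  also have "\<dots> \<le> integral {0..} (\<lambda>t. t powr (x - 1) / exp t)"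
    using M G by (intro integral_subset_le i) (auto simp: integrable_on_def)
  also have "\<dots> = Gamma x" using G by (rule integral_unique)
  finally show ?thesis by simp
qed

lemma summable_mittag_leffler_abs:
  fixes \<alpha> \<beta> z :: real
  assumes \<alpha>: "0 < \<alpha>" and \<beta>: "0 < \<beta>"
  shows "summable (\<lambda>k. \<bar>z ^ k / Gamma (\<alpha> * real k + \<beta>)\<bar>)"
proof -
  \<comment> \<open>Chosen so that M^\<alpha> = 2 (|z| + 1), which makes the terms decay like
    (1/2)^k; the 1 keeps M positive for z = 0.\<close>
  define M where "M = (2 * (\<bar>z\<bar> + 1)) powr (1 / \<alpha>)"
  have M: "0 < M" "M powr \<alpha> = 2 * (\<bar>z\<bar> + 1)"
    using \<alpha> by (simp_all add: M_def powr_powr)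
  \<comment> \<open>From index K on the argument of Gamma is at least 1, the range of
    \<open>Gamma_lower_bound\<close>.\<close>
  obtain K :: nat where K: "1 / \<alpha> < real K" using reals_Archimedean2 by blast
  define C where "C = exp M * M powr (1 - \<beta>)"
  show ?thesis
  proof (rule summable_comparison_test'[where N = K])
    show "summable (\<lambda>k. C * (1 / 2 :: real) ^ k)"
      by (intro summable_mult summable_geometric) simp
    fix k assume k: "K \<le> k"
    have "1 < \<alpha> * real K" using K \<alpha> by (simp add: field_simps)
    also have "\<dots> \<le> \<alpha> * real k" using k \<alpha> by simp
    finally have k1: "1 \<le> \<alpha> * real k + \<beta>" using \<beta> by simp
    have "M powr (\<alpha> * real k + \<beta> - 1) * exp (- M) \<le> Gamma (\<alpha> * real k + \<beta>)"
      by (rule Gamma_lower_bound[OF k1 M(1)])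
    moreover have "M powr (\<alpha> * real k + \<beta> - 1) * exp (- M) = (2 * (\<bar>z\<bar> + 1)) ^ k / C"
    proof -
      have "M powr (\<alpha> * real k + \<beta> - 1) = M powr (\<alpha> * real k) * M powr (\<beta> - 1)"
        by (simp add: powr_add[symmetric] add_diff_eq)
      also have "M powr (\<alpha> * real k) = (2 * (\<bar>z\<bar> + 1)) ^ k"
        using M by (simp add: powr_powr[symmetric] powr_realpow)
      also have "M powr (\<beta> - 1) = 1 / M powr (1 - \<beta>)"
        using powr_minus_divide[of M "1 - \<beta>"] by simp
      finally show ?thesis by (simp add: C_def exp_minus field_simps)
    qed
    ultimately have G: "(2 * (\<bar>z\<bar> + 1)) ^ k / C \<le> Gamma (\<alpha> * real k + \<beta>)" by simp
    have C: "0 < C" using M by (simp add: C_def)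
    have Gpos: "0 < Gamma (\<alpha> * real k + \<beta>)" using k1 by (intro Gamma_real_pos) simp
    have "\<bar>z\<bar> ^ k / Gamma (\<alpha> * real k + \<beta>) \<le> \<bar>z\<bar> ^ k / ((2 * (\<bar>z\<bar> + 1)) ^ k / C)"
      using G C by (intro divide_left_mono mult_pos_pos Gpos divide_pos_pos) auto
    also have "\<dots> \<le> C * (1 / 2) ^ k"
    proof -
      have "\<bar>z\<bar> ^ k \<le> (\<bar>z\<bar> + 1) ^ k" by (intro power_mono) auto
      moreover have "(2 * (\<bar>z\<bar> + 1)) ^ k = 2 ^ k * (\<bar>z\<bar> + 1) ^ k" by (rule power_mult_distrib)
      moreover have "0 < (\<bar>z\<bar> + 1) ^ k" by simp
      ultimately show ?thesis using C by (simp add: field_simps)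
    qed
    finally show "norm \<bar>z ^ k / Gamma (\<alpha> * real k + \<beta>)\<bar> \<le> C * (1 / 2) ^ k"
      using Gpos by (simp add: power_abs)
  qed
qed

lemma summable_mittag_leffler:
  fixes \<alpha> \<beta> z :: real
  assumes "0 < \<alpha>" "0 < \<beta>"
  shows "summable (\<lambda>k. z ^ k / Gamma (\<alpha> * real k + \<beta>))"
  using summable_mittag_leffler_abs[OF assms] by (rule summable_rabs_cancel)

text \<open>The two-parameter Mittag-Leffler function E_{\<alpha>,\<beta>}. Differentiating or
  fractionally integrating E_\<alpha> moves the second parameter.\<close>

definition ml2 :: "real \<Rightarrow> real \<Rightarrow> real \<Rightarrow> real" where
  "ml2 \<alpha> \<beta> z = (\<Sum>k. z ^ k / Gamma (\<alpha> * real k + \<beta>))"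

lemma mittag_leffler_eq: "mittag_leffler \<alpha> = ml2 \<alpha> 1"
  by (simp add: fun_eq_iff mittag_leffler_def ml2_def)

lemma ml2_0: "ml2 \<alpha> \<beta> 0 = 1 / Gamma \<beta>"
  using powser_zero[of "\<lambda>k. 1 / Gamma (\<alpha> * real k + \<beta>)"] by (simp add: ml2_def)

lemma ml2_shift:
  assumes "0 < \<alpha>" "0 < \<beta>"
  shows "ml2 \<alpha> \<beta> z = 1 / Gamma \<beta> + z * ml2 \<alpha> (\<beta> + \<alpha>) z"
proof -
  have "ml2 \<alpha> \<beta> z = (\<Sum>k. z ^ Suc k / Gamma (\<alpha> * real (Suc k) + \<beta>)) + 1 / Gamma \<beta>"
    unfolding ml2_def using suminf_split_initial_segment[OF summable_mittag_leffler[OF assms, of z], of 1]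
    by simp
  also have "(\<Sum>k. z ^ Suc k / Gamma (\<alpha> * real (Suc k) + \<beta>)) = z * ml2 \<alpha> (\<beta> + \<alpha>) z"
    unfolding ml2_def using assms summable_mittag_leffler[of \<alpha> "\<beta> + \<alpha>" z]
    by (subst suminf_mult[symmetric]) (simp_all add: algebra_simps)
  finally show ?thesis by simp
qed

lemma mittag_leffler_deriv:
  assumes \<alpha>: "0 < \<alpha>"
  shows "(mittag_leffler \<alpha> has_real_derivative ml2 \<alpha> \<alpha> z / \<alpha>) (at z)"
proof -
  let ?a = "\<lambda>k. 1 / Gamma (\<alpha> * real k + 1)"
  have "((\<lambda>z. \<Sum>k. ?a k * z ^ k) has_field_derivative (\<Sum>k. diffs ?a k * z ^ k)) (at z)"
    using summable_mittag_leffler[OF \<alpha> zero_less_one]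
    by (intro termdiffs_strong_converges_everywhere) simp
  moreover have "diffs ?a k * z ^ k = z ^ k / Gamma (\<alpha> * real k + \<alpha>) / \<alpha>" for k
  proof -
    define g where "g = \<alpha> * real (Suc k)"
    have g: "0 < g" using \<alpha> by (simp add: g_def add_pos_nonneg)
    then have "Gamma (g + 1) = g * Gamma g"
      by (intro Gamma_plus1) (auto elim!: nonpos_Ints_cases)
    then have "diffs ?a k = real (Suc k) / (g * Gamma g)"
      by (simp add: diffs_def g_def)
    also have "\<dots> = 1 / Gamma g / \<alpha>"
      unfolding g_def by (simp del: of_nat_Suc)
    also have "g = \<alpha> * real k + \<alpha>"
      by (simp add: g_def algebra_simps)
    finally show ?thesis by simp
  qed
  moreover have "(\<Sum>k. z ^ k / Gamma (\<alpha> * real k + \<alpha>) / \<alpha>) = ml2 \<alpha> \<alpha> z / \<alpha>"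
    unfolding ml2_def by (rule suminf_divide[OF summable_mittag_leffler[OF \<alpha> \<alpha>]])
  ultimately show ?thesis
    by (simp only: mittag_leffler_def[abs_def]) (simp add: mult.commute)
qed

text \<open>The solution of the relaxation equation D^\<alpha> y = - c y, y(0) = 1, with the Caputo
  derivative: the fractional counterpart of exp(- c t).\<close>

definition ml_mode :: "real \<Rightarrow> real \<Rightarrow> real \<Rightarrow> real" where
  "ml_mode \<alpha> c t = mittag_leffler \<alpha> (- c * t powr \<alpha>)"

definition ml_mode' :: "real \<Rightarrow> real \<Rightarrow> real \<Rightarrow> real" where
  "ml_mode' \<alpha> c t = - c * t powr (\<alpha> - 1) * ml2 \<alpha> \<alpha> (- c * t powr \<alpha>)"

context
  fixes \<alpha> :: real
  assumes \<alpha>: "0 < \<alpha>" "\<alpha> < 1"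
begin

lemma ml_mode_0: "ml_mode \<alpha> c 0 = 1"
  by (simp add: ml_mode_def mittag_leffler_eq ml2_0)

lemma continuous_on_mittag_leffler: "continuous_on A (mittag_leffler \<alpha>)"
  by (meson DERIV_isCont mittag_leffler_deriv[OF \<alpha>(1)] continuous_at_imp_continuous_on)

lemma continuous_on_ml_mode: "continuous_on {0..} (ml_mode \<alpha> c)"
  unfolding ml_mode_def
  by (rule continuous_on_compose2[OF continuous_on_mittag_leffler[of UNIV]])
    (use \<alpha> in \<open>auto intro!: continuous_intros continuous_on_powr'\<close>)

lemma ml_mode_deriv:
  assumes "0 < t"
  shows "(ml_mode \<alpha> c has_real_derivative ml_mode' \<alpha> c t) (at t)"
proof -
  have "((\<lambda>t. - c * t powr \<alpha>) has_real_derivative - c * (\<alpha> * t powr (\<alpha> - 1))) (at t)"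
    using assms by (intro DERIV_cmult has_real_derivative_powr)
  then have "(ml_mode \<alpha> c has_real_derivative
      ml2 \<alpha> \<alpha> (- c * t powr \<alpha>) / \<alpha> * (- c * (\<alpha> * t powr (\<alpha> - 1)))) (at t)"
    unfolding ml_mode_def by (rule DERIV_chain2[OF mittag_leffler_deriv[OF \<alpha>(1)]])
  then show ?thesis
    by (rule DERIV_cong) (use \<alpha> in \<open>simp add: ml_mode'_def\<close>)
qed

text \<open>Each term of the series gives a Beta integral. The exponent \<gamma> = 1 - \<alpha>
  yields the Caputo derivative of the mode, \<gamma> = \<alpha> its Volterra equation.\<close>

lemma ml_mode'_fractional_integral:
  assumes \<gamma>: "0 < \<gamma>" and t: "0 < t"
  shows "set_integrable lborel {0<..<t} (\<lambda>s. ml_mode' \<alpha> c s * (t - s) powr (\<gamma> - 1))"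
    and "(LBINT s:{0<..<t}. ml_mode' \<alpha> c s * (t - s) powr (\<gamma> - 1))
      = - c * Gamma \<gamma> * t powr (\<alpha> + \<gamma> - 1) * ml2 \<alpha> (\<alpha> + \<gamma>) (- c * t powr \<alpha>)"
proof -
  define b where "b k = \<alpha> * real k + \<alpha>" for k
  have b: "0 < b k" for k using \<alpha> by (simp add: b_def add_nonneg_pos)
  define G where "G k = - c * (- c) ^ k / Gamma (b k)" for k
  let ?p = "\<lambda>k s. s powr (b k - 1) * (t - s) powr (\<gamma> - 1)"
  let ?f = "\<lambda>k s. indicator {0<..<t} s * (G k * ?p k s)"
  note B = Beta_integral_scaled[OF b \<gamma> t]
  have int: "integrable lborel (?f k)" for k
    using integrable_mult_right[of "G k", OF B(1)[of k, unfolded set_integrable_def]]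
    by (simp add: mult_ac)
  have t_pow: "t powr (b k + \<gamma> - 1) = t powr (\<alpha> + \<gamma> - 1) * (t powr \<alpha>) ^ k" for k
    using t by (simp add: b_def powr_realpow[symmetric] powr_powr powr_add[symmetric] algebra_simps)
  have val: "integral\<^sup>L lborel (?f k) = - c * Gamma \<gamma> * t powr (\<alpha> + \<gamma> - 1)
      * ((- c * t powr \<alpha>) ^ k / Gamma (\<alpha> * real k + (\<alpha> + \<gamma>)))" for k
  proof -
    have "integral\<^sup>L lborel (?f k) = G k * (LBINT s:{0<..<t}. ?p k s)"
      by (simp add: set_lebesgue_integral_def mult.left_commute[of _ "G k"])
    also have "\<dots> = G k * (t powr (b k + \<gamma> - 1) * (Gamma (b k) * Gamma \<gamma> / Gamma (b k + \<gamma>)))"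
      by (simp only: B)
    also have "\<dots> = - c * Gamma \<gamma> * t powr (\<alpha> + \<gamma> - 1)
      * ((- c * t powr \<alpha>) ^ k / Gamma (b k + \<gamma>))"
      using Gamma_real_pos[OF b[of k]] unfolding t_pow G_def power_mult_distrib
      by (simp add: field_simps)
    also have "b k + \<gamma> = \<alpha> * real k + (\<alpha> + \<gamma>)" by (simp add: b_def)
    finally show ?thesis .
  qed
  \<comment> \<open>Every term keeps its sign in s, so the norm integrates to the absolute value of
    the integral and summability reduces to that of a Mittag-Leffler series.\<close>
  have nval: "integral\<^sup>L lborel (\<lambda>s. norm (?f k s)) = \<bar>integral\<^sup>L lborel (?f k)\<bar>" for k
  proof -
    have "integral\<^sup>L lborel (\<lambda>s. norm (?f k s)) = integral\<^sup>L lborel (\<lambda>s. \<bar>G k\<bar> * (indicator {0<..<t} s * ?p k s))"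
      by (rule Bochner_Integration.integral_cong) (auto simp: abs_mult indicator_def)
    also have "\<dots> = \<bar>G k\<bar> * integral\<^sup>L lborel (\<lambda>s. indicator {0<..<t} s * ?p k s)"
      by (rule integral_mult_right_zero)
    also have "\<dots> = \<bar>G k * integral\<^sup>L lborel (\<lambda>s. indicator {0<..<t} s * ?p k s)\<bar>"
      unfolding abs_mult
      by (subst (2) abs_of_nonneg) (auto intro!: Bochner_Integration.integral_nonneg simp: indicator_def)
    also have "G k * integral\<^sup>L lborel (\<lambda>s. indicator {0<..<t} s * ?p k s) = integral\<^sup>L lborel (?f k)"
      by (subst integral_mult_right_zero[symmetric]) (simp add: mult_ac)
    finally show ?thesis .
  qed
  have sums: "(\<lambda>k. ?f k s) sums (indicator {0<..<t} s * (ml_mode' \<alpha> c s * (t - s) powr (\<gamma> - 1)))"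
    and nsum: "summable (\<lambda>k. norm (?f k s))" for s
  proof -
    have eq: "?f k s = indicator {0<..<t} s * (- c * s powr (\<alpha> - 1) * (t - s) powr (\<gamma> - 1))
      * ((- c * s powr \<alpha>) ^ k / Gamma (\<alpha> * real k + \<alpha>))" for k
    proof (cases "s \<in> {0<..<t}")
      case True
      then have "s powr (b k - 1) = s powr (\<alpha> - 1) * (s powr \<alpha>) ^ k"
        by (simp add: b_def powr_realpow[symmetric] powr_powr powr_add[symmetric] algebra_simps)
      then show ?thesis using True unfolding G_def power_mult_distrib by (simp add: b_def)
    qed simp
    show "(\<lambda>k. ?f k s) sums (indicator {0<..<t} s * (ml_mode' \<alpha> c s * (t - s) powr (\<gamma> - 1)))"
      unfolding eq ml_mode'_def ml2_def
      using sums_mult[OF summable_sums[OF summable_mittag_leffler[OF \<alpha>(1) \<alpha>(1), of "- c * s powr \<alpha>"]],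
          of "indicator {0<..<t} s * (- c * s powr (\<alpha> - 1) * (t - s) powr (\<gamma> - 1))"]
      by (simp add: mult_ac)
    show "summable (\<lambda>k. norm (?f k s))"
      unfolding eq norm_mult
      using summable_mult[OF summable_mittag_leffler_abs[OF \<alpha>(1) \<alpha>(1), of "- c * s powr \<alpha>"]]
      by (simp only: real_norm_def)
  qed
  have suminf: "(\<Sum>k. ?f k s) = indicator {0<..<t} s * (ml_mode' \<alpha> c s * (t - s) powr (\<gamma> - 1))" for s
    by (rule sums_unique[symmetric, OF sums])
  have sm: "summable (\<lambda>k. integral\<^sup>L lborel (\<lambda>s. norm (?f k s)))"
    unfolding nval val abs_mult[of "_ * _ * _"]
    using \<alpha> \<gamma> by (intro summable_mult summable_mittag_leffler_abs) auto
  have *: "integrable lborel (\<lambda>s. \<Sum>k. ?f k s)"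
    "(\<lambda>k. integral\<^sup>L lborel (?f k)) sums (LBINT s. \<Sum>k. ?f k s)"
    by (rule integrable_suminf sums_integral; use int nsum sm in simp)+
  show "set_integrable lborel {0<..<t} (\<lambda>s. ml_mode' \<alpha> c s * (t - s) powr (\<gamma> - 1))"
    using *(1) unfolding suminf by (simp add: set_integrable_def)
  have "(\<lambda>k. integral\<^sup>L lborel (?f k)) sums (- c * Gamma \<gamma> * t powr (\<alpha> + \<gamma> - 1)
      * ml2 \<alpha> (\<alpha> + \<gamma>) (- c * t powr \<alpha>))"
    unfolding val ml2_def using \<alpha> \<gamma> by (intro sums_mult summable_sums summable_mittag_leffler) auto
  then have "(LBINT s. \<Sum>k. ?f k s) = - c * Gamma \<gamma> * t powr (\<alpha> + \<gamma> - 1)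
      * ml2 \<alpha> (\<alpha> + \<gamma>) (- c * t powr \<alpha>)"
    using *(2) by (rule sums_unique2[symmetric])
  then show "(LBINT s:{0<..<t}. ml_mode' \<alpha> c s * (t - s) powr (\<gamma> - 1))
      = - c * Gamma \<gamma> * t powr (\<alpha> + \<gamma> - 1) * ml2 \<alpha> (\<alpha> + \<gamma>) (- c * t powr \<alpha>)"
    unfolding suminf by (simp add: set_lebesgue_integral_def)
qed

lemma ml_mode'_caputo:
  assumes "0 < t"
  shows "set_integrable lborel {0<..<t} (\<lambda>s. ml_mode' \<alpha> c s * (t - s) powr (- \<alpha>))"
    and "(LBINT s:{0<..<t}. ml_mode' \<alpha> c s * (t - s) powr (- \<alpha>))
      = - c * Gamma (1 - \<alpha>) * ml_mode \<alpha> c t"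
  using ml_mode'_fractional_integral[of "1 - \<alpha>" t c] assms \<alpha>
  by (simp_all add: ml_mode_def mittag_leffler_eq)

text \<open>The point of this form is that the integral term acquires a sign once
  \<open>ml_mode'\<close> is known to be nonpositive; the pointwise bound
  \<open>abs_ml_mode'_le\<close> results.\<close>

lemma ml_mode'_volterra:
  assumes t: "0 < t"
  shows "ml_mode' \<alpha> c t = - c * t powr (\<alpha> - 1) / Gamma \<alpha>
    - c / Gamma \<alpha> * (LBINT s:{0<..<t}. ml_mode' \<alpha> c s * (t - s) powr (\<alpha> - 1))"
proof -
  let ?I = "LBINT s:{0<..<t}. ml_mode' \<alpha> c s * (t - s) powr (\<alpha> - 1)"
  let ?X = "ml2 \<alpha> (\<alpha> + \<alpha>) (- c * t powr \<alpha>)"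
  have p: "t powr (\<alpha> + \<alpha> - 1) = t powr (\<alpha> - 1) * t powr \<alpha>"
    by (simp add: powr_add[symmetric] algebra_simps)
  have "?I = - c * Gamma \<alpha> * (t powr (\<alpha> - 1) * t powr \<alpha>) * ?X"
    using ml_mode'_fractional_integral(2)[OF \<alpha>(1) t, of c] by (simp only: p)
  then have "c / Gamma \<alpha> * ?I = - c * c * t powr (\<alpha> - 1) * t powr \<alpha> * ?X"
    using Gamma_real_pos[OF \<alpha>(1)] by simp
  moreover have "ml_mode' \<alpha> c t = - c * t powr (\<alpha> - 1) * (1 / Gamma \<alpha> + - c * t powr \<alpha> * ?X)"
    by (simp add: ml_mode'_def ml2_shift[OF \<alpha>(1) \<alpha>(1)])
  ultimately show ?thesis by (simp add: algebra_simps)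
qed

section \<open>A maximum principle for the Caputo derivative\<close>

text \<open>
  Integrating by parts against \<open>\<phi> - \<phi> t\<close>, which is nonpositive, both the boundary term at
  \<open>t\<close> and the new integrand have a favourable sign.
\<close>

lemma caputo_at_maximum:
  assumes t: "0 < t" and cont: "continuous_on {0..t} \<phi>"
    and deriv: "\<And>s. 0 < s \<Longrightarrow> s \<le> t \<Longrightarrow> (\<phi> has_real_derivative \<phi>' s) (at s)"
    and max: "\<And>s. s \<in> {0..t} \<Longrightarrow> \<phi> s \<le> \<phi> t"
    and int: "set_integrable lborel {0<..<t} (\<lambda>s. \<phi>' s * (t - s) powr (- \<alpha>))"
  shows "(\<phi> t - \<phi> 0) * t powr (- \<alpha>) \<le> (LBINT s:{0<..<t}. \<phi>' s * (t - s) powr (- \<alpha>))"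
proof -
  let ?k = "\<lambda>s. \<phi>' s * (t - s) powr (- \<alpha>)"
  have k_Ioo: "?k integrable_on {0<..<t}" "(LBINT s:{0<..<t}. ?k s) = integral {0<..<t} ?k"
    using set_borel_integral_eq_integral[OF int] by auto
  then have ki: "?k integrable_on {0..t}"
    by (simp add: integrable_on_Icc_iff_Ioo)
  have lower: "(\<phi> b - \<phi> t) * (t - b) powr (- \<alpha>) + (\<phi> t - \<phi> 0) * t powr (- \<alpha>) \<le> integral {0..b} ?k"
    if b: "0 < b" "b < t" for b
  proof -
    let ?F = "\<lambda>s. (\<phi> s - \<phi> t) * (t - s) powr (- \<alpha>)"
    let ?r = "\<lambda>s. (\<phi> s - \<phi> t) * (\<alpha> * (t - s) powr (- \<alpha> - 1))"
    have F: "((\<lambda>s. ?k s + ?r s) has_integral ?F b - ?F 0) {0..b}"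
    proof (rule fundamental_theorem_of_calculus_interior)
      show "continuous_on {0..b} ?F"
        using b by (intro continuous_intros continuous_on_subset[OF cont]) auto
      fix s assume s: "s \<in> {0<..<b}"
      have p: "((\<lambda>s. (t - s) powr (- \<alpha>)) has_real_derivative - \<alpha> * (t - s) powr (- \<alpha> - 1) * (- 1)) (at s)"
        using s b by (intro DERIV_chain2[OF has_real_derivative_powr]) (auto intro!: derivative_eq_intros)
      have "(?F has_real_derivative (\<phi>' s - 0) * (t - s) powr (- \<alpha>)
          + - \<alpha> * (t - s) powr (- \<alpha> - 1) * (- 1) * (\<phi> s - \<phi> t)) (at s)"
        using s b by (intro DERIV_mult DERIV_diff deriv p DERIV_const) auto
      then show "(?F has_vector_derivative ?k s + ?r s) (at s)"
        by (simp add: has_real_derivative_iff_has_vector_derivative mult_ac)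
    qed (use b in auto)
    have kb: "?k integrable_on {0..b}"
      using integrable_on_subinterval[OF ki, of 0 b] b by auto
    have rb: "?r integrable_on {0..b}"
      using b \<alpha> by (intro integrable_continuous_real continuous_intros continuous_on_subset[OF cont]) auto
    have "integral {0..b} ?r \<le> integral {0..b} (\<lambda>_. 0)"
      using b max \<alpha> by (intro integral_le rb) (auto intro!: mult_nonpos_nonneg)
    moreover have "integral {0..b} ?k + integral {0..b} ?r = ?F b - ?F 0"
      using integral_add[OF kb rb] integral_unique[OF F] by simp
    ultimately show ?thesis by (simp add: algebra_simps)
  qed
  have "((\<lambda>b. integral {0..b} ?k) \<longlongrightarrow> integral {0..t} ?k) (at t within {0..t})"
    using indefinite_integral_continuous_1[OF ki] t by (auto simp: continuous_on_def)
  then have lim1: "((\<lambda>b. integral {0..b} ?k) \<longlongrightarrow> integral {0..t} ?k) (at_left t)"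
    using t by (simp add: at_within_Icc_at_left)
  have "((\<lambda>b. (\<phi> b - \<phi> t) / (b - t)) \<longlongrightarrow> \<phi>' t) (at t)"
    using deriv[of t] t by (simp add: has_field_derivative_iff)
  then have lim2: "((\<lambda>b. (\<phi> b - \<phi> t) / (b - t)) \<longlongrightarrow> \<phi>' t) (at_left t)"
    by (rule filterlim_mono) (auto intro: at_le)
  have "((\<lambda>b. (t - b) powr (1 - \<alpha>)) \<longlongrightarrow> (t - t) powr (1 - \<alpha>)) (at_left t)"
  proof (rule tendsto_powr2)
    show "\<forall>\<^sub>F b in at_left t. 0 \<le> t - b"
      by (auto simp: eventually_at_filter)
    show "((\<lambda>b. t - b) \<longlongrightarrow> t - t) (at_left t)" by (intro tendsto_intros)
  qed (use \<alpha> in auto)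
  \<comment> \<open>The boundary term at b is a difference quotient times (t - b)^(1 - \<alpha>), up
    to sign, so differentiability at t makes it disappear in the limit.\<close>
  then have lim3: "((\<lambda>b. (\<phi> b - \<phi> t) / (b - t) * (- ((t - b) powr (1 - \<alpha>)))) \<longlongrightarrow> \<phi>' t * (- 0)) (at_left t)"
    by (intro tendsto_intros lim2) simp
  have "\<forall>\<^sub>F b in at_left t. (\<phi> b - \<phi> t) / (b - t) * (- ((t - b) powr (1 - \<alpha>))) = (\<phi> b - \<phi> t) * (t - b) powr (- \<alpha>)"
    unfolding eventually_at_filter
  proof (rule always_eventually, intro allI impI)
    fix b assume "b \<noteq> t" "b \<in> {..<t}"
    moreover have "(t - b) powr (1 - \<alpha>) = (t - b) * (t - b) powr (- \<alpha>)"
      using \<open>b \<in> {..<t}\<close> by (simp add: powr_diff powr_minus divide_inverse)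
    ultimately show "(\<phi> b - \<phi> t) / (b - t) * (- ((t - b) powr (1 - \<alpha>))) = (\<phi> b - \<phi> t) * (t - b) powr (- \<alpha>)"
      by (simp only:) (simp add: divide_simps, simp add: algebra_simps)
  qed
  then have lim4: "((\<lambda>b. (\<phi> b - \<phi> t) * (t - b) powr (- \<alpha>)) \<longlongrightarrow> \<phi>' t * (- 0)) (at_left t)"
    using lim3 by (simp add: filterlim_cong)
  have "\<phi>' t * (- 0) + (\<phi> t - \<phi> 0) * t powr (- \<alpha>) \<le> integral {0..t} ?k"
  proof (rule tendsto_le[OF _ lim1 tendsto_add[OF lim4 tendsto_const]])
    show "\<forall>\<^sub>F b in at_left t. (\<phi> b - \<phi> t) * (t - b) powr (- \<alpha>) + (\<phi> t - \<phi> 0) * t powr (- \<alpha>)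
        \<le> integral {0..b} ?k"
      using eventually_at_left_real[OF t] by (rule eventually_mono) (use lower in auto)
  qed simp
  also have "integral {0..t} ?k = (LBINT s:{0<..<t}. ?k s)"
    using k_Ioo by (simp add: integral_open_interval_real)
  finally show ?thesis by simp
qed

text \<open>At a positive maximum \<open>caputo_at_maximum\<close> makes the integral strictly
  positive. It suffices to exclude this at points where the function is positive.\<close>

lemma caputo_comparison:
  assumes cont: "continuous_on {0..b} \<phi>"
    and deriv: "\<And>s. 0 < s \<Longrightarrow> s \<le> b \<Longrightarrow> (\<phi> has_real_derivative \<phi>' s) (at s)"
    and int: "\<And>t. 0 < t \<Longrightarrow> t \<le> b \<Longrightarrow>
      set_integrable lborel {0<..<t} (\<lambda>s. \<phi>' s * (t - s) powr (- \<alpha>))"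
    and init: "\<phi> 0 \<le> 0"
    and neg: "\<And>t. 0 < t \<Longrightarrow> t \<le> b \<Longrightarrow> 0 < \<phi> t \<Longrightarrow>
      (LBINT s:{0<..<t}. \<phi>' s * (t - s) powr (- \<alpha>)) \<le> 0"
    and b: "0 \<le> b"
  shows "\<phi> b \<le> 0"
proof (rule ccontr)
  assume "\<not> \<phi> b \<le> 0"
  obtain t where t: "t \<in> {0..b}" and max: "\<forall>s\<in>{0..b}. \<phi> s \<le> \<phi> t"
    using continuous_attains_sup[OF compact_Icc _ cont] b by auto
  have pos: "0 < \<phi> t" using max b \<open>\<not> \<phi> b \<le> 0\<close> by force
  then have t0: "0 < t" using init t by (cases "t = 0") auto
  have "(\<phi> t - \<phi> 0) * t powr (- \<alpha>) \<le> (LBINT s:{0<..<t}. \<phi>' s * (t - s) powr (- \<alpha>))"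
    using t t0 max int by (intro caputo_at_maximum) (auto intro: continuous_on_subset[OF cont] deriv)
  also have "\<dots> \<le> 0" using t t0 pos by (intro neg) auto
  finally show False
    using pos init t0 by (simp add: mult_le_0_iff)
qed

section \<open>Sign, monotonicity and size of the Mittag-Leffler modes\<close>

lemma ml_mode_nonneg:
  assumes c: "0 \<le> c" and t: "0 \<le> t"
  shows "0 \<le> ml_mode \<alpha> c t"
proof -
  have "- ml_mode \<alpha> c t \<le> 0"
  proof (rule caputo_comparison[where \<phi> = "\<lambda>t. - ml_mode \<alpha> c t" and b = t
        and \<phi>' = "\<lambda>s. - ml_mode' \<alpha> c s"])
    show "continuous_on {0..t} (\<lambda>t. - ml_mode \<alpha> c t)"
      by (intro continuous_intros continuous_on_subset[OF continuous_on_ml_mode]) auto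
    fix s :: real assume s: "0 < s" "s \<le> t"
    show "((\<lambda>t. - ml_mode \<alpha> c t) has_real_derivative - ml_mode' \<alpha> c s) (at s)"
      by (intro DERIV_minus ml_mode_deriv s)
    show "set_integrable lborel {0<..<s} (\<lambda>r. - ml_mode' \<alpha> c r * (s - r) powr (- \<alpha>))"
      using ml_mode'_caputo(1)[OF s(1), of c] by (simp add: set_integrable_def)
    assume "0 < - ml_mode \<alpha> c s"
    then have "c * Gamma (1 - \<alpha>) * ml_mode \<alpha> c s \<le> 0"
      using c \<alpha> by (intro mult_nonneg_nonpos mult_nonneg_nonneg) (auto intro!: less_imp_le Gamma_real_pos)
    then show "(LBINT r:{0<..<s}. - ml_mode' \<alpha> c r * (s - r) powr (- \<alpha>)) \<le> 0"
      using ml_mode'_caputo(2)[OF s(1), of c] by (simp add: set_lebesgue_integral_def)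
  qed (use t in \<open>auto simp: ml_mode_0\<close>)
  then show ?thesis by simp
qed

text \<open>Where y_d - y_c is positive, nonnegativity of y_c gives D^\<alpha> (y_d - y_c) = c y_c -
  d y_d \<le> 0, as the comparison lemma asks.\<close>

lemma ml_mode_antimono:
  assumes c: "0 \<le> c" "c \<le> d" and t: "0 \<le> t"
  shows "ml_mode \<alpha> d t \<le> ml_mode \<alpha> c t"
proof -
  have "ml_mode \<alpha> d t - ml_mode \<alpha> c t \<le> 0"
  proof (rule caputo_comparison[where \<phi> = "\<lambda>t. ml_mode \<alpha> d t - ml_mode \<alpha> c t" and b = t
        and \<phi>' = "\<lambda>s. ml_mode' \<alpha> d s - ml_mode' \<alpha> c s"])
    show "continuous_on {0..t} (\<lambda>t. ml_mode \<alpha> d t - ml_mode \<alpha> c t)"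
      by (intro continuous_intros continuous_on_subset[OF continuous_on_ml_mode]) auto
    fix s :: real assume s: "0 < s" "s \<le> t"
    show "((\<lambda>t. ml_mode \<alpha> d t - ml_mode \<alpha> c t) has_real_derivative ml_mode' \<alpha> d s - ml_mode' \<alpha> c s) (at s)"
      by (intro DERIV_diff ml_mode_deriv s)
    note C = ml_mode'_caputo[OF s(1)]
    show "set_integrable lborel {0<..<s} (\<lambda>r. (ml_mode' \<alpha> d r - ml_mode' \<alpha> c r) * (s - r) powr (- \<alpha>))"
      unfolding left_diff_distrib by (intro set_integral_diff C)
    assume pos: "0 < ml_mode \<alpha> d s - ml_mode \<alpha> c s"
    have "(LBINT r:{0<..<s}. (ml_mode' \<alpha> d r - ml_mode' \<alpha> c r) * (s - r) powr (- \<alpha>))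
        = - Gamma (1 - \<alpha>) * (d * ml_mode \<alpha> d s - c * ml_mode \<alpha> c s)"
      unfolding left_diff_distrib set_integral_diff(2)[OF C(1) C(1)] C(2) by (simp add: algebra_simps)
    also have "\<dots> \<le> 0"
    proof -
      have "c * ml_mode \<alpha> c s \<le> d * ml_mode \<alpha> d s"
        using c pos s ml_mode_nonneg[of c s] by (intro mult_mono) auto
      moreover have "0 < Gamma (1 - \<alpha>)" using \<alpha> by (intro Gamma_real_pos) simp
      ultimately show ?thesis by (simp add: mult_le_0_iff)
    qed
    finally show "(LBINT r:{0<..<s}. (ml_mode' \<alpha> d r - ml_mode' \<alpha> c r) * (s - r) powr (- \<alpha>)) \<le> 0" .
  qed (use t in \<open>auto simp: ml_mode_0\<close>)
  then show ?thesis by simp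
qed

lemma ml_mode_le_1:
  assumes "0 \<le> c" "0 \<le> t"
  shows "ml_mode \<alpha> c t \<le> 1"
proof -
  have "ml_mode \<alpha> 0 t = 1" by (simp add: ml_mode_def mittag_leffler_eq ml2_0)
  then show ?thesis using ml_mode_antimono[of 0 c t] assms by simp
qed

text \<open>A value 1 at t would be a maximum over [0,t] equal to the initial value, so the Caputo
  derivative there would be nonnegative, whereas it equals - c. This keeps the denominators of the
  solution formula away from 0.\<close>

lemma ml_mode_less_1:
  assumes c: "0 < c" and t: "0 < t"
  shows "ml_mode \<alpha> c t < 1"
proof (rule ccontr)
  assume "\<not> ml_mode \<alpha> c t < 1"
  then have 1: "ml_mode \<alpha> c t = 1" using ml_mode_le_1[of c t] c t by simp
  have "(ml_mode \<alpha> c t - ml_mode \<alpha> c 0) * t powr (- \<alpha>)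
      \<le> (LBINT s:{0<..<t}. ml_mode' \<alpha> c s * (t - s) powr (- \<alpha>))"
    using t c by (intro caputo_at_maximum ml_mode'_caputo)
      (auto simp: 1 intro!: ml_mode_deriv ml_mode_le_1 continuous_on_subset[OF continuous_on_ml_mode])
  then have "c * Gamma (1 - \<alpha>) \<le> 0"
    unfolding ml_mode'_caputo(2)[OF t] by (simp add: 1 ml_mode_0)
  moreover have "0 < Gamma (1 - \<alpha>)" using \<alpha> by (intro Gamma_real_pos) simp
  ultimately show False using c by (simp add: mult_le_0_iff)
qed

text \<open>By scaling, y_c(t) = y_c'(s) with c' = c (t/s)^\<alpha> \<le> c for s > t. Monotonicity
  in c thus becomes monotonicity in time.\<close>

lemma ml_mode'_nonpos:
  assumes c: "0 \<le> c" and t: "0 < t"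
  shows "ml_mode' \<alpha> c t \<le> 0"
proof (rule ccontr)
  assume "\<not> ml_mode' \<alpha> c t \<le> 0"
  then obtain d where d: "0 < d" "\<And>h. 0 < h \<Longrightarrow> h < d \<Longrightarrow> ml_mode \<alpha> c t < ml_mode \<alpha> c (t + h)"
    using DERIV_pos_inc_right[OF ml_mode_deriv[OF t, of c]] by auto
  define s where "s = t + d / 2"
  have s: "t < s" "ml_mode \<alpha> c t < ml_mode \<alpha> c s" using d by (auto simp: s_def)
  define c' where "c' = c * (t / s) powr \<alpha>"
  have "(t / s) powr \<alpha> \<le> 1" using s t \<alpha> by (intro powr_le1) auto
  then have c': "0 \<le> c'" "c' \<le> c" using c by (auto simp: c'_def mult_left_le)
  have "ml_mode \<alpha> c t = ml_mode \<alpha> c' s"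
    using s t by (simp add: ml_mode_def c'_def powr_divide)
  then show False using ml_mode_antimono[OF c', of s] s t by simp
qed

lemma abs_ml_mode'_le:
  assumes c: "0 \<le> c" and t: "0 < t"
  shows "\<bar>ml_mode' \<alpha> c t\<bar> \<le> c * t powr (\<alpha> - 1) / Gamma \<alpha>"
proof -
  have "(LBINT s:{0<..<t}. - (ml_mode' \<alpha> c s * (t - s) powr (\<alpha> - 1))) \<ge> 0"
    unfolding set_lebesgue_integral_def using c
    by (intro Bochner_Integration.integral_nonneg)
      (auto simp: indicator_def mult_le_0_iff ml_mode'_nonpos)
  then have "(LBINT s:{0<..<t}. ml_mode' \<alpha> c s * (t - s) powr (\<alpha> - 1)) \<le> 0"
    by (simp add: set_lebesgue_integral_def)
  then have "c / Gamma \<alpha> * (LBINT s:{0<..<t}. ml_mode' \<alpha> c s * (t - s) powr (\<alpha> - 1)) \<le> 0"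
    using c \<alpha> by (intro mult_nonneg_nonpos) (auto intro!: less_imp_le Gamma_real_pos)
  then show ?thesis
    using ml_mode'_volterra[OF t, of c] ml_mode'_nonpos[OF c t] by simp
qed

end


section \<open>Integrating the Caputo derivative\<close>

lemma caputo_eq: "caputo \<alpha> \<phi> t
    = 1 / Gamma (1 - \<alpha>) * (LBINT \<tau>:{0<..<t}. deriv \<phi> \<tau> * (t - \<tau>) powr (- \<alpha>))"
  by (simp add: caputo_def powr_minus divide_inverse)

lemma caputo_cong:
  assumes "\<And>\<tau>. \<tau> \<in> {0<..<t} \<Longrightarrow> (\<phi> has_real_derivative \<phi>' \<tau>) (at \<tau>)"
  shows "caputo \<alpha> \<phi> t
    = 1 / Gamma (1 - \<alpha>) * (LBINT \<tau>:{0<..<t}. \<phi>' \<tau> * (t - \<tau>) powr (- \<alpha>))"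
  unfolding caputo_eq
  by (rule arg_cong[of _ _ "(*) _"], rule set_lebesgue_integral_cong)
    (use assms in \<open>auto dest!: DERIV_imp_deriv\<close>)

lemma caputo_differentiable_iff:
  "caputo_differentiable \<alpha> T \<phi> \<longleftrightarrow>
    (\<forall>\<tau>\<in>{0<..<T}. \<phi> field_differentiable at \<tau>) \<and>
    (\<forall>t\<in>{0<..<T}. set_integrable lborel {0<..<t} (\<lambda>\<tau>. deriv \<phi> \<tau> * (t - \<tau>) powr (- \<alpha>)))"
  by (simp add: caputo_differentiable_def powr_minus divide_inverse)

lemma caputo_differentiableI:
  assumes "\<And>\<tau>. \<tau> \<in> {0<..<T} \<Longrightarrow> (\<phi> has_real_derivative \<phi>' \<tau>) (at \<tau>)"
    and "\<And>t. t \<in> {0<..<T} \<Longrightarrow> set_integrable lborel {0<..<t} (\<lambda>\<tau>. \<phi>' \<tau> * (t - \<tau>) powr (- \<alpha>))"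
  shows "caputo_differentiable \<alpha> T \<phi>"
  unfolding caputo_differentiable_iff
proof (intro conjI ballI)
  show "\<phi> field_differentiable at \<tau>" if "\<tau> \<in> {0<..<T}" for \<tau>
    using assms(1)[OF that] by (auto simp: field_differentiable_def)
  fix t assume t: "t \<in> {0<..<T}"
  have "set_integrable lborel {0<..<t} (\<lambda>\<tau>. deriv \<phi> \<tau> * (t - \<tau>) powr (- \<alpha>))
    \<longleftrightarrow> set_integrable lborel {0<..<t} (\<lambda>\<tau>. \<phi>' \<tau> * (t - \<tau>) powr (- \<alpha>))"
    by (rule set_integrable_cong) (use assms(1) t in \<open>auto simp: DERIV_imp_deriv\<close>)
  then show "set_integrable lborel {0<..<t} (\<lambda>\<tau>. deriv \<phi> \<tau> * (t - \<tau>) powr (- \<alpha>))"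
    using assms(2)[OF t] by simp
qed

text \<open>Since \<open>k\<close> is nonnegative and its integrals over s are bounded by C,
  integrability of \<open>p\<close> alone makes the product integrable on the triangle 0 < \<tau> <
  s < t.\<close>

lemma triangle_fubini:
  fixes p K :: "real \<Rightarrow> real" and k :: "real \<Rightarrow> real \<Rightarrow> real"
  assumes p: "set_integrable lborel {0<..<t} p"
    and k[measurable]: "(\<lambda>z. k (snd z) (fst z)) \<in> borel_measurable (borel \<Otimes>\<^sub>M borel)"
    and kpos: "\<And>s \<tau>. 0 \<le> k s \<tau>"
    and kint: "\<And>\<tau>. \<tau> \<in> {0<..<t} \<Longrightarrow> set_integrable lborel {\<tau><..<t} (\<lambda>s. k s \<tau>)"
    and K: "\<And>\<tau>. \<tau> \<in> {0<..<t} \<Longrightarrow> (LBINT s:{\<tau><..<t}. k s \<tau>) = K \<tau>"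
    and C: "\<And>\<tau>. \<tau> \<in> {0<..<t} \<Longrightarrow> K \<tau> \<le> C"
  shows "set_integrable lborel {0<..<t} (\<lambda>s. LBINT \<tau>:{0<..<s}. p \<tau> * k s \<tau>)" (is ?int)
    and "(LBINT s:{0<..<t}. (LBINT \<tau>:{0<..<s}. p \<tau> * k s \<tau>)) = (LBINT \<tau>:{0<..<t}. p \<tau> * K \<tau>)"
      (is ?eq)
proof -
  let ?p = "\<lambda>\<tau>. indicator {0<..<t} \<tau> * p \<tau>"
  define F where "F = (\<lambda>z. if fst z < snd z \<and> snd z < t then ?p (fst z) * k (snd z) (fst z) else 0)"
  have pi: "integrable lborel ?p" using p by (simp add: set_integrable_def)
  then have pm[measurable]: "?p \<in> borel_measurable borel" by simp
  have "F \<in> borel_measurable (borel \<Otimes>\<^sub>M borel)"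
    unfolding F_def by measurable
  then have Fm: "F \<in> borel_measurable (lborel \<Otimes>\<^sub>M lborel)"
    by (simp cong: measurable_cong_sets sets_pair_measure_cong)
  have Fsec: "F (\<tau>, s) = ?p \<tau> * (indicator {\<tau><..<t} s * k s \<tau>)" for \<tau> s
    by (auto simp: F_def indicator_def)
  have Fsec_int: "integrable lborel (\<lambda>s. F (\<tau>, s))" for \<tau>
  proof (cases "\<tau> \<in> {0<..<t}")
    case True
    show ?thesis
      unfolding Fsec using kint[OF True] by (auto simp: set_integrable_def intro!: integrable_mult_right)
  qed (simp add: Fsec)
  have Fsec_val: "(LBINT s. F (\<tau>, s)) = indicator {0<..<t} \<tau> * (p \<tau> * K \<tau>)" for \<tau>
  proof (cases "\<tau> \<in> {0<..<t}")
    case True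
    show ?thesis
      unfolding Fsec integral_mult_right_zero using K[OF True] by (simp add: set_lebesgue_integral_def)
  qed (simp add: Fsec)
  have Fsec_norm: "(LBINT s. norm (F (\<tau>, s))) = norm (LBINT s. F (\<tau>, s))" for \<tau>
  proof -
    have "(LBINT s. norm (F (\<tau>, s))) = \<bar>?p \<tau>\<bar> * (LBINT s. indicator {\<tau><..<t} s * k s \<tau>)"
      unfolding integral_mult_right_zero[symmetric]
      by (rule Bochner_Integration.integral_cong) (use kpos in \<open>auto simp: Fsec abs_mult indicator_def\<close>)
    also have "\<dots> = norm (?p \<tau> * (LBINT s. indicator {\<tau><..<t} s * k s \<tau>))"
    proof -
      have "0 \<le> (LBINT s. indicator {\<tau><..<t} s * k s \<tau>)"
        using kpos by (intro Bochner_Integration.integral_nonneg) auto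
      then show ?thesis by (simp add: abs_mult)
    qed
    also have "\<dots> = norm (LBINT s. F (\<tau>, s))"
      unfolding Fsec integral_mult_right_zero ..
    finally show ?thesis .
  qed
  have K0: "0 \<le> K \<tau>" if "\<tau> \<in> {0<..<t}" for \<tau>
    unfolding K[OF that, symmetric] set_lebesgue_integral_def
    using kpos by (intro Bochner_Integration.integral_nonneg) auto
  have "integrable (lborel \<Otimes>\<^sub>M lborel) F"
  proof (rule lborel_pair.Fubini_integrable[OF Fm])
    show "integrable lborel (\<lambda>\<tau>. LBINT s. norm (F (\<tau>, s)))"
    proof (rule Bochner_Integration.integrable_bound)
      show "integrable lborel (\<lambda>\<tau>. C * ?p \<tau>)" using pi by (rule integrable_mult_right)
      show "(\<lambda>\<tau>. LBINT s. norm (F (\<tau>, s))) \<in> borel_measurable lborel"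
        using Fm by measurable
      show "AE \<tau> in lborel. norm (LBINT s. norm (F (\<tau>, s))) \<le> norm (C * ?p \<tau>)"
      proof (rule AE_I2)
        fix \<tau>
        show "norm (LBINT s. norm (F (\<tau>, s))) \<le> norm (C * ?p \<tau>)"
        proof (cases "\<tau> \<in> {0<..<t}")
          case True
          have "\<bar>p \<tau>\<bar> * \<bar>K \<tau>\<bar> \<le> \<bar>p \<tau>\<bar> * \<bar>C\<bar>"
            using K0[OF True] C[OF True] by (intro mult_left_mono) auto
          then show ?thesis
            using True unfolding Fsec_norm Fsec_val by (simp add: abs_mult mult.commute)
        qed (simp add: Fsec)
      qed
    qed
  qed (simp add: Fsec_int)
  then have Fint: "integrable (lborel \<Otimes>\<^sub>M lborel) (case_prod (\<lambda>\<tau> s. F (\<tau>, s)))"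
    by simp
  have Fsnd: "(LBINT \<tau>. F (\<tau>, s)) = indicator {0<..<t} s * (LBINT \<tau>:{0<..<s}. p \<tau> * k s \<tau>)" for s
  proof (cases "s \<in> {0<..<t}")
    case True
    then have "F (\<tau>, s) = indicator {0<..<s} \<tau> *\<^sub>R (p \<tau> * k s \<tau>)" for \<tau>
      by (auto simp: F_def indicator_def)
    then show ?thesis using True by (simp add: set_lebesgue_integral_def)
  next
    case False
    then have "F (\<tau>, s) = 0" for \<tau> by (auto simp: F_def indicator_def)
    then show ?thesis using False by simp
  qed
  show ?int
    using lborel_pair.integrable_snd[OF Fint] unfolding Fsnd by (simp add: set_integrable_def)
  show ?eq
    using lborel_pair.Fubini_integral[OF Fint] unfolding Fsnd Fsec_val
    by (simp add: set_lebesgue_integral_def)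
qed

text \<open>The kernels (s - \<tau>)^(-\<alpha>) and (t - s)^(-\<alpha>) have the same integral over
  \<tau> < s < t. Exchanging the order of integration with the first produces the time integral of
  the Caputo derivative, with the second an integral of \<phi> - \<phi>(0). No derivative of \<phi>
  survives on the right.\<close>

lemma caputo_integral:
  assumes \<alpha>: "0 < \<alpha>" "\<alpha> < 1" and cd: "caputo_differentiable \<alpha> T \<phi>"
    and cont: "continuous_on {0..T} \<phi>" and t: "0 < t" "t < T"
  shows "set_integrable lborel {0<..<t} (caputo \<alpha> \<phi>)"
    and "(LBINT s:{0<..<t}. caputo \<alpha> \<phi> s)
      = 1 / Gamma (1 - \<alpha>) * (LBINT s:{0<..<t}. (\<phi> s - \<phi> 0) * (t - s) powr (- \<alpha>))"
proof -
  let ?p = "deriv \<phi>"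
  \<comment> \<open>On (0,t) the kernel is at least t^(-\<alpha>), so integrability of the
    derivative is inherited from its product with the kernel; measurability is read off from that
    product too.\<close>
  have p: "set_integrable lborel {0<..<t} ?p"
  proof -
    have pk: "set_integrable lborel {0<..<t} (\<lambda>\<tau>. ?p \<tau> * (t - \<tau>) powr (- \<alpha>))"
      using cd t by (auto simp: caputo_differentiable_iff)
    let ?g = "\<lambda>\<tau>. indicator {0<..<t} \<tau> * (?p \<tau> * (t - \<tau>) powr (- \<alpha>))"
    have gi: "integrable lborel ?g" using pk by (simp add: set_integrable_def)
    then have gm[measurable]: "?g \<in> borel_measurable borel" by simp
    have eq: "indicator {0<..<t} \<tau> * ?p \<tau> = ?g \<tau> * (t - \<tau>) powr \<alpha>" for \<tau>
      by (auto simp: indicator_def powr_minus)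
    have "integrable lborel (\<lambda>\<tau>. indicator {0<..<t} \<tau> * ?p \<tau>)"
    proof (rule Bochner_Integration.integrable_bound)
      show "integrable lborel (\<lambda>\<tau>. t powr \<alpha> * ?g \<tau>)" using gi by (rule integrable_mult_right)
      show "(\<lambda>\<tau>. indicator {0<..<t} \<tau> * ?p \<tau>) \<in> borel_measurable lborel"
        unfolding eq by measurable
      have "\<bar>?g \<tau> * (t - \<tau>) powr \<alpha>\<bar> \<le> \<bar>t powr \<alpha> * ?g \<tau>\<bar>" for \<tau>
      proof (cases "\<tau> \<in> {0<..<t}")
        case True
        then have "(t - \<tau>) powr \<alpha> \<le> t powr \<alpha>" using \<alpha> by (intro powr_mono2) auto
        then show ?thesis unfolding abs_mult by (simp add: mult_left_mono mult.commute[of "t powr \<alpha>"])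
      qed simp
      then show "AE \<tau> in lborel. norm (indicator {0<..<t} \<tau> * ?p \<tau>) \<le> norm (t powr \<alpha> * ?g \<tau>)"
        unfolding eq by simp
    qed
    then show ?thesis by (simp add: set_integrable_def)
  qed
  have ftc: "(LBINT \<tau>:{0<..<s}. ?p \<tau>) = \<phi> s - \<phi> 0" if s: "s \<in> {0<..<t}" for s
  proof -
    have "(?p has_integral (\<phi> s - \<phi> 0)) {0..s}"
    proof (rule fundamental_theorem_of_calculus_interior)
      show "continuous_on {0..s} \<phi>" using s t by (intro continuous_on_subset[OF cont]) auto
      fix \<tau> assume "\<tau> \<in> {0<..<s}"
      then have "\<phi> field_differentiable at \<tau>"
        using cd s t by (auto simp: caputo_differentiable_iff)
      then show "(\<phi> has_vector_derivative ?p \<tau>) (at \<tau>)"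
        by (simp add: has_real_derivative_iff_has_vector_derivative[symmetric] DERIV_deriv_iff_field_differentiable)
    qed (use s in auto)
    then have "integral {0<..<s} ?p = \<phi> s - \<phi> 0"
      by (metis integral_open_interval_real integral_unique)
    moreover have "set_integrable lborel {0<..<s} ?p"
      using s by (intro set_integrable_subset[OF p]) auto
    ultimately show ?thesis by (simp add: set_borel_integral_eq_integral(2))
  qed
  define K where "K \<tau> = (t - \<tau>) powr (1 - \<alpha>) / (1 - \<alpha>)" for \<tau>
  have C: "K \<tau> \<le> t powr (1 - \<alpha>) / (1 - \<alpha>)" if "\<tau> \<in> {0<..<t}" for \<tau>
    unfolding K_def using that \<alpha> by (intro divide_right_mono powr_mono2) auto
  have 1: "set_integrable lborel {0<..<t} (\<lambda>s. LBINT \<tau>:{0<..<s}. ?p \<tau> * (s - \<tau>) powr (- \<alpha>))"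
    "(LBINT s:{0<..<t}. (LBINT \<tau>:{0<..<s}. ?p \<tau> * (s - \<tau>) powr (- \<alpha>))) = (LBINT \<tau>:{0<..<t}. ?p \<tau> * K \<tau>)"
    using triangle_fubini[OF p, where k = "\<lambda>s \<tau>. (s - \<tau>) powr (- \<alpha>)" and K = K, OF _ _ _ _ C]
      power_kernel_left[of "1 - \<alpha>" _ t] \<alpha> by (simp_all add: K_def)
  have 2: "(LBINT s:{0<..<t}. (LBINT \<tau>:{0<..<s}. ?p \<tau> * (t - s) powr (- \<alpha>))) = (LBINT \<tau>:{0<..<t}. ?p \<tau> * K \<tau>)"
    using triangle_fubini(2)[OF p, where k = "\<lambda>s \<tau>. (t - s) powr (- \<alpha>)" and K = K, OF _ _ _ _ C]
      power_kernel_right[of "1 - \<alpha>" _ t] \<alpha> by (simp add: K_def)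
  show "set_integrable lborel {0<..<t} (caputo \<alpha> \<phi>)"
    using set_integrable_mult_right[OF 1(1), of "1 / Gamma (1 - \<alpha>)"]
    unfolding caputo_eq[abs_def] by simp
  have "(LBINT s:{0<..<t}. caputo \<alpha> \<phi> s) = 1 / Gamma (1 - \<alpha>) * (LBINT \<tau>:{0<..<t}. ?p \<tau> * K \<tau>)"
    unfolding caputo_eq 1(2)[symmetric] by (rule set_integral_mult_right)
  also have "(LBINT \<tau>:{0<..<t}. ?p \<tau> * K \<tau>) = (LBINT s:{0<..<t}. (\<phi> s - \<phi> 0) * (t - s) powr (- \<alpha>))"
    unfolding 2[symmetric] by (rule set_lebesgue_integral_cong) (auto simp: ftc)
  finally show "(LBINT s:{0<..<t}. caputo \<alpha> \<phi> s)
      = 1 / Gamma (1 - \<alpha>) * (LBINT s:{0<..<t}. (\<phi> s - \<phi> 0) * (t - s) powr (- \<alpha>))" .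
qed


section \<open>Fourier--Bessel expansion of smooth functions\<close>

lemma fourier_bessel_coeff_eq:
  assumes l: "l \<noteq> 0" "bessel_J 0 l = 0" and v: "continuous_on {0..1} v"
  shows "fourier_bessel_coeff l v
    = wip v (\<lambda>x. bessel_J 0 (l * x)) / wip (\<lambda>x. bessel_J 0 (l * x)) (\<lambda>x. bessel_J 0 (l * x))"
proof -
  have "set_integrable lborel {0..1} (\<lambda>x. x * v x * bessel_J 0 (l * x))"
    by (intro borel_integrable_atLeastAtMost' continuous_intros v continuous_on_bessel_mode)
  then have "(LBINT x:{0..1}. x * v x * bessel_J 0 (l * x)) = wip v (\<lambda>x. bessel_J 0 (l * x))"
    unfolding wip_def by (rule set_borel_integral_eq_integral(2))
  then show ?thesis
    by (simp add: fourier_bessel_coeff_def wip_bessel_mode_self[OF l])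
qed

text \<open>Green's second identity, with \<open>P\<close> the flux x p'. The boundary terms vanish
  by \<open>p 1 = 0\<close>, \<open>P 0 = 0\<close> and J_0(l) = 0. Stating it with
  \<open>has_integral\<close> delivers integrability even when \<open>q\<close> is not
  continuous.\<close>

lemma bessel_mode_by_parts:
  assumes l: "l \<noteq> 0" "bessel_J 0 l = 0"
    and p: "continuous_on {0..1} p" and P: "continuous_on {0..1} P"
    and dp: "\<And>x. x \<in> {0<..<1} \<Longrightarrow> (p has_real_derivative P x / x) (at x)"
    and dP: "\<And>x. x \<in> {0<..<1} \<Longrightarrow> (P has_real_derivative x * q x) (at x)"
    and bc: "p 1 = 0" "P 0 = 0"
  shows "((\<lambda>x. x * q x * bessel_J 0 (l * x)) has_integral
      - l\<^sup>2 * wip p (\<lambda>x. bessel_J 0 (l * x))) {0..1}"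
proof -
  let ?\<phi> = "\<lambda>x. bessel_J 0 (l * x)"
  let ?\<psi> = "\<lambda>x. x * bessel_J 1 (l * x)"
  let ?F = "\<lambda>x. P x * ?\<phi> x + l * (p x * ?\<psi> x)"
  have c\<psi>: "continuous_on {0..1} ?\<psi>"
    by (rule DERIV_continuous_on[OF bessel_mode_flux_deriv[OF l(1)]])
  have "((\<lambda>x. x * q x * ?\<phi> x + l\<^sup>2 * (x * p x * ?\<phi> x)) has_integral ?F 1 - ?F 0) {0..1}"
  proof (rule fundamental_theorem_of_calculus_interior)
    show "continuous_on {0..1} ?F"
      by (intro continuous_intros p P c\<psi> continuous_on_bessel_mode)
    fix x :: real assume x: "x \<in> {0<..<1}"
    have "(?F has_real_derivative
        (x * q x * ?\<phi> x + (- l * bessel_J 1 (l * x)) * P x)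
        + l * (P x / x * ?\<psi> x + (l * x * ?\<phi> x) * p x)) (at x)"
      by (intro DERIV_add DERIV_mult DERIV_cmult dp[OF x] dP[OF x] bessel_mode_deriv
          bessel_mode_flux_deriv l)
    then have "(?F has_real_derivative x * q x * ?\<phi> x + l\<^sup>2 * (x * p x * ?\<phi> x)) (at x)"
      by (rule DERIV_cong) (use x in \<open>simp add: power2_eq_square algebra_simps\<close>)
    then show "(?F has_vector_derivative x * q x * ?\<phi> x + l\<^sup>2 * (x * p x * ?\<phi> x)) (at x)"
      by (simp add: has_real_derivative_iff_has_vector_derivative)
  qed simp
  moreover have "((\<lambda>x. l\<^sup>2 * (x * p x * ?\<phi> x)) has_integral l\<^sup>2 * wip p ?\<phi>) {0..1}"
    unfolding wip_def
    by (intro has_integral_mult_right integrable_integral wip_integrable p continuous_on_bessel_mode)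
  ultimately have "((\<lambda>x. (x * q x * ?\<phi> x + l\<^sup>2 * (x * p x * ?\<phi> x)) - l\<^sup>2 * (x * p x * ?\<phi> x))
      has_integral (?F 1 - ?F 0) - l\<^sup>2 * wip p ?\<phi>) {0..1}"
    by (rule has_integral_diff)
  then show ?thesis using bc l by simp
qed

lemma continuous_on_div_vanishing:
  fixes v :: "real \<Rightarrow> real"
  assumes v: "continuous_on {0..1} v" and B: "\<And>x. x \<in> {0..1} \<Longrightarrow> \<bar>v x\<bar> \<le> B * x\<^sup>2"
  shows "continuous_on {0..1} (\<lambda>x. v x / x)"
  unfolding continuous_on_def
proof
  fix x :: real assume x: "x \<in> {0..1}"
  show "((\<lambda>x. v x / x) \<longlongrightarrow> v x / x) (at x within {0..1})"
  proof (cases "x = 0")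
    case False
    then show ?thesis using v x by (auto intro!: tendsto_intros simp: continuous_on_def)
  next
    case True
    have "((\<lambda>x. v x / x) \<longlongrightarrow> 0) (at 0 within {0..1})"
    proof (rule Lim_null_comparison)
      show "((\<lambda>x. B * x) \<longlongrightarrow> 0) (at 0 within {0..1})" by (auto intro!: tendsto_eq_intros)
      show "\<forall>\<^sub>F x in at 0 within {0..1}. norm (v x / x) \<le> B * x"
        using B by (auto simp: eventually_at_filter divide_simps power2_eq_square mult_ac)
    qed
    then show ?thesis using True by simp
  qed
qed

lemma vanishing_order_step:
  fixes v v' :: "real \<Rightarrow> real"
  assumes "\<And>x. x \<in> {0..1} \<Longrightarrow> (v has_real_derivative v' x) (at x within {0..1})" "v 0 = 0"
    and B: "\<And>x. x \<in> {0..1} \<Longrightarrow> \<bar>v' x\<bar> \<le> B * x ^ n" and x: "x \<in> {0..1}" and "0 \<le> B"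
  shows "\<bar>v x\<bar> \<le> B * x ^ Suc n"
proof -
  have "norm (v x - v 0) \<le> (B * x ^ n) * norm (x - 0)"
  proof (rule field_differentiable_bound[of "{0..x}" v v'])
    fix s assume s: "s \<in> {0..x}"
    show "(v has_field_derivative v' s) (at s within {0..x})"
      by (rule DERIV_subset[OF assms(1)]) (use s x in auto)
    have "B * s ^ n \<le> B * x ^ n" using s \<open>0 \<le> B\<close> by (intro mult_left_mono power_mono) auto
    then show "norm (v' s) \<le> B * x ^ n" using B[of s] s x by auto
  qed (use x in auto)
  then show ?thesis using x assms(2) by (simp add: mult_ac)
qed

section \<open>The zeros of J_0 and the system of their modes\<close>

locale bessel_zeros =
  fixes L :: "nat \<Rightarrow> real"
  assumes L_inj: "inj L" and L_zeros: "range L = {x. 0 < x \<and> bessel_J 0 x = 0}"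
    and L_least: "L 0 \<le> L k"
begin

lemma L_pos: "0 < L k" and L_zero: "bessel_J 0 (L k) = 0"
  using L_zeros by (metis (mono_tags, lifting) mem_Collect_eq rangeI)+

definition \<phi> :: "nat \<Rightarrow> real \<Rightarrow> real" where "\<phi> k x = bessel_J 0 (L k * x)"

lemma \<phi>_abs: "\<phi> k = (\<lambda>x. bessel_J 0 (L k * x))"
  by (simp add: fun_eq_iff \<phi>_def)

lemma continuous_on_\<phi>: "continuous_on A (\<phi> k)"
  unfolding \<phi>_abs by (rule continuous_on_bessel_mode)

lemma \<phi>_1: "\<phi> k 1 = 0"
  by (simp add: \<phi>_def L_zero)

lemma \<phi>_norm_pos: "0 < wip (\<phi> k) (\<phi> k)"
  unfolding \<phi>_abs by (rule wip_bessel_mode_pos)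

lemma green_\<phi>: "x \<in> {0..1} \<Longrightarrow> green (\<phi> k) x = \<phi> k x / (L k)\<^sup>2"
  unfolding \<phi>_abs using L_pos[of k] L_zero[of k] by (simp add: green_bessel_mode)

lemma \<phi>_orthogonal: "j \<noteq> k \<Longrightarrow> wip (\<phi> j) (\<phi> k) = 0"
  unfolding \<phi>_abs using L_inj by (intro bessel_modes_orthogonal L_pos L_zero) (auto simp: inj_def)

lemma \<phi>_complete:
  assumes "continuous_on {0..1} v" "\<And>k. wip v (\<phi> k) = 0" "x \<in> {0..1}"
  shows "v x = 0"
proof (rule bessel_modes_complete[OF assms(1) _ assms(3)])
  fix l :: real assume "0 < l" "bessel_J 0 l = 0"
  then obtain k where "l = L k" using L_zeros by (metis (mono_tags, lifting) mem_Collect_eq rangeE)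
  then show "wip v (\<lambda>x. bessel_J 0 (l * x)) = 0" using assms(2)[of k] by (simp add: \<phi>_abs)
qed

end

text \<open>The datum is the difference g - f, with \<open>e i\<close> its i-th derivative, because
  the series involve only g_k - f_k.\<close>

locale smooth_datum = bessel_zeros +
  fixes e :: "nat \<Rightarrow> real \<Rightarrow> real"
  assumes e_deriv: "\<And>i x. i < 4 \<Longrightarrow> x \<in> {0..1} \<Longrightarrow>
      (e i has_real_derivative e (Suc i) x) (at x within {0..1})"
    and e_0: "\<And>i. i < 4 \<Longrightarrow> e i 0 = 0" and e_1: "\<And>i. i < 3 \<Longrightarrow> e i 1 = 0"
    and e_bounded: "bounded (e 4 ` {0..1})"
begin

lemma continuous_on_e: "i < 4 \<Longrightarrow> continuous_on {0..1} (e i)"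
  by (rule DERIV_continuous_on[OF e_deriv])

lemma e_deriv_at: "i < 4 \<Longrightarrow> x \<in> {0<..<1} \<Longrightarrow> (e i has_real_derivative e (Suc i) x) (at x)"
  using e_deriv[of i x] by (simp add: at_within_Icc_at)

text \<open>Integrating the bound on the fourth derivative back from 0 gains one power of x per
  step. These powers absorb the negative powers of x in \<open>q\<close>.\<close>

lemma e_vanishing:
  obtains B where "0 \<le> B" "\<And>i x. i \<le> 4 \<Longrightarrow> x \<in> {0..1} \<Longrightarrow> \<bar>e i x\<bar> \<le> B * x ^ (4 - i)"
proof -
  obtain B where B: "\<forall>y\<in>e 4 ` {0..1}. norm y \<le> B" using e_bounded unfolding bounded_iff by blast
  then have B0: "0 \<le> B" by (force intro: order_trans[OF abs_ge_zero])
  have "\<bar>e (4 - j) x\<bar> \<le> B * x ^ j" if "j \<le> 4" "x \<in> {0..1}" for j x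
    using that
  proof (induction j arbitrary: x)
    case 0
    then show ?case using B by simp
  next
    case (Suc j)
    then have eq: "Suc (4 - Suc j) = 4 - j" by simp
    show ?case
      by (rule vanishing_order_step[where v' = "e (4 - j)"])
        (use Suc e_deriv[of "4 - Suc j", unfolded eq] e_0 B0 in auto)
  qed
  then have "\<bar>e i x\<bar> \<le> B * x ^ (4 - i)" if "i \<le> 4" "x \<in> {0..1}" for i x
    using that by (metis diff_diff_cancel diff_le_self)
  then show ?thesis by (rule that[OF B0])
qed

text \<open>\<open>q\<close> is the square of the Bessel operator applied to \<open>e 0\<close>.\<close>

definition q :: "real \<Rightarrow> real" where
  "q x = e 4 x + 2 * e 3 x / x - e 2 x / x\<^sup>2 + e 1 x / x ^ 3"

text \<open>Two integrations by parts, with the Bessel operator applied to \<open>e 0\<close> as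
  intermediate function \<open>p\<close>. The first one uses \<open>e 0 1 = 0\<close>; the second
  uses \<open>p 1 = 0\<close>, which holds because \<open>e 1\<close> and \<open>e 2\<close> vanish
  at 1.\<close>

lemma wip_q: "wip q (\<phi> k) = (L k) ^ 4 * wip (e 0) (\<phi> k)"
proof -
  obtain B where B: "0 \<le> B" "\<And>i x. i \<le> 4 \<Longrightarrow> x \<in> {0..1} \<Longrightarrow> \<bar>e i x\<bar> \<le> B * x ^ (4 - i)"
    using e_vanishing by metis
  define p where "p x = e 2 x + e 1 x / x" for x
  have c1: "continuous_on {0..1} (\<lambda>x. e 1 x / x)"
  proof (rule continuous_on_div_vanishing)
    fix x :: real assume x: "x \<in> {0..1}"
    have "\<bar>e 1 x\<bar> \<le> B * x ^ 3" using B(2)[of 1 x] x by simp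
    also have "\<dots> \<le> B * x\<^sup>2" using B(1) x by (intro mult_left_mono power_decreasing) auto
    finally show "\<bar>e 1 x\<bar> \<le> B * x\<^sup>2" .
  qed (rule continuous_on_e, simp)
  have l: "L k \<noteq> 0" "bessel_J 0 (L k) = 0" using L_pos[of k] L_zero by auto
  have "((\<lambda>x. x * p x * bessel_J 0 (L k * x)) has_integral
      - (L k)\<^sup>2 * wip (e 0) (\<lambda>x. bessel_J 0 (L k * x))) {0..1}"
  proof (rule bessel_mode_by_parts[OF l, where P = "\<lambda>x. x * e 1 x"])
    fix x :: real assume x: "x \<in> {0<..<1}"
    show "(e 0 has_real_derivative x * e 1 x / x) (at x)"
      using e_deriv_at[of 0 x] x by simp
    have "((\<lambda>x. x * e 1 x) has_real_derivative 1 * e 1 x + e (Suc 1) x * x) (at x)"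
      using x by (intro DERIV_mult DERIV_ident e_deriv_at) auto
    then show "((\<lambda>x. x * e 1 x) has_real_derivative x * p x) (at x)"
      by (rule DERIV_cong) (use x in \<open>simp add: p_def field_simps numeral_2_eq_2\<close>)
  qed (auto intro!: continuous_intros continuous_on_e simp: e_1)
  then have 1: "wip p (\<phi> k) = - (L k)\<^sup>2 * wip (e 0) (\<phi> k)"
    unfolding wip_def[of p] \<phi>_abs by (rule integral_unique)
  have "((\<lambda>x. x * q x * bessel_J 0 (L k * x)) has_integral
      - (L k)\<^sup>2 * wip p (\<lambda>x. bessel_J 0 (L k * x))) {0..1}"
  proof (rule bessel_mode_by_parts[OF l, where P = "\<lambda>x. x * e 3 x + e 2 x - e 1 x / x"])
    show "continuous_on {0..1} p"
      unfolding p_def by (intro continuous_intros c1 continuous_on_e) simp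
    show "continuous_on {0..1} (\<lambda>x. x * e 3 x + e 2 x - e 1 x / x)"
      by (intro continuous_intros c1 continuous_on_e) simp_all
    fix x :: real assume x: "x \<in> {0<..<1}"
    have d: "(e 1 has_real_derivative e 2 x) (at x)" "(e 2 has_real_derivative e 3 x) (at x)"
      "(e 3 has_real_derivative e 4 x) (at x)"
      using e_deriv_at[of 1 x] e_deriv_at[of 2 x] e_deriv_at[of 3 x] x
      by (simp_all add: eval_nat_numeral)
    have d1: "((\<lambda>x. e 1 x / x) has_real_derivative (e 2 x * x - e 1 x * 1) / (x * x)) (at x)"
      using x by (intro DERIV_divide d DERIV_ident) simp
    have "(p has_real_derivative e 3 x + (e 2 x * x - e 1 x * 1) / (x * x)) (at x)"
      unfolding p_def by (intro DERIV_add d d1)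
    then show "(p has_real_derivative (x * e 3 x + e 2 x - e 1 x / x) / x) (at x)"
      by (rule DERIV_cong) (use x in \<open>simp add: field_simps\<close>)
    have "((\<lambda>x. x * e 3 x + e 2 x - e 1 x / x) has_real_derivative
        (1 * e 3 x + e 4 x * x) + e 3 x - (e 2 x * x - e 1 x * 1) / (x * x)) (at x)"
      by (intro DERIV_add DERIV_diff DERIV_mult DERIV_ident d d1)
    then show "((\<lambda>x. x * e 3 x + e 2 x - e 1 x / x) has_real_derivative x * q x) (at x)"
      by (rule DERIV_cong) (use x in \<open>simp add: q_def field_simps eval_nat_numeral\<close>)
  qed (simp_all add: p_def e_0 e_1)
  then have "wip q (\<phi> k) = - (L k)\<^sup>2 * wip p (\<phi> k)"
    unfolding wip_def[of q] \<phi>_abs by (rule integral_unique)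
  then show ?thesis by (simp add: 1 eval_nat_numeral)
qed

lemma q_bounded_measurable:
  obtains C where "0 \<le> C" "\<And>x. x \<in> {0..1} \<Longrightarrow> \<bar>q x\<bar> \<le> C"
    "q \<in> borel_measurable (lebesgue_on {0..1})"
proof -
  obtain B where B: "0 \<le> B" "\<And>i x. i \<le> 4 \<Longrightarrow> x \<in> {0..1} \<Longrightarrow> \<bar>e i x\<bar> \<le> B * x ^ (4 - i)"
    using e_vanishing by metis
  have div: "\<bar>v / x ^ n\<bar> \<le> B" if "\<bar>v\<bar> \<le> B * x ^ n" "x \<in> {0..1}" "0 < n" for v x :: real and n
    using that B(1) by (cases "x = 0") (auto simp: abs_mult field_simps power_0_left)
  have 1: "\<bar>q x\<bar> \<le> 5 * B" if x: "x \<in> {0..1}" for x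
  proof -
    have "\<bar>e 4 x\<bar> \<le> B" using B(2)[of 4 x] x by simp
    moreover have "\<bar>e 3 x / x ^ 1\<bar> \<le> B" using B(2)[of 3 x] x by (intro div) auto
    moreover have "\<bar>e 2 x / x\<^sup>2\<bar> \<le> B" using B(2)[of 2 x] x by (intro div) auto
    moreover have "\<bar>e 1 x / x ^ 3\<bar> \<le> B" using B(2)[of 1 x] x by (intro div) auto
    moreover have "q x = e 4 x + 2 * (e 3 x / x ^ 1) - e 2 x / x\<^sup>2 + e 1 x / x ^ 3"
      by (simp add: q_def)
    ultimately show ?thesis by linarith
  qed
  \<comment> \<open>\<open>e 4\<close> is given only as a bounded derivative. As the derivative of
    \<open>e 3\<close> it is integrable in the Henstock-Kurzweil sense, and measurability follows
    from that.\<close>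
  have "(e 4 has_integral e 3 1 - e 3 0) {0..1}"
    using e_deriv[of 3] by (intro fundamental_theorem_of_calculus)
      (auto simp: has_real_derivative_iff_has_vector_derivative[symmetric] eval_nat_numeral)
  then have "e 4 \<in> borel_measurable (lebesgue_on {0..1})"
    by (intro integrable_imp_measurable) (auto simp: integrable_on_def)
  moreover have "e i \<in> borel_measurable (lebesgue_on {0..1})" if "i < 4" for i
    using that by (intro continuous_imp_measurable_on_sets_lebesgue continuous_on_e) auto
  moreover have "(\<lambda>x::real. x) \<in> borel_measurable (lebesgue_on {0..1})"
    by (intro continuous_imp_measurable_on_sets_lebesgue continuous_intros) auto
  ultimately have "q \<in> borel_measurable (lebesgue_on {0..1})"
    unfolding q_def
    by (intro borel_measurable_add borel_measurable_diff borel_measurable_divide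
        borel_measurable_times borel_measurable_const borel_measurable_power) simp_all
  then show ?thesis using that[of "5 * B"] 1 B(1) by simp
qed

text \<open>The Fourier-Bessel coefficient of \<open>e 0\<close>, that is g_k - f_k in the
  theorem.\<close>

definition d :: "nat \<Rightarrow> real" where
  "d k = wip (e 0) (\<phi> k) / wip (\<phi> k) (\<phi> k)"

lemma summable_wip_q: "summable (\<lambda>k. (wip q (\<phi> k) / wip (\<phi> k) (\<phi> k))\<^sup>2 * wip (\<phi> k) (\<phi> k))"
proof (rule summableI_nonneg_bounded)
  obtain C where C: "0 \<le> C" "\<And>x. x \<in> {0..1} \<Longrightarrow> \<bar>q x\<bar> \<le> C"
    and qm: "q \<in> borel_measurable (lebesgue_on {0..1})"
    using q_bounded_measurable by metis
  have qw: "(\<lambda>x. x * q x * w x) integrable_on {0..1}"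
    if w: "w \<in> borel_measurable (lebesgue_on {0..1})" and D: "0 \<le> D" "\<And>x. x \<in> {0..1} \<Longrightarrow> \<bar>w x\<bar> \<le> D" for w D
  proof (rule measurable_bounded_by_integrable_imp_integrable_real)
    show "(\<lambda>x. x * q x * w x) \<in> borel_measurable (lebesgue_on {0..1})"
      by (intro borel_measurable_times qm w continuous_imp_measurable_on_sets_lebesgue continuous_intros) simp
    show "(\<lambda>x. C * D) integrable_on {0..1::real}"
      by (intro integrable_continuous_real continuous_on_const)
    show "\<bar>x * q x * w x\<bar> \<le> C * D" if x: "x \<in> {0..1}" for x
    proof -
      have "\<bar>x * q x\<bar> * \<bar>w x\<bar> \<le> (1 * C) * D"
        unfolding abs_mult using x C D by (intro mult_mono) auto
      then show ?thesis by (simp add: abs_mult)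
    qed
  qed simp
  fix n
  have "(\<Sum>k<n. (wip q (\<phi> k))\<^sup>2 / wip (\<phi> k) (\<phi> k)) \<le> wip q q"
    unfolding \<phi>_abs
  proof (rule bessel_inequality)
    show "(\<lambda>x. x * q x * q x) integrable_on {0..1}"
      by (rule qw[OF qm C])
    show "(\<lambda>x. x * q x * w x) integrable_on {0..1}" if w: "continuous_on {0..1} w" for w
    proof -
      obtain D where "0 \<le> D" "\<And>x. x \<in> {0..1} \<Longrightarrow> \<bar>w x\<bar> \<le> D"
        using continuous_bounded_01[OF w] by metis
      then show ?thesis
        by (intro qw continuous_imp_measurable_on_sets_lebesgue w) auto
    qed
  qed (auto intro: L_pos L_zero inj_on_subset[OF L_inj])
  moreover have "(wip q (\<phi> k))\<^sup>2 / wip (\<phi> k) (\<phi> k)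
      = (wip q (\<phi> k) / wip (\<phi> k) (\<phi> k))\<^sup>2 * wip (\<phi> k) (\<phi> k)" for k
    using \<phi>_norm_pos[of k] by (simp add: power2_eq_square)
  ultimately show "(\<Sum>k<n. (wip q (\<phi> k) / wip (\<phi> k) (\<phi> k))\<^sup>2 * wip (\<phi> k) (\<phi> k)) \<le> wip q q"
    by simp
qed (simp add: wip_nonneg)

definition tail :: "nat \<Rightarrow> real" where
  "tail n = (\<Sum>k. (wip q (\<phi> (k + n)) / wip (\<phi> (k + n)) (\<phi> (k + n)))\<^sup>2 * wip (\<phi> (k + n)) (\<phi> (k + n)))"

lemma tail_tendsto_0: "(\<lambda>n. sqrt (tail n)) \<longlonglongrightarrow> 0"
proof -
  let ?a = "\<lambda>k. (wip q (\<phi> k) / wip (\<phi> k) (\<phi> k))\<^sup>2 * wip (\<phi> k) (\<phi> k)"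
  have "tail = (\<lambda>n. suminf ?a - sum ?a {..<n})"
    unfolding tail_def using suminf_minus_initial_segment[OF summable_wip_q] by (simp add: fun_eq_iff)
  moreover have "(\<lambda>n. suminf ?a - sum ?a {..<n}) \<longlonglongrightarrow> suminf ?a - suminf ?a"
    by (intro tendsto_intros summable_LIMSEQ summable_wip_q)
  ultimately have "tail \<longlonglongrightarrow> 0" by simp
  then show ?thesis using tendsto_real_sqrt by fastforce
qed

text \<open>The coefficients of \<open>q\<close> are (L k)^4 d k, and
  \<open>sum_bessel_modes_bound\<close> divides by (L k)^2. What remains is the weight of the
  second-order terms of the equation, with a bound independent of x.\<close>

lemma weighted_modes_tail:
  assumes x: "x \<in> {0..1}"
  shows "(\<Sum>k\<in>{n..<m}. \<bar>(L k)\<^sup>2 * d k * \<phi> k x\<bar>) \<le> sqrt (tail n)"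
proof -
  let ?a = "\<lambda>k. wip q (\<phi> k) / wip (\<phi> k) (\<phi> k)"
  have eq: "\<bar>(L k)\<^sup>2 * d k * \<phi> k x\<bar> = \<bar>?a k * \<phi> k x\<bar> / (L k)\<^sup>2" for k
  proof -
    have "(L k)\<^sup>2 * d k = ?a k / (L k)\<^sup>2"
      using L_pos[of k] by (simp add: wip_q d_def eval_nat_numeral)
    then show ?thesis by (simp add: abs_mult)
  qed
  have "(\<Sum>k\<in>{n..<m}. \<bar>?a k * \<phi> k x\<bar> / (L k)\<^sup>2) \<le> sqrt (\<Sum>k\<in>{n..<m}. (?a k)\<^sup>2 * wip (\<phi> k) (\<phi> k))"
    unfolding \<phi>_abs
    by (rule sum_bessel_modes_bound) (use x in \<open>auto intro: L_pos L_zero inj_on_subset[OF L_inj]\<close>)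
  also have "\<dots> \<le> sqrt (tail n)"
  proof (rule real_sqrt_le_mono)
    have "(\<Sum>k\<in>{n..<m}. (?a k)\<^sup>2 * wip (\<phi> k) (\<phi> k))
        = (\<Sum>k<m - n. (?a (k + n))\<^sup>2 * wip (\<phi> (k + n)) (\<phi> (k + n)))"
      by (rule sum.reindex_bij_witness[of _ "\<lambda>k. k + n" "\<lambda>k. k - n"]) auto
    also have "\<dots> \<le> tail n"
      unfolding tail_def
      using summable_ignore_initial_segment[OF summable_wip_q, of n]
      by (intro sum_le_suminf) (auto simp: wip_nonneg)
    finally show "(\<Sum>k\<in>{n..<m}. (?a k)\<^sup>2 * wip (\<phi> k) (\<phi> k)) \<le> tail n" .
  qed
  finally show ?thesis by (simp add: eq)
qed

text \<open>The parameter z may be x alone or a pair (x,t), with X extracting the space variable.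
  All remainders are below C * sqrt (tail n), so convergence is uniform in time as well.\<close>

lemma dominated_modes:
  fixes h :: "nat \<Rightarrow> 'a \<Rightarrow> real"
  assumes h: "\<And>k z. z \<in> A \<Longrightarrow> \<bar>h k z\<bar> \<le> C * \<bar>(L k)\<^sup>2 * d k * \<phi> k (X z)\<bar>"
    and X: "\<And>z. z \<in> A \<Longrightarrow> X z \<in> {0..1}" and C: "0 \<le> C"
  shows "z \<in> A \<Longrightarrow> summable (\<lambda>k. \<bar>h k z\<bar>)"
    and "uniform_limit A (\<lambda>n z. \<Sum>k<n. h k z) (\<lambda>z. \<Sum>k. h k z) sequentially"
proof -
  have bnd: "(\<Sum>k\<in>{n..<m}. \<bar>h k z\<bar>) \<le> C * sqrt (tail n)" if z: "z \<in> A" for n m z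
  proof -
    have "(\<Sum>k\<in>{n..<m}. \<bar>h k z\<bar>) \<le> (\<Sum>k\<in>{n..<m}. C * \<bar>(L k)\<^sup>2 * d k * \<phi> k (X z)\<bar>)"
      by (intro sum_mono h z)
    also have "\<dots> \<le> C * sqrt (tail n)"
      unfolding sum_distrib_left[symmetric] by (intro mult_left_mono weighted_modes_tail X z C)
    finally show ?thesis .
  qed
  have sm: "summable (\<lambda>k. \<bar>h k z\<bar>)" if z: "z \<in> A" for z
    by (rule summableI_nonneg_bounded[of _ "C * sqrt (tail 0)"])
      (use bnd[OF z, of 0] in \<open>auto simp: atLeast0LessThan\<close>)
  then show "z \<in> A \<Longrightarrow> summable (\<lambda>k. \<bar>h k z\<bar>)" .
  have rest: "\<bar>(\<Sum>k<n. h k z) - (\<Sum>k. h k z)\<bar> \<le> C * sqrt (tail n)" if z: "z \<in> A" for n z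
  proof -
    have s: "summable (\<lambda>k. \<bar>h (k + n) z\<bar>)"
      by (rule summable_ignore_initial_segment[OF sm[OF z]])
    have "(\<Sum>k<n. h k z) - (\<Sum>k. h k z) = - (\<Sum>k. h (k + n) z)"
      using suminf_minus_initial_segment[OF summable_rabs_cancel[OF sm[OF z]], of n] by simp
    then have "\<bar>(\<Sum>k<n. h k z) - (\<Sum>k. h k z)\<bar> \<le> (\<Sum>k. \<bar>h (k + n) z\<bar>)"
      using summable_rabs[OF s] by simp
    also have "\<dots> \<le> C * sqrt (tail n)"
    proof (rule suminf_le_const[OF s])
      fix m
      have "(\<Sum>k<m. \<bar>h (k + n) z\<bar>) = (\<Sum>k\<in>{n..<m + n}. \<bar>h k z\<bar>)"
        by (rule sum.reindex_bij_witness[of _ "\<lambda>k. k - n" "\<lambda>k. k + n"]) auto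
      then show "(\<Sum>k<m. \<bar>h (k + n) z\<bar>) \<le> C * sqrt (tail n)" using bnd[OF z] by simp
    qed
    finally show ?thesis .
  qed
  have "(\<lambda>n. C * sqrt (tail n)) \<longlonglongrightarrow> C * 0" by (intro tendsto_intros tail_tendsto_0)
  then have lim: "(\<lambda>n. C * sqrt (tail n)) \<longlonglongrightarrow> 0" by simp
  show "uniform_limit A (\<lambda>n z. \<Sum>k<n. h k z) (\<lambda>z. \<Sum>k. h k z) sequentially"
    unfolding uniform_limit_iff
  proof (intro allI impI)
    fix \<epsilon> :: real assume "0 < \<epsilon>"
    then have "\<forall>\<^sub>F n in sequentially. C * sqrt (tail n) < \<epsilon>" by (rule order_tendstoD[OF lim])
    then show "\<forall>\<^sub>F n in sequentially. \<forall>z\<in>A. dist (\<Sum>k<n. h k z) (\<Sum>k. h k z) < \<epsilon>"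
    proof (rule eventually_mono)
      fix n assume "C * sqrt (tail n) < \<epsilon>"
      then show "\<forall>z\<in>A. dist (\<Sum>k<n. h k z) (\<Sum>k. h k z) < \<epsilon>"
        using rest[of _ n] unfolding dist_real_def by (meson le_less_trans)
    qed
  qed
qed

lemma modes_dominated: "\<bar>d k * \<phi> k x\<bar> \<le> 1 / (L 0)\<^sup>2 * \<bar>(L k)\<^sup>2 * d k * \<phi> k x\<bar>"
proof -
  have "(L 0)\<^sup>2 \<le> (L k)\<^sup>2" using L_least L_pos[of 0] by (intro power_mono) auto
  then have "(L 0)\<^sup>2 * \<bar>d k * \<phi> k x\<bar> \<le> (L k)\<^sup>2 * \<bar>d k * \<phi> k x\<bar>" by (rule mult_right_mono) simp
  then show ?thesis using L_pos[of 0] by (simp add: abs_mult field_simps)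
qed

text \<open>Uniform convergence and orthogonality give the sum the same projections as
  \<open>e 0\<close>; completeness then identifies the two continuous functions.\<close>

lemma fourier_bessel_expansion:
  assumes x: "x \<in> {0..1}"
  shows "(\<Sum>k. d k * \<phi> k x) = e 0 x"
proof -
  let ?E = "\<lambda>x. \<Sum>k. d k * \<phi> k x"
  let ?En = "\<lambda>n x. \<Sum>k<n. d k * \<phi> k x"
  have ul: "uniform_limit {0..1} ?En ?E sequentially"
    by (rule dominated_modes(2)[where X = "\<lambda>x. x"]) (auto intro: modes_dominated)
  have cn: "continuous_on {0..1} (?En n)" for n
    by (intro continuous_intros continuous_on_\<phi>)
  have cE: "continuous_on {0..1} ?E"
    by (rule uniform_limit_theorem[OF always_eventually ul]) (auto intro: cn)
  have ce: "continuous_on {0..1} (e 0)" by (rule continuous_on_e) simp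
  have "wip (\<lambda>x. 1 * ?E x + (- 1) * e 0 x) (\<phi> j) = 0" for j
  proof -
    obtain B where B: "0 \<le> B" "\<And>x. x \<in> {0..1} \<Longrightarrow> \<bar>\<phi> j x\<bar> \<le> B"
      using continuous_bounded_01[OF continuous_on_\<phi>] by metis
    have "(\<lambda>n. wip (?En n) (\<phi> j)) \<longlonglongrightarrow> wip ?E (\<phi> j)"
    proof (rule LIMSEQ_I)
      fix r :: real assume r: "0 < r"
      \<comment> \<open>The bound B may be 0, hence the denominator B + 1.\<close>
      then have "0 < r / (B + 1)" using B by simp
      then have "\<forall>\<^sub>F n in sequentially. \<forall>x\<in>{0..1}. dist (?En n x) (?E x) < r / (B + 1)"
        using ul by (simp add: uniform_limit_iff)
      then obtain N where N: "\<And>n x. N \<le> n \<Longrightarrow> x \<in> {0..1} \<Longrightarrow> \<bar>?En n x - ?E x\<bar> < r / (B + 1)"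
        unfolding eventually_sequentially dist_real_def by blast
      show "\<exists>N. \<forall>n\<ge>N. norm (wip (?En n) (\<phi> j) - wip ?E (\<phi> j)) < r"
      proof (intro exI allI impI)
        fix n assume n: "N \<le> n"
        have "wip (?En n) (\<phi> j) - wip ?E (\<phi> j) = wip (\<lambda>x. 1 * ?En n x + (- 1) * ?E x) (\<phi> j)"
          by (subst wip_lincomb_left) (auto intro: cn cE continuous_on_\<phi>)
        moreover have "\<bar>wip (\<lambda>x. 1 * ?En n x + (- 1) * ?E x) (\<phi> j)\<bar> \<le> r / (B + 1) * B"
          using N[OF n] B by (intro wip_bound continuous_intros cn cE continuous_on_\<phi>)
            (auto intro: less_imp_le)
        moreover have "r / (B + 1) * B < r" using r B by (simp add: field_simps)
        ultimately show "norm (wip (?En n) (\<phi> j) - wip ?E (\<phi> j)) < r" by simp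
      qed
    qed
    moreover have "wip (?En n) (\<phi> j) = wip (e 0) (\<phi> j)" if "j < n" for n
    proof -
      have "wip (?En n) (\<phi> j) = (\<Sum>k<n. d k * wip (\<phi> k) (\<phi> j))"
        by (subst wip_sum_left) (auto intro: continuous_on_\<phi>)
      also have "\<dots> = (\<Sum>k<n. if k = j then d j * wip (\<phi> j) (\<phi> j) else 0)"
        by (rule sum.cong) (auto simp: \<phi>_orthogonal)
      also have "\<dots> = wip (e 0) (\<phi> j)"
        using that \<phi>_norm_pos[of j] by (simp add: d_def)
      finally show ?thesis .
    qed
    then have "(\<lambda>n. wip (?En n) (\<phi> j)) \<longlonglongrightarrow> wip (e 0) (\<phi> j)"
      by (intro tendsto_eventually) (auto simp: eventually_at_top_dense)
    ultimately have "wip ?E (\<phi> j) = wip (e 0) (\<phi> j)" by (rule LIMSEQ_unique)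
    then show ?thesis
      by (subst wip_lincomb_left) (auto intro: cE ce continuous_on_\<phi>)
  qed
  moreover have "continuous_on {0..1} (\<lambda>x. 1 * ?E x + (- 1) * e 0 x)"
    by (intro continuous_on_add continuous_on_mult continuous_on_const cE ce)
  ultimately have "1 * ?E x + (- 1) * e 0 x = 0"
    using \<phi>_complete[where v = "\<lambda>x. 1 * ?E x + (- 1) * e 0 x", OF _ _ x] by blast
  then show ?thesis by simp
qed

end


section \<open>The solution\<close>

lemma diff_bounds:
  assumes u: "continuous_on {0..1} u" and v: "continuous_on {0..1} v"
    and r: "\<And>x. x \<in> {0..1} \<Longrightarrow> \<bar>u x - v x\<bar> \<le> r" and x: "x \<in> {0..1}"
  shows green_diff_bound: "\<bar>green u x - green v x\<bar> \<le> r"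
    and prim_diff_bound: "\<bar>prim u x - prim v x\<bar> \<le> r"
proof -
  let ?w = "\<lambda>x. 1 * u x + (- 1) * v x"
  have cw: "continuous_on {0..1} ?w" by (intro continuous_on_add continuous_on_mult continuous_on_const u v)
  have r': "\<bar>?w y\<bar> \<le> r" if "y \<in> {0..1}" for y using r[OF that] by simp
  then have r0: "0 \<le> r" using x by (force intro: order_trans[OF abs_ge_zero])
  have "wip ?w ?w \<le> r * r" using wip_bound[OF cw cw r' r'] by simp
  then have "sqrt (wip ?w ?w) \<le> r" using r0 by (simp add: real_le_lsqrt power2_eq_square)
  then show "\<bar>green u x - green v x\<bar> \<le> r"
    using green_bound[OF cw x] green_lincomb[OF u v x, of 1 "- 1"] by simp
  have "x\<^sup>2 * r \<le> 1 * r" using x r0 by (intro mult_right_mono) (auto simp: power_le_one)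
  then show "\<bar>prim u x - prim v x\<bar> \<le> r"
    using prim_bound[OF cw r' x] prim_lincomb[OF u v x, of 1 "- 1"] by simp
qed

lemma prim_sum:
  assumes "finite F" "\<And>k. k \<in> F \<Longrightarrow> continuous_on {0..1} (v k)" "x \<in> {0..1}"
  shows "prim (\<lambda>x. \<Sum>k\<in>F. c k * v k x) x = (\<Sum>k\<in>F. c k * prim (v k) x)"
  using assms
proof (induction F rule: finite_induct)
  case empty
  then show ?case by (simp add: prim_def)
next
  case (insert k F)
  then show ?case
    using prim_lincomb[of "v k" "\<lambda>x. \<Sum>k\<in>F. c k * v k x" x "c k" 1]
    by (simp add: continuous_on_sum continuous_on_mult)
qed

locale mode_solution = smooth_datum +
  fixes \<alpha> T :: real
  assumes \<alpha>: "0 < \<alpha>" "\<alpha> < 1" and T: "0 < T"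
begin

definition y :: "nat \<Rightarrow> real \<Rightarrow> real" where "y k t = ml_mode \<alpha> ((L k)\<^sup>2) t"

text \<open>Chosen so that c k * (1 - y k T) = d k, which turns the condition at time T into the
  expansion of g - f.\<close>

definition c :: "nat \<Rightarrow> real" where "c k = d k / (1 - y k T)"

text \<open>
  The solution is \<open>u = g - S\<close>, and \<open>- P\<close> is the Bessel operator applied to \<open>S\<close>. The series for
  \<open>S\<close> is never differentiated in \<open>x\<close>: instead \<open>S\<close> is written as the inverse operator applied to \<open>P\<close>.
\<close>

definition S :: "real \<Rightarrow> real \<Rightarrow> real" where
  "S x t = (\<Sum>k. c k * (1 - y k t) * \<phi> k x)"

definition P :: "real \<Rightarrow> real \<Rightarrow> real" where
  "P x t = (\<Sum>k. ((L k)\<^sup>2 * (c k * (1 - y k t))) * \<phi> k x)"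

text \<open>The function 1 - y_k has Caputo derivative L_k^2 y_k = L_k^2 - L_k^2 (1 - y_k). Summed
  over k this makes the Caputo derivative of \<open>S\<close> equal to Q - P, so \<open>Q\<close> is
  the part that is constant in time.\<close>

definition Q :: "real \<Rightarrow> real" where
  "Q x = (\<Sum>k. (L k)\<^sup>2 * c k * \<phi> k x)"

definition \<delta> :: real where "\<delta> = 1 - y 0 T"

lemma \<delta>_pos: "0 < \<delta>"
  unfolding \<delta>_def y_def using ml_mode_less_1[OF \<alpha> _ T, of "(L 0)\<^sup>2"] L_pos[of 0] by simp

text \<open>The modes in time decrease with the eigenvalue, so the least zero of J_0 has the
  smallest denominator.\<close>

lemma \<delta>_le: "\<delta> \<le> 1 - y k T"
proof -
  have "(L 0)\<^sup>2 \<le> (L k)\<^sup>2" using L_least L_pos[of 0] by (intro power_mono) auto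
  then show ?thesis
    unfolding \<delta>_def y_def using ml_mode_antimono[OF \<alpha>, of "(L 0)\<^sup>2" "(L k)\<^sup>2" T] T by simp
qed

lemma y_bounds: "0 \<le> t \<Longrightarrow> 0 \<le> y k t" "0 \<le> t \<Longrightarrow> y k t \<le> 1"
  unfolding y_def using ml_mode_nonneg[OF \<alpha>] ml_mode_le_1[OF \<alpha>] by simp_all

lemma abs_c_le: "\<bar>c k\<bar> \<le> \<bar>d k\<bar> / \<delta>"
  unfolding c_def abs_divide using \<delta>_pos \<delta>_le[of k] by (intro divide_left_mono) auto

lemma c_dominated:
  assumes "\<bar>a\<bar> \<le> A"
  shows "\<bar>c k * a * \<phi> k x\<bar> \<le> A / \<delta> * (1 / (L 0)\<^sup>2) * \<bar>(L k)\<^sup>2 * d k * \<phi> k x\<bar>"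
    and "\<bar>(L k)\<^sup>2 * (c k * a) * \<phi> k x\<bar> \<le> A / \<delta> * \<bar>(L k)\<^sup>2 * d k * \<phi> k x\<bar>"
proof -
  have "0 \<le> A" using assms by simp
  have *: "\<bar>c k * a * \<phi> k x\<bar> \<le> A / \<delta> * \<bar>d k * \<phi> k x\<bar>"
  proof -
    have "\<bar>c k\<bar> * \<bar>a\<bar> \<le> (\<bar>d k\<bar> / \<delta>) * A"
      using abs_c_le[of k] assms \<delta>_pos by (intro mult_mono) auto
    then have "\<bar>c k\<bar> * \<bar>a\<bar> * \<bar>\<phi> k x\<bar> \<le> (\<bar>d k\<bar> / \<delta>) * A * \<bar>\<phi> k x\<bar>" by (rule mult_right_mono) simp
    then show ?thesis by (simp add: abs_mult mult_ac)
  qed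
  also have "\<dots> \<le> A / \<delta> * (1 / (L 0)\<^sup>2 * \<bar>(L k)\<^sup>2 * d k * \<phi> k x\<bar>)"
    using \<open>0 \<le> A\<close> \<delta>_pos by (intro mult_left_mono modes_dominated) auto
  finally show "\<bar>c k * a * \<phi> k x\<bar> \<le> A / \<delta> * (1 / (L 0)\<^sup>2) * \<bar>(L k)\<^sup>2 * d k * \<phi> k x\<bar>"
    by (simp only: mult.assoc)
  have "(L k)\<^sup>2 * \<bar>c k * a * \<phi> k x\<bar> \<le> (L k)\<^sup>2 * (A / \<delta> * \<bar>d k * \<phi> k x\<bar>)"
    using * by (rule mult_left_mono) simp
  then show "\<bar>(L k)\<^sup>2 * (c k * a) * \<phi> k x\<bar> \<le> A / \<delta> * \<bar>(L k)\<^sup>2 * d k * \<phi> k x\<bar>"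
    by (simp add: abs_mult mult_ac)
qed

lemma m_bound: "0 \<le> t \<Longrightarrow> \<bar>1 - y k t\<bar> \<le> 1"
  using y_bounds[of t k] by auto

lemma S_uniform:
  "uniform_limit ({0..1} \<times> {0..}) (\<lambda>n z. \<Sum>k<n. c k * (1 - y k (snd z)) * \<phi> k (fst z))
    (\<lambda>z. S (fst z) (snd z)) sequentially"
  unfolding S_def
proof (rule dominated_modes(2)[where X = fst and C = "1 / \<delta> * (1 / (L 0)\<^sup>2)"])
  show "\<bar>c k * (1 - y k (snd z)) * \<phi> k (fst z)\<bar>
      \<le> 1 / \<delta> * (1 / (L 0)\<^sup>2) * \<bar>(L k)\<^sup>2 * d k * \<phi> k (fst z)\<bar>"
    if "z \<in> {0..1} \<times> {0..}" for k z
    using that by (intro c_dominated(1) m_bound) auto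
qed (use \<delta>_pos in auto)

lemma P_uniform:
  "uniform_limit ({0..1} \<times> {0..}) (\<lambda>n z. \<Sum>k<n. ((L k)\<^sup>2 * (c k * (1 - y k (snd z)))) * \<phi> k (fst z))
    (\<lambda>z. P (fst z) (snd z)) sequentially"
  unfolding P_def
proof (rule dominated_modes(2)[where X = fst and C = "1 / \<delta>"])
  show "\<bar>(L k)\<^sup>2 * (c k * (1 - y k (snd z))) * \<phi> k (fst z)\<bar>
      \<le> 1 / \<delta> * \<bar>(L k)\<^sup>2 * d k * \<phi> k (fst z)\<bar>"
    if "z \<in> {0..1} \<times> {0..}" for k z
    using that by (intro c_dominated(2) m_bound) auto
qed (use \<delta>_pos in auto)

lemma Q_uniform:
  "uniform_limit {0..1} (\<lambda>n x. \<Sum>k<n. (L k)\<^sup>2 * c k * \<phi> k x) Q sequentially"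
proof -
  have "\<bar>(L k)\<^sup>2 * c k * \<phi> k x\<bar> \<le> 1 / \<delta> * \<bar>(L k)\<^sup>2 * d k * \<phi> k x\<bar>" for k x
    using c_dominated(2)[of 1 1 k x] by simp
  then show ?thesis
    unfolding Q_def[abs_def]
    by (intro dominated_modes(2)[where X = "\<lambda>x. x" and C = "1 / \<delta>"]) (use \<delta>_pos in auto)
qed

lemma S_summable:
  assumes "x \<in> {0..1}" "0 \<le> t"
  shows "summable (\<lambda>k. c k * (1 - y k t) * \<phi> k x)"
proof (rule summable_rabs_cancel, rule dominated_modes(1)[where X = "\<lambda>x. x" and A = "{x}"
      and C = "1 / \<delta> * (1 / (L 0)\<^sup>2)"])
  show "\<bar>c k * (1 - y k t) * \<phi> k z\<bar> \<le> 1 / \<delta> * (1 / (L 0)\<^sup>2) * \<bar>(L k)\<^sup>2 * d k * \<phi> k z\<bar>" for k z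
    by (intro c_dominated(1) m_bound assms)
qed (use assms \<delta>_pos in auto)

lemma weighted_summable:
  assumes "x \<in> {0..1}" "\<And>k. \<bar>a k\<bar> \<le> A"
  shows "summable (\<lambda>k. \<bar>(L k)\<^sup>2 * (c k * a k) * \<phi> k x\<bar>)"
proof (rule dominated_modes(1)[where X = "\<lambda>x. x" and A = "{x}" and C = "A / \<delta>"])
  show "0 \<le> A / \<delta>" using assms(2)[of 0] \<delta>_pos by simp
qed (use assms c_dominated(2) in auto)

lemma continuous_on_y: "continuous_on {0..} (y k)"
  unfolding y_def by (rule continuous_on_ml_mode[OF \<alpha>])

lemma continuous_on_partial:
  "continuous_on ({0..1} \<times> {0..}) (\<lambda>z. \<Sum>k<n. a k * (1 - y k (snd z)) * \<phi> k (fst z))"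
  by (intro continuous_intros continuous_on_compose2[OF continuous_on_y]
      continuous_on_compose2[OF continuous_on_\<phi>[of UNIV]]) auto

lemma continuous_on_S: "continuous_on ({0..1} \<times> {0..}) (\<lambda>z. S (fst z) (snd z))"
  by (rule uniform_limit_theorem[OF always_eventually S_uniform])
    (auto intro: continuous_on_partial)

lemma continuous_on_P: "continuous_on ({0..1} \<times> {0..}) (\<lambda>z. P (fst z) (snd z))"
  by (rule uniform_limit_theorem[OF always_eventually P_uniform])
    (auto intro: continuous_on_partial[where a = "\<lambda>k. (L k)\<^sup>2 * c k", unfolded mult.assoc]
      simp: mult.assoc)

lemma continuous_on_Q: "continuous_on {0..1} Q"
  by (rule uniform_limit_theorem[OF always_eventually Q_uniform])
    (auto intro!: continuous_intros continuous_on_\<phi>)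

lemma continuous_on_P_slice:
  assumes "0 \<le> t"
  shows "continuous_on {0..1} (\<lambda>x. P x t)"
proof -
  have "continuous_on {0..1} (\<lambda>x. P (fst (x, t)) (snd (x, t)))"
    by (rule continuous_on_compose2[OF continuous_on_P])
      (use assms in \<open>auto intro!: continuous_intros\<close>)
  then show ?thesis by simp
qed

definition Pn :: "nat \<Rightarrow> real \<Rightarrow> real \<Rightarrow> real" where
  "Pn n t x = (\<Sum>k<n. ((L k)\<^sup>2 * (c k * (1 - y k t))) * \<phi> k x)"

lemma continuous_on_Pn: "continuous_on {0..1} (Pn n t)"
  unfolding Pn_def by (intro continuous_intros continuous_on_\<phi>)

lemma Pn_approx:
  assumes "0 < r"
  obtains N where "\<And>n x t. N \<le> n \<Longrightarrow> x \<in> {0..1} \<Longrightarrow> 0 \<le> t \<Longrightarrow> \<bar>Pn n t x - P x t\<bar> \<le> r"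
proof -
  have "\<forall>\<^sub>F n in sequentially. \<forall>z\<in>{0..1} \<times> {0..}. dist (Pn n (snd z) (fst z)) (P (fst z) (snd z)) < r"
    using P_uniform assms unfolding uniform_limit_iff Pn_def by blast
  then obtain N where "\<forall>n\<ge>N. \<forall>z\<in>{0..1} \<times> {0..}. dist (Pn n (snd z) (fst z)) (P (fst z) (snd z)) < r"
    unfolding eventually_sequentially by blast
  then have "\<bar>Pn n t x - P x t\<bar> \<le> r" if "N \<le> n" "x \<in> {0..1}" "0 \<le> t" for n x t
    using that by (force simp: dist_real_def)
  then show ?thesis by (rule that)
qed

lemma S_green:
  assumes x: "x \<in> {0..1}" and t: "0 \<le> t"
  shows "S x t = green (\<lambda>x. P x t) x"
proof (rule LIMSEQ_unique)
  show "(\<lambda>n. \<Sum>k<n. c k * (1 - y k t) * \<phi> k x) \<longlonglongrightarrow> S x t"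
    unfolding S_def by (rule summable_LIMSEQ[OF S_summable[OF x t]])
  have eq: "(\<Sum>k<n. c k * (1 - y k t) * \<phi> k x) = green (Pn n t) x" for n
  proof -
    have "green (Pn n t) x = (\<Sum>k<n. ((L k)\<^sup>2 * (c k * (1 - y k t))) * green (\<phi> k) x)"
      unfolding Pn_def[abs_def] using x by (intro green_sum continuous_on_\<phi>) auto
    also have "\<dots> = (\<Sum>k<n. c k * (1 - y k t) * \<phi> k x)"
    proof (rule sum.cong[OF refl])
      fix k
      show "((L k)\<^sup>2 * (c k * (1 - y k t))) * green (\<phi> k) x = c k * (1 - y k t) * \<phi> k x"
        using L_pos[of k] by (simp add: green_\<phi>[OF x])
    qed
    finally show ?thesis ..
  qed
  show "(\<lambda>n. \<Sum>k<n. c k * (1 - y k t) * \<phi> k x) \<longlonglongrightarrow> green (\<lambda>x. P x t) x"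
    unfolding eq
  proof (rule LIMSEQ_I)
    fix r :: real assume r: "0 < r"
    then have "0 < r / 2" by simp
    then obtain N where N: "\<And>n x t. N \<le> n \<Longrightarrow> x \<in> {0..1} \<Longrightarrow> 0 \<le> t \<Longrightarrow> \<bar>Pn n t x - P x t\<bar> \<le> r / 2"
      using Pn_approx by metis
    have "norm (green (Pn n t) x - green (\<lambda>x. P x t) x) < r" if "N \<le> n" for n
    proof -
      have "\<bar>green (Pn n t) x - green (\<lambda>x. P x t) x\<bar> \<le> r / 2"
        using N[OF that] t by (intro green_diff_bound continuous_on_Pn continuous_on_P_slice x) auto
      then show ?thesis using r by simp
    qed
    then show "\<exists>N. \<forall>n\<ge>N. norm (green (Pn n t) x - green (\<lambda>x. P x t) x) < r" by blast
  qed
qed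

text \<open>Both x-derivatives of \<open>S\<close> are expressed through this flux and
  \<open>P\<close>, so its joint continuity is what the solution concept demands of them.\<close>

lemma continuous_on_prim_P:
  "continuous_on ({0..1} \<times> {0..}) (\<lambda>z. prim (\<lambda>x. P x (snd z)) (fst z))"
proof (rule uniform_limit_theorem)
  show "\<forall>\<^sub>F n in sequentially. continuous_on ({0..1} \<times> {0..}) (\<lambda>z. prim (Pn n (snd z)) (fst z))"
  proof (rule always_eventually, rule allI)
    fix n
    have "continuous_on ({0..1} \<times> {0..}) (\<lambda>z. \<Sum>k<n. ((L k)\<^sup>2 * (c k * (1 - y k (snd z)))) * prim (\<phi> k) (fst z))"
      by (intro continuous_intros continuous_on_compose2[OF continuous_on_y]
          continuous_on_compose2[OF continuous_on_prim[OF continuous_on_\<phi>]]) auto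
    moreover have "prim (Pn n (snd z)) (fst z)
        = (\<Sum>k<n. ((L k)\<^sup>2 * (c k * (1 - y k (snd z)))) * prim (\<phi> k) (fst z))"
      if "z \<in> {0..1} \<times> {0..}" for z
      unfolding Pn_def[abs_def] using that by (intro prim_sum continuous_on_\<phi>) auto
    ultimately show "continuous_on ({0..1} \<times> {0..}) (\<lambda>z. prim (Pn n (snd z)) (fst z))"
      by (simp cong: continuous_on_cong)
  qed
  show "uniform_limit ({0..1} \<times> {0..}) (\<lambda>n z. prim (Pn n (snd z)) (fst z))
      (\<lambda>z. prim (\<lambda>x. P x (snd z)) (fst z)) sequentially"
    unfolding uniform_limit_iff
  proof (intro allI impI)
    fix r :: real assume r: "0 < r"
    then have "0 < r / 2" by simp
    then obtain N where N: "\<And>n x t. N \<le> n \<Longrightarrow> x \<in> {0..1} \<Longrightarrow> 0 \<le> t \<Longrightarrow> \<bar>Pn n t x - P x t\<bar> \<le> r / 2"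
      using Pn_approx by metis
    have "dist (prim (Pn n (snd z)) (fst z)) (prim (\<lambda>x. P x (snd z)) (fst z)) < r"
      if n: "N \<le> n" and z: "z \<in> {0..1} \<times> {0..}" for n z
    proof -
      have t: "0 \<le> snd z" and x: "fst z \<in> {0..1}" using z by auto
      have "\<bar>prim (Pn n (snd z)) (fst z) - prim (\<lambda>x. P x (snd z)) (fst z)\<bar> \<le> r / 2"
        by (rule prim_diff_bound[OF continuous_on_Pn continuous_on_P_slice[OF t] N[OF n _ t] x])
      then show ?thesis using r by (simp add: dist_real_def)
    qed
    then show "\<forall>\<^sub>F n in sequentially. \<forall>z\<in>{0..1} \<times> {0..}.
        dist (prim (Pn n (snd z)) (fst z)) (prim (\<lambda>x. P x (snd z)) (fst z)) < r"
      unfolding eventually_sequentially by blast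
  qed
qed simp

lemma S_deriv_x:
  assumes x: "x \<in> {0<..<1}" and t: "0 \<le> t"
  shows "((\<lambda>x. S x t) has_real_derivative - (prim (\<lambda>x. P x t) x / x)) (at x)"
proof -
  have "(green (\<lambda>x. P x t) has_real_derivative - (prim (\<lambda>x. P x t) x / x)) (at x)"
    using green_deriv[OF continuous_on_P_slice[OF t], of x] x by (simp add: at_within_Icc_at)
  then show ?thesis
    by (rule has_field_derivative_transform_within_open[where S = "{0<..<1}"])
      (use x t in \<open>auto simp: S_green\<close>)
qed

lemma prim_P_deriv:
  assumes x: "x \<in> {0<..<1}" and t: "0 \<le> t"
  shows "(prim (\<lambda>x. P x t) has_real_derivative x * P x t) (at x)"
  using prim_deriv[OF continuous_on_P_slice[OF t], of x] x by (simp add: at_within_Icc_at)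

lemma S_0: "S x 0 = 0"
  by (simp add: S_def y_def ml_mode_0[OF \<alpha>])

lemma S_1: "S 1 t = 0"
  by (simp add: S_def \<phi>_1)

lemma S_T: "x \<in> {0..1} \<Longrightarrow> S x T = e 0 x"
proof -
  assume x: "x \<in> {0..1}"
  have "c k * (1 - y k T) = d k" for k
    using \<delta>_pos \<delta>_le[of k] by (simp add: c_def)
  then show ?thesis using fourier_bessel_expansion[OF x] by (simp add: S_def)
qed

definition D :: "real \<Rightarrow> real \<Rightarrow> real" where
  "D x t = (\<Sum>k. c k * (- ml_mode' \<alpha> ((L k)\<^sup>2) t) * \<phi> k x)"

lemma D_term_bound:
  assumes t: "0 < t"
  shows "\<bar>c k * (- ml_mode' \<alpha> ((L k)\<^sup>2) t) * \<phi> k x\<bar>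
    \<le> t powr (\<alpha> - 1) / Gamma \<alpha> * \<bar>(L k)\<^sup>2 * (c k * 1) * \<phi> k x\<bar>"
proof -
  have "\<bar>ml_mode' \<alpha> ((L k)\<^sup>2) t\<bar> \<le> (L k)\<^sup>2 * t powr (\<alpha> - 1) / Gamma \<alpha>"
    by (rule abs_ml_mode'_le[OF \<alpha> _ t]) simp
  then have "\<bar>c k * \<phi> k x\<bar> * \<bar>ml_mode' \<alpha> ((L k)\<^sup>2) t\<bar>
      \<le> \<bar>c k * \<phi> k x\<bar> * ((L k)\<^sup>2 * t powr (\<alpha> - 1) / Gamma \<alpha>)"
    by (rule mult_left_mono) simp
  then show ?thesis by (simp add: abs_mult mult_ac)
qed

lemma S_deriv_t:
  assumes x: "x \<in> {0..1}" and t: "0 < t"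
  shows "(S x has_real_derivative D x t) (at t)"
proof -
  have "((\<lambda>t. \<Sum>k. c k * (1 - y k t) * \<phi> k x) has_field_derivative
      (\<Sum>k. c k * (- ml_mode' \<alpha> ((L k)\<^sup>2) t) * \<phi> k x)) (at t)"
  proof (rule has_field_derivative_series')
    \<comment> \<open>The interval stays away from 0, where the bound t^(\<alpha> - 1) on the
      differentiated terms blows up.\<close>
    let ?A = "{t / 2..t + 1}"
    show "convex ?A" by simp
    show "((\<lambda>t. c k * (1 - y k t) * \<phi> k x) has_field_derivative
        c k * (- ml_mode' \<alpha> ((L k)\<^sup>2) s) * \<phi> k x) (at s within ?A)" if "s \<in> ?A" for k s
    proof -
      have "0 < s" using that t by auto
      have "((\<lambda>t. c k * (1 - y k t) * \<phi> k x) has_field_derivative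
          c k * (0 - ml_mode' \<alpha> ((L k)\<^sup>2) s) * \<phi> k x) (at s)"
        unfolding y_def
        by (intro DERIV_cmult_right DERIV_cmult DERIV_diff DERIV_const ml_mode_deriv[OF \<alpha> \<open>0 < s\<close>])
      then show ?thesis by (simp add: has_field_derivative_at_within)
    qed
    show "uniformly_convergent_on ?A (\<lambda>n s. \<Sum>i<n. c i * (- ml_mode' \<alpha> ((L i)\<^sup>2) s) * \<phi> i x)"
    proof (rule Weierstrass_m_test')
      fix k s assume s: "s \<in> ?A"
      then have s0: "0 < s" using t by auto
      have "s powr (\<alpha> - 1) \<le> (t / 2) powr (\<alpha> - 1)"
        using s t \<alpha> by (intro powr_mono2') auto
      then have "s powr (\<alpha> - 1) / Gamma \<alpha> \<le> (t / 2) powr (\<alpha> - 1) / Gamma \<alpha>"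
        using Gamma_real_pos[OF \<alpha>(1)] by (intro divide_right_mono) auto
      then have "s powr (\<alpha> - 1) / Gamma \<alpha> * \<bar>(L k)\<^sup>2 * (c k * 1) * \<phi> k x\<bar>
          \<le> (t / 2) powr (\<alpha> - 1) / Gamma \<alpha> * \<bar>(L k)\<^sup>2 * (c k * 1) * \<phi> k x\<bar>"
        by (rule mult_right_mono) simp
      with D_term_bound[OF s0, of k x]
      show "norm (c k * (- ml_mode' \<alpha> ((L k)\<^sup>2) s) * \<phi> k x)
          \<le> (t / 2) powr (\<alpha> - 1) / Gamma \<alpha> * \<bar>(L k)\<^sup>2 * (c k * 1) * \<phi> k x\<bar>"
        unfolding real_norm_def by (rule order_trans)
    next
      show "summable (\<lambda>k. (t / 2) powr (\<alpha> - 1) / Gamma \<alpha> * \<bar>(L k)\<^sup>2 * (c k * 1) * \<phi> k x\<bar>)"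
        by (intro summable_mult weighted_summable[OF x, of _ 1]) simp
    qed
    show "t \<in> ?A" "t \<in> interior ?A" using t by auto
    show "summable (\<lambda>k. c k * (1 - y k t) * \<phi> k x)" using S_summable[OF x] t by simp
  qed
  then show ?thesis by (simp add: S_def[abs_def] D_def)
qed

text \<open>Termwise integration is legitimate because - \<open>ml_mode'\<close> is nonnegative: the
  norms integrate exactly to multiples of L_k^2 |c_k| y_k |\<phi>_k|, and y_k \<le> 1 makes these
  summable.\<close>

lemma S_caputo:
  assumes x: "x \<in> {0..1}" and t: "0 < t"
  shows "set_integrable lborel {0<..<t} (\<lambda>s. D x s * (t - s) powr (- \<alpha>))"
    and "(LBINT s:{0<..<t}. D x s * (t - s) powr (- \<alpha>)) = Gamma (1 - \<alpha>) * (Q x - P x t)"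
proof -
  let ?m = "\<lambda>k s. ml_mode' \<alpha> ((L k)\<^sup>2) s * (t - s) powr (- \<alpha>)"
  let ?f = "\<lambda>k s. (c k * \<phi> k x) * (indicator {0<..<t} s * - ?m k s)"
  note C = ml_mode'_caputo[OF \<alpha> t]
  have mi: "integrable lborel (\<lambda>s. indicator {0<..<t} s * - ?m k s)" for k
    using integrable_minus[OF C(1)[of "(L k)\<^sup>2", unfolded set_integrable_def]] by simp
  have mv: "(LBINT s. indicator {0<..<t} s * - ?m k s) = (L k)\<^sup>2 * Gamma (1 - \<alpha>) * y k t" for k
    using C(2)[of "(L k)\<^sup>2"] by (simp add: set_lebesgue_integral_def y_def)
  have int: "integrable lborel (?f k)" for k
    by (rule integrable_mult_right[OF mi])
  have val: "integral\<^sup>L lborel (?f k) = Gamma (1 - \<alpha>) * ((L k)\<^sup>2 * (c k * y k t) * \<phi> k x)" for k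
    unfolding integral_mult_right_zero mv by (simp add: mult_ac)
  have mpos: "0 \<le> indicator {0<..<t} s * - ?m k s" for k s
    using ml_mode'_nonpos[OF \<alpha>, of "(L k)\<^sup>2" s] by (auto simp: indicator_def mult_nonpos_nonneg)
  have nval: "(LBINT s. norm (?f k s)) = Gamma (1 - \<alpha>) * \<bar>(L k)\<^sup>2 * (c k * y k t) * \<phi> k x\<bar>" for k
  proof -
    have "(LBINT s. norm (?f k s)) = (LBINT s. \<bar>c k * \<phi> k x\<bar> * (indicator {0<..<t} s * - ?m k s))"
      unfolding norm_mult[of "c k * \<phi> k x"] using abs_of_nonneg[OF mpos]
      by (simp only: real_norm_def)
    also have "\<dots> = \<bar>c k * \<phi> k x\<bar> * ((L k)\<^sup>2 * Gamma (1 - \<alpha>) * y k t)"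
      unfolding integral_mult_right_zero mv ..
    finally show ?thesis using y_bounds(1)[of t k] t by (simp add: abs_mult mult_ac)
  qed
  have sm: "summable (\<lambda>k. LBINT s. norm (?f k s))"
    unfolding nval
  proof (intro summable_mult weighted_summable[OF x])
    show "\<bar>y k t\<bar> \<le> 1" for k using y_bounds[of t k] t by simp
  qed
  have fs: "(\<Sum>k. ?f k s) = indicator {0<..<t} s * (D x s * (t - s) powr (- \<alpha>))"
    and ns: "summable (\<lambda>k. norm (?f k s))" for s
  proof -
    have eq: "?f k s = indicator {0<..<t} s * (t - s) powr (- \<alpha>) * (c k * (- ml_mode' \<alpha> ((L k)\<^sup>2) s) * \<phi> k x)" for k
      by (simp add: mult_ac)
    have sD: "summable (\<lambda>k. \<bar>c k * (- ml_mode' \<alpha> ((L k)\<^sup>2) s) * \<phi> k x\<bar>)" if "0 < s"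
    proof (rule summable_comparison_test')
      show "summable (\<lambda>k. s powr (\<alpha> - 1) / Gamma \<alpha> * \<bar>(L k)\<^sup>2 * (c k * 1) * \<phi> k x\<bar>)"
        by (intro summable_mult weighted_summable[OF x, of _ 1]) simp
    qed (use D_term_bound[OF that] in simp)
    show "summable (\<lambda>k. norm (?f k s))"
    proof (cases "0 < s")
      case True
      show ?thesis unfolding eq norm_mult[of "indicator _ _ * _"]
        using sD[OF True] by (intro summable_mult) simp
    qed simp
    show "(\<Sum>k. ?f k s) = indicator {0<..<t} s * (D x s * (t - s) powr (- \<alpha>))"
    proof (cases "0 < s")
      case True
      show ?thesis unfolding eq D_def
        by (subst suminf_mult[OF summable_rabs_cancel[OF sD[OF True]]]) (simp add: mult_ac)
    qed simp
  qed
  have *: "integrable lborel (\<lambda>s. \<Sum>k. ?f k s)"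
    by (rule integrable_suminf[OF int _ sm]) (use ns in simp)
  have **: "(\<lambda>k. integral\<^sup>L lborel (?f k)) sums (LBINT s. \<Sum>k. ?f k s)"
    by (rule sums_integral[OF int _ sm]) (use ns in simp)
  show "set_integrable lborel {0<..<t} (\<lambda>s. D x s * (t - s) powr (- \<alpha>))"
    using * unfolding fs by (simp add: set_integrable_def)
  have sQ: "summable (\<lambda>k. (L k)\<^sup>2 * (c k * 1) * \<phi> k x)"
    by (rule summable_rabs_cancel[OF weighted_summable[OF x, of _ 1]]) simp
  have sP: "summable (\<lambda>k. (L k)\<^sup>2 * (c k * (1 - y k t)) * \<phi> k x)"
    by (rule summable_rabs_cancel[OF weighted_summable[OF x, of _ 1]]) (use m_bound t in simp)
  have "(\<lambda>k. Gamma (1 - \<alpha>) * ((L k)\<^sup>2 * (c k * 1) * \<phi> k x - (L k)\<^sup>2 * (c k * (1 - y k t)) * \<phi> k x))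
      sums (Gamma (1 - \<alpha>) * (Q x - P x t))"
    using sQ sP unfolding Q_def P_def by (intro sums_mult sums_diff summable_sums) (simp_all add: mult.assoc summable_sums)
  moreover have "Gamma (1 - \<alpha>) * ((L k)\<^sup>2 * (c k * 1) * \<phi> k x - (L k)\<^sup>2 * (c k * (1 - y k t)) * \<phi> k x)
      = integral\<^sup>L lborel (?f k)" for k
    unfolding val by (simp add: algebra_simps)
  ultimately have "(LBINT s. \<Sum>k. ?f k s) = Gamma (1 - \<alpha>) * (Q x - P x t)"
    using ** by (simp add: sums_iff)
  then show "(LBINT s:{0<..<t}. D x s * (t - s) powr (- \<alpha>)) = Gamma (1 - \<alpha>) * (Q x - P x t)"
    unfolding fs by (simp add: set_lebesgue_integral_def)
qed

text \<open>For u = g - S the Caputo derivative is P - Q, while the Bessel operator gives g'' + g'/x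
  + P. The terms with P cancel, leaving a source that depends on x only: - (g'' + g'/x) - Q.\<close>

lemma inverse_problem_solvable:
  assumes g: "\<And>x. x \<in> {0..1} \<Longrightarrow> (g has_real_derivative g1 x) (at x within {0..1})"
      "\<And>x. x \<in> {0..1} \<Longrightarrow> (g1 has_real_derivative g2 x) (at x within {0..1})"
      "continuous_on {0..1} g2" "g 1 = 0"
    and f: "\<And>x. x \<in> {0..1} \<Longrightarrow> e 0 x = g x - f x"
  shows "inverse_problem_solution \<alpha> T g f (\<lambda>x t. g x - S x t) (\<lambda>x. - (g2 x + 1 / x * g1 x) - Q x)"
proof -
  let ?u = "\<lambda>x t. g x - S x t"
  let ?A = "\<lambda>t x. prim (\<lambda>x. P x t) x"
  have cg: "continuous_on {0..1} g" and cg1: "continuous_on {0..1} g1"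
    by (rule DERIV_continuous_on, fact)+
  have dg: "(g has_real_derivative g1 x) (at x)" "(g1 has_real_derivative g2 x) (at x)"
    if "x \<in> {0<..<1}" for x
    using g(1)[of x] g(2)[of x] that by (simp_all add: at_within_Icc_at)
  have ux: "((\<lambda>x. ?u x t) has_real_derivative g1 x + ?A t x / x) (at x)"
    if "x \<in> {0<..<1}" "0 \<le> t" for x t
    using DERIV_diff[OF dg(1) S_deriv_x, of x t] that by simp
  have dxu: "dx ?u x t = g1 x + ?A t x / x" if "x \<in> {0<..<1}" "0 \<le> t" for x t
    unfolding dx_def by (rule DERIV_imp_deriv[OF ux[OF that]])
  have uxx: "((\<lambda>x. dx ?u x t) has_real_derivative g2 x + (x * P x t * x - ?A t x * 1) / (x * x)) (at x)"
    if x: "x \<in> {0<..<1}" and t: "0 \<le> t" for x t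
  proof -
    have "((\<lambda>x. g1 x + ?A t x / x) has_real_derivative
        g2 x + (x * P x t * x - ?A t x * 1) / (x * x)) (at x)"
      using x by (intro DERIV_add DERIV_divide dg prim_P_deriv t DERIV_ident) auto
    then show ?thesis
      by (rule has_field_derivative_transform_within_open[where S = "{0<..<1}"])
        (use x t in \<open>auto simp: dxu\<close>)
  qed
  have dxxu: "dx (dx ?u) x t = g2 x + P x t - ?A t x / x\<^sup>2" if "x \<in> {0<..<1}" "0 \<le> t" for x t
  proof -
    have "dx (dx ?u) x t = g2 x + (x * P x t * x - ?A t x * 1) / (x * x)"
      unfolding dx_def[of "dx ?u"] by (rule DERIV_imp_deriv[OF uxx[OF that]])
    then show ?thesis using that by (simp add: diff_divide_distrib power2_eq_square)
  qed
  have ut: "(?u x has_real_derivative - D x t) (at t)" if "x \<in> {0..1}" "0 < t" for x t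
    using DERIV_diff[OF DERIV_const S_deriv_t[OF that], of "g x"] by simp
  have cap_int: "set_integrable lborel {0<..<t} (\<lambda>s. - D x s * (t - s) powr (- \<alpha>))"
    if "x \<in> {0..1}" "0 < t" for x t
    using S_caputo(1)[OF that] by (simp add: set_integrable_def)
  have cap: "caputo \<alpha> (?u x) t = P x t - Q x" if x: "x \<in> {0..1}" and t: "0 < t" for x t
  proof -
    have "caputo \<alpha> (?u x) t = 1 / Gamma (1 - \<alpha>) * (LBINT s:{0<..<t}. - D x s * (t - s) powr (- \<alpha>))"
      by (rule caputo_cong) (use ut x in auto)
    also have "(LBINT s:{0<..<t}. - D x s * (t - s) powr (- \<alpha>)) = - (Gamma (1 - \<alpha>) * (Q x - P x t))"
      using S_caputo(2)[OF x t] by (simp add: set_lebesgue_integral_def)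
    also have "1 / Gamma (1 - \<alpha>) * - (Gamma (1 - \<alpha>) * (Q x - P x t)) = P x t - Q x"
    proof -
      have "0 < Gamma (1 - \<alpha>)" using \<alpha> by (intro Gamma_real_pos) simp
      then show ?thesis by simp
    qed
    finally show ?thesis .
  qed
  have pair1: "continuous_on B (\<lambda>z. v (fst z))" if "continuous_on {0..1} v" "B \<subseteq> {0..1} \<times> UNIV"
    for v :: "real \<Rightarrow> real" and B :: "(real \<times> real) set"
    using that by (intro continuous_on_compose2[OF that(1)] continuous_intros) auto
  have O: "{0<..<1::real} \<times> {0<..<T} \<subseteq> {0..1} \<times> {0..}" "{0..1} \<times> {0..T} \<subseteq> {0..1::real} \<times> {0..}"
    by auto
  note cA = continuous_on_subset[OF continuous_on_prim_P O(1)]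
  show ?thesis
    unfolding inverse_problem_solution_def
  proof (intro conjI ballI)
    show "continuous_on ({0..1} \<times> {0..T}) (\<lambda>(x, t). ?u x t)"
      unfolding case_prod_unfold
      by (intro continuous_on_diff pair1[OF cg] continuous_on_subset[OF continuous_on_S O(2)]) auto
    show "caputo_differentiable \<alpha> T (?u x)" if "x \<in> {0<..<1}" for x
      using that by (intro caputo_differentiableI[where \<phi>' = "\<lambda>s. - D x s"] ut cap_int) auto
    show "(\<lambda>y. ?u y t) field_differentiable at x" "(\<lambda>y. dx ?u y t) field_differentiable at x"
      if "x \<in> {0<..<1}" "t \<in> {0<..<T}" for x t
      using ux[of x t] uxx[of x t] that by (auto simp: field_differentiable_def)
    have "continuous_on ({0<..<1} \<times> {0<..<T}) (\<lambda>z. g1 (fst z) + ?A (snd z) (fst z) / fst z)"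
      by (intro continuous_on_add pair1[OF cg1] continuous_on_divide cA continuous_intros) auto
    then show "continuous_on ({0<..<1} \<times> {0<..<T}) (\<lambda>(x, t). dx ?u x t)"
      unfolding case_prod_unfold by (rule continuous_on_cong[THEN iffD1, OF refl, rotated]) (auto simp: dxu)
    have "continuous_on ({0<..<1} \<times> {0<..<T})
        (\<lambda>z. g2 (fst z) + P (fst z) (snd z) - ?A (snd z) (fst z) / (fst z)\<^sup>2)"
      by (intro continuous_on_add continuous_on_diff pair1[OF g(3)] continuous_on_divide cA
          continuous_intros continuous_on_subset[OF continuous_on_P O(1)]) auto
    then show "continuous_on ({0<..<1} \<times> {0<..<T}) (\<lambda>(x, t). dx (dx ?u) x t)"
      unfolding case_prod_unfold by (rule continuous_on_cong[THEN iffD1, OF refl, rotated]) (auto simp: dxxu)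
    show "continuous_on {0<..<1} (\<lambda>x. - (g2 x + 1 / x * g1 x) - Q x)"
      by (intro continuous_intros continuous_on_subset[OF g(3)] continuous_on_subset[OF cg1]
          continuous_on_subset[OF continuous_on_Q]) auto
    show "caputo \<alpha> (?u x) t = dx (dx ?u) x t + 1 / x * dx ?u x t + (- (g2 x + 1 / x * g1 x) - Q x)"
      if "x \<in> {0<..<1}" "t \<in> {0<..<T}" for x t
      using that by (simp add: cap dxxu dxu field_simps power2_eq_square)
    show "((\<lambda>x. x * dx ?u x t) \<longlongrightarrow> 0) (at_right 0)" if t: "t \<in> {0<..<T}" for t
    proof -
      have "continuous_on {0..1} (\<lambda>x. x * g1 x + ?A t x)"
        using t by (intro continuous_intros cg1 continuous_on_prim continuous_on_P_slice) auto
      then have "((\<lambda>x. x * g1 x + ?A t x) \<longlongrightarrow> 0 * g1 0 + ?A t 0) (at 0 within {0..1})"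
        unfolding continuous_on_def by (rule bspec) simp
      then have "((\<lambda>x. x * g1 x + ?A t x) \<longlongrightarrow> 0) (at_right 0)"
        by (simp add: at_within_Icc_at_right prim_def)
      moreover have "\<forall>\<^sub>F x in at_right 0. x * g1 x + ?A t x = x * dx ?u x t"
        using eventually_at_right_real[OF zero_less_one]
        by (rule eventually_mono) (use t in \<open>auto simp: dxu field_simps\<close>)
      ultimately show ?thesis by (rule Lim_transform_eventually)
    qed
    show "?u 1 t = 0" for t by (simp add: S_1 g)
    show "?u x 0 = g x" for x by (simp add: S_0)
    show "?u x T = f x" if "x \<in> {0<..<1}" for x
      using that f[of x] by (simp add: S_T)
  qed
qed

end


section \<open>Uniqueness\<close>

text \<open>\<open>F\<close> is continuous on the closed rectangle and \<open>k\<close> merely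
  integrable. With a singular kernel in time this keeps fractional integrals continuous up to the
  sides and lets them commute with projections in x.\<close>

lemma kernel_integral:
  fixes F :: "real \<Rightarrow> real \<Rightarrow> real" and k :: "real \<Rightarrow> real"
  assumes F: "continuous_on ({0..1} \<times> {0..T}) (\<lambda>z. F (fst z) (snd z))"
    and k: "set_integrable lborel {0<..<t} k" and t: "0 \<le> t" "t \<le> T"
  shows kernel_integrable: "x \<in> {0..1} \<Longrightarrow> set_integrable lborel {0<..<t} (\<lambda>s. F x s * k s)"
    and continuous_on_kernel_integral:
      "continuous_on {0..1} (\<lambda>x. LBINT s:{0<..<t}. F x s * k s)"
    and kernel_integral_swap: "integral {0..1} (\<lambda>x. LBINT s:{0<..<t}. F x s * k s)
      = (LBINT s:{0<..<t}. integral {0..1} (\<lambda>x. F x s) * k s)"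
proof -
  let ?R = "{0..1} \<times> {0..T} :: (real \<times> real) set"
  let ?k = "\<lambda>s. indicator {0<..<t} s * k s"
  have ki: "integrable lborel ?k" using k by (simp add: set_integrable_def)
  then have km[measurable]: "?k \<in> borel_measurable borel" by simp
  have "bounded ((\<lambda>z. F (fst z) (snd z)) ` ?R)"
    by (intro compact_imp_bounded compact_continuous_image F compact_Times) auto
  then obtain M where "\<forall>v\<in>(\<lambda>z. F (fst z) (snd z)) ` ?R. norm v \<le> M"
    unfolding bounded_iff by blast
  then have M: "\<bar>F x s\<bar> \<le> M" if "x \<in> {0..1}" "s \<in> {0..T}" for x s
    using that by force
  have M0: "0 \<le> M" using M[of 0 0] t by simp
  \<comment> \<open>Cutting \<open>F\<close> off outside the rectangle gives a Borel function on the
    whole plane, as Fubini's theorem wants.\<close>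
  define G where "G = (\<lambda>z. indicator ?R z * F (fst z) (snd z))"
  have Gm: "G \<in> borel_measurable (borel \<Otimes>\<^sub>M borel)"
    unfolding G_def borel_prod
    using borel_measurable_continuous_on_indicator[OF _ F] by (simp add: compact_Times borel_compact)
  note [measurable] = Gm
  have Gb: "\<bar>G z\<bar> \<le> M * indicator {0..1} (fst z)" for z
    using M[of "fst z" "snd z"] M0 by (auto simp: G_def indicator_def)
  define K where "K = (\<lambda>z. G z * ?k (snd z))"
  have Km: "K \<in> borel_measurable (borel \<Otimes>\<^sub>M borel)"
    unfolding K_def by measurable
  have Kb: "\<bar>K z\<bar> \<le> M * indicator {0..1} (fst z) * \<bar>?k (snd z)\<bar>" for z
    unfolding K_def abs_mult[of "G z"] using Gb by (intro mult_right_mono) auto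
  have Ksec: "integrable lborel (\<lambda>s. K (x, s))" for x
  proof (rule Bochner_Integration.integrable_bound)
    show "integrable lborel (\<lambda>s. M * \<bar>?k s\<bar>)" using ki by (intro integrable_mult_right integrable_abs)
    show "(\<lambda>s. K (x, s)) \<in> borel_measurable lborel" using Km by simp
    have "\<bar>K (x, s)\<bar> \<le> M * \<bar>?k s\<bar>" for s
    proof -
      have "M * indicator {0..1} x * \<bar>?k s\<bar> \<le> M * \<bar>?k s\<bar>"
        using M0 by (intro mult_right_mono) (auto simp: indicator_def)
      then show ?thesis using Kb[of "(x, s)"] by simp
    qed
    then show "AE s in lborel. norm (K (x, s)) \<le> norm (M * \<bar>?k s\<bar>)" using M0 by simp
  qed
  have Kx: "K (x, s) = indicator {0<..<t} s *\<^sub>R (F x s * k s)" if "x \<in> {0..1}" for x s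
    using that t by (auto simp: K_def G_def indicator_def)
  show "set_integrable lborel {0<..<t} (\<lambda>s. F x s * k s)" if "x \<in> {0..1}" for x
    using Ksec[of x] unfolding Kx[OF that] set_integrable_def .
  have Kval: "(LBINT s. K (x, s)) = (LBINT s:{0<..<t}. F x s * k s)" if "x \<in> {0..1}" for x
    unfolding Kx[OF that] set_lebesgue_integral_def ..
  have Kval0: "(LBINT s. K (x, s)) = 0" if "x \<notin> {0..1}" for x
  proof -
    have "K (x, s) = 0" for s using that by (auto simp: K_def G_def indicator_def)
    then show ?thesis by simp
  qed
  have "integrable (lborel \<Otimes>\<^sub>M lborel) K"
  proof (rule lborel_pair.Fubini_integrable)
    show Km': "K \<in> borel_measurable (lborel \<Otimes>\<^sub>M lborel)"
      using Km by (simp cong: measurable_cong_sets sets_pair_measure_cong)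
    let ?c = "LBINT s. \<bar>?k s\<bar>"
    show "integrable lborel (\<lambda>x. LBINT s. norm (K (x, s)))"
    proof (rule Bochner_Integration.integrable_bound)
      show "integrable lborel (\<lambda>x. indicator {0..1::real} x * (M * ?c))" by simp
      show "(\<lambda>x. LBINT s. norm (K (x, s))) \<in> borel_measurable lborel"
        using Km' by measurable
      have le: "(LBINT s. norm (K (x, s))) \<le> indicator {0..1} x * (M * ?c)" for x
      proof -
        have "(LBINT s. norm (K (x, s))) \<le> (LBINT s. (M * indicator {0..1} x) * \<bar>?k s\<bar>)"
          using Kb[of "(x, _)"] ki Ksec[of x] M0
          by (intro Bochner_Integration.integral_mono integrable_norm integrable_mult_right integrable_abs) auto
        then show ?thesis unfolding integral_mult_right_zero by (simp add: mult_ac)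
      qed
      have nn: "0 \<le> (LBINT s. norm (K (x, s)))" for x
        by (intro Bochner_Integration.integral_nonneg) simp
      have "norm (LBINT s. norm (K (x, s))) \<le> norm (indicator {0..1} x * (M * ?c))" for x
        using le[of x] nn[of x] unfolding real_norm_def by linarith
      then show "AE x in lborel. norm (LBINT s. norm (K (x, s))) \<le> norm (indicator {0..1} x * (M * ?c))"
        by simp
    qed
  qed (simp add: Ksec)
  then have Kint: "integrable (lborel \<Otimes>\<^sub>M lborel) (case_prod (\<lambda>x s. K (x, s)))" by simp
  show cont: "continuous_on {0..1} (\<lambda>x. LBINT s:{0<..<t}. F x s * k s)"
    unfolding continuous_on_iff
  proof (intro ballI allI impI)
    fix x r :: real assume x: "x \<in> {0..1}" and r: "0 < r"
    define c where "c = (LBINT s. \<bar>?k s\<bar>)"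
    have c0: "0 \<le> c" unfolding c_def by (intro Bochner_Integration.integral_nonneg) simp
    have "uniformly_continuous_on ?R (\<lambda>z. F (fst z) (snd z))"
      by (intro compact_uniformly_continuous F compact_Times) auto
    moreover have r': "0 < r / (c + 1)" using r c0 by simp
    ultimately obtain \<delta> where \<delta>: "0 < \<delta>"
      "\<And>z z'. z \<in> ?R \<Longrightarrow> z' \<in> ?R \<Longrightarrow> dist z' z < \<delta> \<Longrightarrow> dist (F (fst z') (snd z')) (F (fst z) (snd z)) < r / (c + 1)"
      unfolding uniformly_continuous_on_def by meson
    have "dist (LBINT s:{0<..<t}. F x' s * k s) (LBINT s:{0<..<t}. F x s * k s) < r"
      if x': "x' \<in> {0..1}" "dist x' x < \<delta>" for x'
    proof -
      have "\<bar>(LBINT s. K (x', s)) - (LBINT s. K (x, s))\<bar> = \<bar>LBINT s. K (x', s) - K (x, s)\<bar>"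
        by (simp add: Bochner_Integration.integral_diff Ksec)
      also have "\<dots> \<le> (LBINT s. \<bar>K (x', s) - K (x, s)\<bar>)"
        by (rule integral_abs_bound)
      also have "\<dots> \<le> (LBINT s. r / (c + 1) * \<bar>?k s\<bar>)"
      proof (intro Bochner_Integration.integral_mono integrable_abs integrable_mult_right
          Bochner_Integration.integrable_diff Ksec ki)
        fix s
        show "\<bar>K (x', s) - K (x, s)\<bar> \<le> r / (c + 1) * \<bar>?k s\<bar>"
        proof (cases "s \<in> {0<..<t}")
          case True
          have "dist (x', s) (x, s) < \<delta>" using x'(2) by (simp add: dist_Pair_Pair)
          then have "\<bar>F x' s - F x s\<bar> \<le> r / (c + 1)"
            using \<delta>(2)[of "(x, s)" "(x', s)"] x x' True t by (simp add: dist_real_def)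
          then have "\<bar>F x' s - F x s\<bar> * \<bar>k s\<bar> \<le> r / (c + 1) * \<bar>k s\<bar>" by (rule mult_right_mono) simp
          then show ?thesis
            using True unfolding Kx[OF x] Kx[OF x'(1)]
            by (simp add: abs_mult[symmetric] left_diff_distrib)
        next
          case False
          then show ?thesis unfolding Kx[OF x] Kx[OF x'(1)] by simp
        qed
      qed
      also have "\<dots> = r / (c + 1) * c" unfolding c_def by (rule integral_mult_right_zero)
      also have "\<dots> < r" using r c0 by (simp add: field_simps)
      finally show ?thesis using Kval[OF x] Kval[OF x'(1)] by (simp add: dist_real_def)
    qed
    then show "\<exists>\<delta>>0. \<forall>x'\<in>{0..1}. dist x' x < \<delta> \<longrightarrow>
        dist (LBINT s:{0<..<t}. F x' s * k s) (LBINT s:{0<..<t}. F x s * k s) < r"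
      using \<delta>(1) by blast
  qed
  have "integral {0..1} (\<lambda>x. LBINT s:{0<..<t}. F x s * k s) = (LBINT x:{0..1}. LBINT s:{0<..<t}. F x s * k s)"
    using cont by (intro set_borel_integral_eq_integral(2)[symmetric] borel_integrable_atLeastAtMost')
  also have "\<dots> = (LBINT x. LBINT s. K (x, s))"
    unfolding set_lebesgue_integral_def[of _ "{0..1}"]
  proof (rule Bochner_Integration.integral_cong[OF refl])
    fix x :: real
    show "indicator {0..1} x *\<^sub>R (LBINT s:{0<..<t}. F x s * k s) = (LBINT s. K (x, s))"
      using Kval[of x] Kval0[of x] by (cases "x \<in> {0..1}") auto
  qed
  also have "\<dots> = (LBINT s. LBINT x. K (x, s))"
    by (rule lborel_pair.Fubini_integral[OF Kint, symmetric])
  also have "\<dots> = (LBINT s:{0<..<t}. integral {0..1} (\<lambda>x. F x s) * k s)"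
    unfolding set_lebesgue_integral_def[of _ "{0<..<t}"]
  proof (rule Bochner_Integration.integral_cong[OF refl])
    fix s :: real
    show "(LBINT x. K (x, s)) = indicator {0<..<t} s *\<^sub>R (integral {0..1} (\<lambda>x. F x s) * k s)"
    proof (cases "s \<in> {0<..<t}")
      case True
      then have eq: "K (x, s) = indicator {0..1} x * F x s * k s" for x
        using t by (auto simp: K_def G_def indicator_def)
      have "continuous_on {0..1} (\<lambda>x. F (fst (x, s)) (snd (x, s)))"
        by (rule continuous_on_compose2[OF F]) (use True t in \<open>auto intro!: continuous_intros\<close>)
      then have "(LBINT x:{0..1}. F x s) = integral {0..1} (\<lambda>x. F x s)"
        by (intro set_borel_integral_eq_integral(2) borel_integrable_atLeastAtMost') simp
      then show ?thesis using True unfolding eq by (simp add: set_lebesgue_integral_def)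
    qed (auto simp: K_def indicator_def)
  qed
  finally show "integral {0..1} (\<lambda>x. LBINT s:{0<..<t}. F x s * k s)
      = (LBINT s:{0<..<t}. integral {0..1} (\<lambda>x. F x s) * k s)" .
qed

text \<open>
  A bounded solution has no logarithmic singularity at 0, so no boundary condition is
  needed there.
\<close>

lemma bessel_problem_unique:
  assumes Z: "continuous_on {0..1} Z" and R: "continuous_on {0..1} R"
    and d1: "\<And>x. x \<in> {0<..<1} \<Longrightarrow> (Z has_real_derivative Z1 x) (at x)"
    and d2: "\<And>x. x \<in> {0<..<1} \<Longrightarrow> (Z1 has_real_derivative Z2 x) (at x)"
    and eq: "\<And>x. x \<in> {0<..<1} \<Longrightarrow> Z2 x + Z1 x / x = R x"
    and bc: "Z 1 = 0" and x: "x \<in> {0..1}"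
  shows "Z x = - green R x"
proof -
  let ?I = "{0<..<1::real}"
  define W where "W x = Z x + green R x" for x
  have cW: "continuous_on {0..1} W"
    unfolding W_def by (intro continuous_intros Z continuous_on_green R)
  have dW: "(W has_real_derivative Z1 x - prim R x / x) (at x)" if "x \<in> ?I" for x
  proof -
    have "(green R has_real_derivative - (prim R x / x)) (at x)"
      using green_deriv[OF R, of x] that by (simp add: at_within_Icc_at)
    from DERIV_add[OF d1[OF that] this] show ?thesis unfolding W_def by simp
  qed
  \<comment> \<open>The flux of Z and that of - green R differ by a constant \<kappa>, so their
    difference W is \<kappa> ln x plus a constant; the value at 1 removes that constant and
    boundedness near 0 removes \<kappa>.\<close>
  have "\<exists>\<kappa>. \<forall>x\<in>?I. x * Z1 x - prim R x = \<kappa>"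
  proof (rule has_field_derivative_zero_constant)
    fix x assume x: "x \<in> ?I"
    have "(prim R has_real_derivative x * R x) (at x)"
      using prim_deriv[OF R, of x] x by (simp add: at_within_Icc_at)
    then have "((\<lambda>x. x * Z1 x - prim R x) has_real_derivative (1 * Z1 x + Z2 x * x) - x * R x) (at x)"
      by (intro DERIV_diff DERIV_mult DERIV_ident d2[OF x])
    then have "((\<lambda>x. x * Z1 x - prim R x) has_real_derivative 0) (at x)"
      by (rule DERIV_cong) (use x eq[OF x, symmetric] in \<open>simp add: field_simps\<close>)
    then show "((\<lambda>x. x * Z1 x - prim R x) has_real_derivative 0) (at x within ?I)"
      by (rule has_field_derivative_at_within)
  qed simp
  then obtain \<kappa> where \<kappa>: "x * Z1 x - prim R x = \<kappa>" if "x \<in> ?I" for x by blast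
  have "\<exists>m. \<forall>x\<in>?I. W x - \<kappa> * ln x = m"
  proof (rule has_field_derivative_zero_constant)
    fix x assume x: "x \<in> ?I"
    have "((\<lambda>x. W x - \<kappa> * ln x) has_real_derivative (Z1 x - prim R x / x) - \<kappa> * inverse x) (at x)"
      using x by (intro DERIV_diff dW DERIV_cmult DERIV_ln) auto
    then have "((\<lambda>x. W x - \<kappa> * ln x) has_real_derivative 0) (at x)"
    proof (rule DERIV_cong)
      have "x * ((Z1 x - prim R x / x) - \<kappa> * inverse x) = 0"
        using x \<kappa>[OF x] by (simp add: right_diff_distrib)
      then show "(Z1 x - prim R x / x) - \<kappa> * inverse x = 0" using x by simp
    qed
    then show "((\<lambda>x. W x - \<kappa> * ln x) has_real_derivative 0) (at x within ?I)"
      by (rule has_field_derivative_at_within)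
  qed simp
  then obtain m where m: "W x - \<kappa> * ln x = m" if "x \<in> ?I" for x by blast
  have m0: "m = 0"
  proof -
    have "continuous_on {1/2..1} (\<lambda>x. W x - \<kappa> * ln x)"
      by (intro continuous_intros continuous_on_subset[OF cW]) auto
    then have "(\<lambda>x. W x - \<kappa> * ln x) 1 = m"
      by (intro continuous_constant_on_closure[of "{1/2<..<1}" "\<lambda>x. W x - \<kappa> * ln x" m 1]) (use m in auto)
    then show ?thesis using bc by (simp add: W_def green_1[OF R])
  qed
  obtain B where B: "0 \<le> B" "\<And>x. x \<in> {0..1} \<Longrightarrow> \<bar>W x\<bar> \<le> B"
    using continuous_bounded_01[OF cW] by metis
  have "\<kappa> = 0"
  proof (rule ccontr)
    assume nz: "\<kappa> \<noteq> 0"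
    \<comment> \<open>At this point |\<kappa> ln z| equals B + 1, beyond the bound on W.\<close>
    define z where "z = exp (- ((B + 1) / \<bar>\<kappa>\<bar>))"
    have z: "z \<in> ?I" using B nz by (simp add: z_def)
    then have "\<bar>\<kappa> * ln z\<bar> \<le> B" using m[OF z] m0 B(2)[of z] by auto
    moreover have "\<bar>\<kappa> * ln z\<bar> = B + 1" using nz B by (simp add: z_def abs_mult)
    ultimately show False by simp
  qed
  then have W0: "W x = 0" if "x \<in> ?I" for x using m[OF that] m0 by simp
  have "W x = 0"
    using continuous_constant_on_closure[of ?I W 0 x] cW W0 x by simp
  then show ?thesis by (simp add: W_def)
qed

section \<open>The homogeneous problem, integrated in time\<close>

locale homogeneous_problem = bessel_zeros +
  fixes \<alpha> T :: real and U :: "real \<Rightarrow> real \<Rightarrow> real" and H :: "real \<Rightarrow> real"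
  assumes \<alpha>: "0 < \<alpha>" "\<alpha> < 1" and T: "0 < T"
    and sol: "inverse_problem_solution \<alpha> T (\<lambda>_. 0) (\<lambda>_. 0) U H"
begin

lemma U_cont: "continuous_on ({0..1} \<times> {0..T}) (\<lambda>z. U (fst z) (snd z))"
  using sol unfolding inverse_problem_solution_def case_prod_unfold by blast

lemma U_caputo_differentiable: "x \<in> {0<..<1} \<Longrightarrow> caputo_differentiable \<alpha> T (U x)"
  using sol unfolding inverse_problem_solution_def by blast

lemma U_dx: "x \<in> {0<..<1} \<Longrightarrow> t \<in> {0<..<T} \<Longrightarrow> ((\<lambda>y. U y t) has_real_derivative dx U x t) (at x)"
  "x \<in> {0<..<1} \<Longrightarrow> t \<in> {0<..<T} \<Longrightarrow> ((\<lambda>y. dx U y t) has_real_derivative dx (dx U) x t) (at x)"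
  using sol unfolding inverse_problem_solution_def dx_def DERIV_deriv_iff_field_differentiable by blast+

lemma U_dx_cont:
  "continuous_on ({0<..<1} \<times> {0<..<T}) (\<lambda>(x, t). dx U x t)"
  "continuous_on ({0<..<1} \<times> {0<..<T}) (\<lambda>(x, t). dx (dx U) x t)"
  using sol unfolding inverse_problem_solution_def by blast+

lemma U_equation: "x \<in> {0<..<1} \<Longrightarrow> t \<in> {0<..<T} \<Longrightarrow>
    caputo \<alpha> (U x) t = dx (dx U) x t + 1 / x * dx U x t + H x"
  using sol unfolding inverse_problem_solution_def by blast

lemma U_1: "t \<in> {0<..<T} \<Longrightarrow> U 1 t = 0"
  and U_0: "x \<in> {0<..<1} \<Longrightarrow> U x 0 = 0" and U_T: "x \<in> {0<..<1} \<Longrightarrow> U x T = 0"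
  using sol unfolding inverse_problem_solution_def by blast+

lemma U_slice_t: "x \<in> {0..1} \<Longrightarrow> continuous_on {0..T} (U x)"
proof -
  assume x: "x \<in> {0..1}"
  have "continuous_on {0..T} (\<lambda>t. U (fst (x, t)) (snd (x, t)))"
    by (rule continuous_on_compose2[OF U_cont]) (use x in \<open>auto intro!: continuous_intros\<close>)
  then show ?thesis by simp
qed

lemma U_slice_x: "t \<in> {0..T} \<Longrightarrow> continuous_on {0..1} (\<lambda>x. U x t)"
proof -
  assume t: "t \<in> {0..T}"
  have "continuous_on {0..1} (\<lambda>x. U (fst (x, t)) (snd (x, t)))"
    by (rule continuous_on_compose2[OF U_cont]) (use t in \<open>auto intro!: continuous_intros\<close>)
  then show ?thesis by simp
qed

text \<open>Gamma (1 - \<alpha>) times the Riemann-Liouville integral of U of order 1 - \<alpha> in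
  time.\<close>

definition V :: "real \<Rightarrow> real \<Rightarrow> real" where
  "V x t = (LBINT s:{0<..<t}. U x s * (t - s) powr (- \<alpha>))"

definition Y :: "real \<Rightarrow> real \<Rightarrow> real \<Rightarrow> real" where
  "Y a b x = integral {a..b} (U x)"

lemma kernel: "0 < t \<Longrightarrow> set_integrable lborel {0<..<t} (\<lambda>s. (t - s) powr (- \<alpha>))"
  "0 < t \<Longrightarrow> (LBINT s:{0<..<t}. (t - s) powr (- \<alpha>)) = t powr (1 - \<alpha>) / (1 - \<alpha>)"
  using power_kernel_right[of "1 - \<alpha>" 0 t] \<alpha> by simp_all

lemma V_cont: "0 < t \<Longrightarrow> t \<le> T \<Longrightarrow> continuous_on {0..1} (\<lambda>x. V x t)"
  unfolding V_def by (intro continuous_on_kernel_integral[OF U_cont kernel(1)]) auto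

lemma Gamma_pos: "0 < Gamma (1 - \<alpha>)"
  using \<alpha> by (intro Gamma_real_pos) simp

text \<open>Leibniz' rule needs derivatives continuous on compact time intervals, so a and b stay
  strictly inside (0,T). Integrating the equation over [a,b] replaces the Caputo derivative by an
  increment of \<open>V\<close>, where the initial condition enters.\<close>

lemma Y_derivs:
  assumes ab: "0 < a" "a < b" "b < T" and x: "x \<in> {0<..<1}"
  shows "(Y a b has_real_derivative integral {a..b} (dx U x)) (at x)"
    and "((\<lambda>x. integral {a..b} (dx U x)) has_real_derivative integral {a..b} (dx (dx U) x)) (at x)"
    and "integral {a..b} (dx (dx U) x) + integral {a..b} (dx U x) / x
      = (V x b - V x a) / Gamma (1 - \<alpha>) - (b - a) * H x"
proof -
  let ?I = "{0<..<1::real}"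
  have sub: "?I \<times> {a..b} \<subseteq> ?I \<times> {0<..<T}" using ab by auto
  have at: "at x within ?I = at x" using x by (intro at_within_open) auto
  have slice: "continuous_on {a..b} (w x)"
    if "continuous_on (?I \<times> {0<..<T}) (\<lambda>(x, t). w x t)" "x \<in> ?I" for w :: "real \<Rightarrow> real \<Rightarrow> real" and x
  proof -
    have "continuous_on {a..b} (\<lambda>t. (\<lambda>(x, t). w x t) (x, t))"
      by (rule continuous_on_compose2[OF that(1)]) (use that(2) ab in \<open>auto intro!: continuous_intros\<close>)
    then show ?thesis by simp
  qed
  have U_int: "U x integrable_on {a..b}" if "x \<in> ?I" for x
    using that ab by (intro integrable_continuous_real continuous_on_subset[OF U_slice_t]) auto
  have "((\<lambda>x. integral (cbox a b) (U x)) has_field_derivative integral (cbox a b) (dx U x)) (at x within ?I)"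
    by (rule leibniz_rule_field_derivative)
      (use ab x U_int U_dx(1) in \<open>auto intro!: continuous_on_subset[OF U_dx_cont(1) sub]
        intro: has_field_derivative_at_within\<close>)
  then show "(Y a b has_real_derivative integral {a..b} (dx U x)) (at x)"
    unfolding at by (simp add: Y_def[abs_def])
  have "((\<lambda>x. integral (cbox a b) (dx U x)) has_field_derivative integral (cbox a b) (dx (dx U) x)) (at x within ?I)"
    by (rule leibniz_rule_field_derivative)
      (use ab x U_dx(2) in \<open>auto intro!: continuous_on_subset[OF U_dx_cont(2) sub]
        integrable_continuous_real slice U_dx_cont intro: has_field_derivative_at_within\<close>)
  then show "((\<lambda>x. integral {a..b} (dx U x)) has_real_derivative integral {a..b} (dx (dx U) x)) (at x)"
    unfolding at by simp
  have cap: "caputo \<alpha> (U x) integrable_on {0..t} \<and> integral {0..t} (caputo \<alpha> (U x)) = V x t / Gamma (1 - \<alpha>)"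
    if t: "0 < t" "t < T" for t
  proof -
    have "continuous_on {0..T} (U x)" using x by (intro U_slice_t) auto
    note C = caputo_integral[OF \<alpha> U_caputo_differentiable[OF x] this t]
    have "caputo \<alpha> (U x) integrable_on {0<..<t}"
      "integral {0<..<t} (caputo \<alpha> (U x)) = V x t / Gamma (1 - \<alpha>)"
      using set_borel_integral_eq_integral[OF C(1)] C(2) U_0[OF x] by (simp_all add: V_def)
    then show ?thesis by (simp add: integrable_on_Icc_iff_Ioo integral_open_interval_real)
  qed
  have "integral {0..a} (caputo \<alpha> (U x)) + integral {a..b} (caputo \<alpha> (U x)) = integral {0..b} (caputo \<alpha> (U x))"
    using ab cap[of b] by (intro Henstock_Kurzweil_Integration.integral_combine) auto
  then have "integral {a..b} (caputo \<alpha> (U x)) = (V x b - V x a) / Gamma (1 - \<alpha>)"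
    using cap[of a] cap[of b] ab by (simp add: diff_divide_distrib)
  moreover have "integral {a..b} (caputo \<alpha> (U x))
      = integral {a..b} (\<lambda>t. (dx (dx U) x t + 1 / x * dx U x t) + H x)"
    by (rule integral_cong) (use ab x U_equation in auto)
  moreover have "\<dots> = integral {a..b} (dx (dx U) x) + 1 / x * integral {a..b} (dx U x) + (b - a) * H x"
  proof -
    have i: "dx U x integrable_on {a..b}" "dx (dx U) x integrable_on {a..b}"
      by (intro integrable_continuous_real slice U_dx_cont x)+
    have "((\<lambda>t. (dx (dx U) x t + 1 / x * dx U x t) + H x) has_integral
        integral {a..b} (dx (dx U) x) + 1 / x * integral {a..b} (dx U x) + (b - a) *\<^sub>R H x) {a..b}"
      using ab by (intro has_integral_add has_integral_mult_right has_integral_const_real[THEN has_integral_eq_rhs]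
          integrable_integral i) auto
    then show ?thesis by (simp add: integral_unique)
  qed
  ultimately show "integral {a..b} (dx (dx U) x) + integral {a..b} (dx U x) / x
      = (V x b - V x a) / Gamma (1 - \<alpha>) - (b - a) * H x"
    by simp
qed

lemma Y_cont: "0 < a \<Longrightarrow> a < b \<Longrightarrow> b < T \<Longrightarrow> continuous_on {0..1} (Y a b)"
proof -
  assume ab: "0 < a" "a < b" "b < T"
  have "continuous_on ({0..1} \<times> cbox a b) (\<lambda>(x, t). U x t)"
    unfolding case_prod_unfold by (rule continuous_on_subset[OF U_cont]) (use ab in auto)
  then have "continuous_on {0..1} (\<lambda>x. integral (cbox a b) (U x))"
    by (rule integral_continuous_on_param)
  then show ?thesis by (simp add: Y_def[abs_def])
qed

text \<open>
  The source is eliminated by comparing two time intervals; this only involves data that are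
  continuous up to the boundary.
\<close>

lemma Y_eliminated:
  assumes ab: "0 < a" "a < b" "b < T" and cd: "0 < c" "c < d" "d < T" and x: "x \<in> {0..1}"
  shows "(d - c) * Y a b x + - (b - a) * Y c d x
    = - green (\<lambda>x. ((d - c) * (V x b - V x a) - (b - a) * (V x d - V x c)) / Gamma (1 - \<alpha>)) x"
proof (rule bessel_problem_unique[OF _ _ _ _ _ _ x])
  show "continuous_on {0..1} (\<lambda>x. (d - c) * Y a b x + - (b - a) * Y c d x)"
    by (intro continuous_intros Y_cont ab cd)
  show "continuous_on {0..1} (\<lambda>x. ((d - c) * (V x b - V x a) - (b - a) * (V x d - V x c)) / Gamma (1 - \<alpha>))"
    using ab cd Gamma_pos by (intro continuous_intros V_cont) auto
  show "(d - c) * Y a b 1 + - (b - a) * Y c d 1 = 0"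
  proof -
    have "Y a b 1 = integral {a..b} (\<lambda>_. 0)" if "0 < a" "b < T" for a b
      unfolding Y_def by (rule integral_cong) (use that in \<open>auto intro: U_1\<close>)
    then show ?thesis using ab cd by simp
  qed
  fix x :: real assume x: "x \<in> {0<..<1}"
  show "((\<lambda>x. (d - c) * Y a b x + - (b - a) * Y c d x) has_real_derivative
      (d - c) * integral {a..b} (dx U x) + - (b - a) * integral {c..d} (dx U x)) (at x)"
    by (intro DERIV_add DERIV_cmult Y_derivs ab cd x)
  show "((\<lambda>x. (d - c) * integral {a..b} (dx U x) + - (b - a) * integral {c..d} (dx U x)) has_real_derivative
      (d - c) * integral {a..b} (dx (dx U) x) + - (b - a) * integral {c..d} (dx (dx U) x)) (at x)"
    by (intro DERIV_add DERIV_cmult Y_derivs ab cd x)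
  have "(d - c) * integral {a..b} (dx (dx U) x) + - (b - a) * integral {c..d} (dx (dx U) x)
      + ((d - c) * integral {a..b} (dx U x) + - (b - a) * integral {c..d} (dx U x)) / x
      = (d - c) * (integral {a..b} (dx (dx U) x) + integral {a..b} (dx U x) / x)
      - (b - a) * (integral {c..d} (dx (dx U) x) + integral {c..d} (dx U x) / x)"
    by (simp add: algebra_simps add_divide_distrib diff_divide_distrib)
  also have "\<dots> = ((d - c) * (V x b - V x a) - (b - a) * (V x d - V x c)) / Gamma (1 - \<alpha>)"
    unfolding Y_derivs(3)[OF ab x] Y_derivs(3)[OF cd x] by (simp add: algebra_simps diff_divide_distrib add_divide_distrib)
  finally show "(d - c) * integral {a..b} (dx (dx U) x) + - (b - a) * integral {c..d} (dx (dx U) x)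
      + ((d - c) * integral {a..b} (dx U x) + - (b - a) * integral {c..d} (dx U x)) / x
      = ((d - c) * (V x b - V x a) - (b - a) * (V x d - V x c)) / Gamma (1 - \<alpha>)" .
qed

end


section \<open>Projection on a single mode\<close>

context homogeneous_problem
begin

definition u :: "nat \<Rightarrow> real \<Rightarrow> real" where "u k t = wip (\<lambda>x. U x t) (\<phi> k)"

lemma weighted_U_cont:
  "continuous_on ({0..1} \<times> {0..T}) (\<lambda>z. fst z * U (fst z) (snd z) * \<phi> k (fst z))"
  by (intro continuous_intros U_cont continuous_on_compose2[OF continuous_on_\<phi>[of UNIV]]) auto

lemma u_cont: "continuous_on {0..T} (u k)"
proof -
  have "continuous_on ({0..T} \<times> cbox 0 1) (\<lambda>(t, x). x * U x t * \<phi> k x)"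
  proof -
    have "continuous_on ({0..T} \<times> cbox 0 1) (\<lambda>z. fst (snd z, fst z)
        * U (fst (snd z, fst z)) (snd (snd z, fst z)) * \<phi> k (fst (snd z, fst z)))"
      by (rule continuous_on_compose2[OF weighted_U_cont]) (auto intro!: continuous_intros)
    then show ?thesis by (simp add: case_prod_unfold)
  qed
  then have "continuous_on {0..T} (\<lambda>t. integral (cbox 0 1) (\<lambda>x. x * U x t * \<phi> k x))"
    by (rule integral_continuous_on_param)
  then show ?thesis by (simp add: u_def[abs_def] wip_def)
qed

definition v :: "nat \<Rightarrow> real \<Rightarrow> real" where
  "v k t = (LBINT s:{0<..<t}. u k s * (t - s) powr (- \<alpha>))"

lemma V_proj:
  assumes t: "0 < t" "t \<le> T"
  shows "wip (\<lambda>x. V x t) (\<phi> k) = v k t"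
proof -
  have "x * V x t * \<phi> k x = (LBINT s:{0<..<t}. (x * U x s * \<phi> k x) * (t - s) powr (- \<alpha>))" for x
  proof -
    have "x * V x t * \<phi> k x = (x * \<phi> k x) * (LBINT s:{0<..<t}. U x s * (t - s) powr (- \<alpha>))"
      by (simp add: V_def)
    also have "\<dots> = (LBINT s:{0<..<t}. (x * \<phi> k x) * (U x s * (t - s) powr (- \<alpha>)))"
      by (rule set_integral_mult_right[symmetric])
    finally show ?thesis by (simp add: mult_ac)
  qed
  then show ?thesis
    unfolding wip_def v_def u_def using t
    by (simp only:) (rule kernel_integral_swap[OF weighted_U_cont[simplified] kernel(1)]; simp)
qed

lemma Y_proj:
  assumes ab: "0 < a" "a < b" "b < T"
  shows "wip (Y a b) (\<phi> k) = integral {a..b} (u k)"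
proof -
  have "wip (Y a b) (\<phi> k) = integral {0..1} (\<lambda>x. integral {a..b} (\<lambda>t. x * U x t * \<phi> k x))"
    unfolding wip_def Y_def by (simp add: mult_ac)
  also have "\<dots> = integral {a..b} (\<lambda>t. integral {0..1} (\<lambda>x. x * U x t * \<phi> k x))"
  proof -
    have "continuous_on (cbox (0, a) (1, b)) (\<lambda>(x, t). x * U x t * \<phi> k x)"
      unfolding case_prod_unfold cbox_Pair_eq
      by (rule continuous_on_subset[OF weighted_U_cont]) (use ab in auto)
    from integral_swap_continuous[OF this] show ?thesis by simp
  qed
  finally show ?thesis by (simp add: u_def[abs_def] wip_def)
qed

text \<open>Gamma (1 - \<alpha>) times the left side I^(1-\<alpha>) u + L^2 I^1 u of the projected
  equation.\<close>

definition \<Psi> :: "nat \<Rightarrow> real \<Rightarrow> real" where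
  "\<Psi> k t = v k t + Gamma (1 - \<alpha>) * (L k)\<^sup>2 * integral {0..t} (u k)"

lemma integral_u_diff:
  assumes "0 \<le> a" "a \<le> b" "b \<le> T"
  shows "integral {a..b} (u k) = integral {0..b} (u k) - integral {0..a} (u k)"
proof -
  have "u k integrable_on {0..b}"
    using assms by (intro integrable_continuous_real continuous_on_subset[OF u_cont]) auto
  then have "integral {0..a} (u k) + integral {a..b} (u k) = integral {0..b} (u k)"
    using assms by (intro Henstock_Kurzweil_Integration.integral_combine) auto
  then show ?thesis by simp
qed

text \<open>Projecting \<open>Y_eliminated\<close> on a mode turns \<open>green\<close> into
  division by (L k)^2. What results says that increments of \<Psi> are proportional to the length of
  the time interval.\<close>

lemma \<Psi>_increment:
  assumes ab: "0 < a" "a < b" "b < T" and cd: "0 < c" "c < d" "d < T"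
  shows "(d - c) * (\<Psi> k b - \<Psi> k a) = (b - a) * (\<Psi> k d - \<Psi> k c)"
proof -
  let ?G = "Gamma (1 - \<alpha>)"
  let ?R = "\<lambda>x. ((d - c) * (V x b - V x a) - (b - a) * (V x d - V x c)) / ?G"
  have cV: "continuous_on {0..1} (\<lambda>x. V x t)" if "t \<in> {a, b, c, d}" for t
    using that ab cd by (intro V_cont) auto
  have cR: "continuous_on {0..1} ?R"
    using Gamma_pos by (intro continuous_intros cV) auto
  have L: "L k \<noteq> 0" using L_pos[of k] by simp
  have "wip (\<lambda>x. (d - c) * Y a b x + - (b - a) * Y c d x) (\<phi> k) = wip (\<lambda>x. (- 1) * green ?R x + 0 * green ?R x) (\<phi> k)"
    by (rule wip_cong) (use Y_eliminated[OF ab cd] in auto)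
  also have "\<dots> = - wip (green ?R) (\<phi> k)"
    by (subst wip_lincomb_left) (auto intro: continuous_on_green cR continuous_on_\<phi>)
  also have "wip (green ?R) (\<phi> k) = wip ?R (\<phi> k) / (L k)\<^sup>2"
    unfolding \<phi>_abs by (rule wip_green_bessel_mode[OF L L_zero cR])
  also have "wip ?R (\<phi> k) = ((d - c) * (v k b - v k a) - (b - a) * (v k d - v k c)) / ?G"
  proof -
    have 1: "wip (\<lambda>x. 1 * V x t + (- 1) * V x s) (\<phi> k) = v k t - v k s"
      if "t \<in> {a, b, c, d}" "s \<in> {a, b, c, d}" for s t
    proof -
      have "0 < t" "t \<le> T" "0 < s" "s \<le> T" using that ab cd by auto
      then show ?thesis
        using that by (subst wip_lincomb_left) (auto intro: cV continuous_on_\<phi> simp: V_proj)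
    qed
    have c1: "continuous_on {0..1} (\<lambda>x. 1 * V x t + (- 1) * V x s)"
      if "t \<in> {a, b, c, d}" "s \<in> {a, b, c, d}" for s t
      by (intro continuous_intros cV that)
    have "wip ?R (\<phi> k) = wip (\<lambda>x. (d - c) / ?G * (1 * V x b + (- 1) * V x a)
        + (- (b - a) / ?G) * (1 * V x d + (- 1) * V x c)) (\<phi> k)"
      using Gamma_pos by (intro wip_cong) (auto simp: field_simps)
    also have "\<dots> = (d - c) / ?G * wip (\<lambda>x. 1 * V x b + (- 1) * V x a) (\<phi> k)
        + (- (b - a) / ?G) * wip (\<lambda>x. 1 * V x d + (- 1) * V x c) (\<phi> k)"
      by (rule wip_lincomb_left) (intro c1 continuous_on_\<phi>; simp)+
    also have "\<dots> = (d - c) / ?G * (v k b - v k a) + (- (b - a) / ?G) * (v k d - v k c)"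
      using 1[of b a] 1[of d c] by simp
    also have "\<dots> = ((d - c) * (v k b - v k a) - (b - a) * (v k d - v k c)) / ?G"
      using Gamma_pos by (simp add: field_simps)
    finally show ?thesis .
  qed
  also have "wip (\<lambda>x. (d - c) * Y a b x + - (b - a) * Y c d x) (\<phi> k)
      = (d - c) * integral {a..b} (u k) + - (b - a) * integral {c..d} (u k)"
    using Y_proj[OF ab] Y_proj[OF cd]
    by (subst wip_lincomb_left[OF Y_cont[OF ab] Y_cont[OF cd] continuous_on_\<phi>]) simp
  finally have "?G * (L k)\<^sup>2 * ((d - c) * integral {a..b} (u k) - (b - a) * integral {c..d} (u k))
      = - ((d - c) * (v k b - v k a) - (b - a) * (v k d - v k c))"
    using Gamma_pos L by (simp add: field_simps)
  then show ?thesis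
    unfolding \<Psi>_def using integral_u_diff[of a b k] integral_u_diff[of c d k] ab cd
    by (simp add: algebra_simps)
qed

lemma u_bounded:
  obtains M where "0 \<le> M" "\<And>t. t \<in> {0..T} \<Longrightarrow> \<bar>u k t\<bar> \<le> M"
proof -
  have "bounded (u k ` {0..T})"
    by (intro compact_imp_bounded compact_continuous_image u_cont) simp
  then obtain M where M: "\<forall>x\<in>u k ` {0..T}. norm x \<le> M" unfolding bounded_iff by blast
  then have "\<bar>u k 0\<bar> \<le> M" using T by simp
  then have "0 \<le> M" by (rule order_trans[OF abs_ge_zero])
  then show ?thesis using M by (intro that) auto
qed

lemma kernel_mult_integrable:
  assumes w: "continuous_on {0..t} w" and t: "0 < t"
  shows "set_integrable lborel {0<..<t} (\<lambda>s. w s * (t - s) powr (- \<alpha>))"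
proof -
  have "continuous_on ({0..1} \<times> {0..t}) (\<lambda>z. w (snd z))"
    by (intro continuous_on_compose2[OF w] continuous_intros) auto
  from kernel_integrable[OF this kernel(1)[OF t], where x = 0] t show ?thesis by simp
qed

lemma \<Psi>_bound:
  assumes M: "\<And>t. t \<in> {0..T} \<Longrightarrow> \<bar>u k t\<bar> \<le> M" and t: "0 < t" "t < T"
  shows "\<bar>\<Psi> k t\<bar> \<le> M * (t powr (1 - \<alpha>) / (1 - \<alpha>)) + Gamma (1 - \<alpha>) * (L k)\<^sup>2 * (M * t)"
proof -
  have cu: "continuous_on {0..t} (u k)" using t by (intro continuous_on_subset[OF u_cont]) auto
  have "\<bar>v k t\<bar> \<le> (LBINT s:{0<..<t}. M * (t - s) powr (- \<alpha>))"
  proof -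
    note i = kernel_mult_integrable[OF cu t(1)]
    have "\<bar>v k t\<bar> \<le> (LBINT s:{0<..<t}. \<bar>u k s * (t - s) powr (- \<alpha>)\<bar>)"
      using set_integral_norm_bound[OF i] by (simp add: v_def)
    also have "\<dots> \<le> (LBINT s:{0<..<t}. M * (t - s) powr (- \<alpha>))"
    proof (rule set_integral_mono)
      show "set_integrable lborel {0<..<t} (\<lambda>s. \<bar>u k s * (t - s) powr (- \<alpha>)\<bar>)"
        using i by (rule set_integrable_abs)
      show "set_integrable lborel {0<..<t} (\<lambda>s. M * (t - s) powr (- \<alpha>))"
        using kernel(1)[OF t(1)] by (intro set_integrable_mult_right)
      show "\<bar>u k s * (t - s) powr (- \<alpha>)\<bar> \<le> M * (t - s) powr (- \<alpha>)" if "s \<in> {0<..<t}" for s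
        unfolding abs_mult using that t M[of s] by (simp add: mult_right_mono)
    qed
    finally show ?thesis .
  qed
  also have "\<dots> = M * (t powr (1 - \<alpha>) / (1 - \<alpha>))"
    using kernel(2)[OF t(1)] by simp
  finally have 1: "\<bar>v k t\<bar> \<le> M * (t powr (1 - \<alpha>) / (1 - \<alpha>))" .
  have "norm (integral {0..t} (u k)) \<le> integral {0..t} (\<lambda>_. M)"
    using t M by (intro integral_norm_bound_integral integrable_continuous_real cu) auto
  then have "\<bar>integral {0..t} (u k)\<bar> \<le> M * t" using t by (simp add: mult.commute)
  then have "Gamma (1 - \<alpha>) * (L k)\<^sup>2 * \<bar>integral {0..t} (u k)\<bar> \<le> Gamma (1 - \<alpha>) * (L k)\<^sup>2 * (M * t)"
    using Gamma_pos by (intro mult_left_mono) auto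
  moreover have "\<bar>\<Psi> k t\<bar> \<le> \<bar>v k t\<bar> + Gamma (1 - \<alpha>) * (L k)\<^sup>2 * \<bar>integral {0..t} (u k)\<bar>"
  proof -
    have "\<bar>Gamma (1 - \<alpha>) * (L k)\<^sup>2 * integral {0..t} (u k)\<bar>
        = Gamma (1 - \<alpha>) * (L k)\<^sup>2 * \<bar>integral {0..t} (u k)\<bar>"
      using Gamma_pos by (simp add: abs_mult)
    then show ?thesis
      using abs_triangle_ineq[of "v k t" "Gamma (1 - \<alpha>) * (L k)\<^sup>2 * integral {0..t} (u k)"]
      unfolding \<Psi>_def by linarith
  qed
  ultimately show ?thesis using 1 by linarith
qed

text \<open>Proportional increments make \<Psi> affine on (0,T), and its limit 0 at the left end
  makes it linear. The slope \<kappa> takes the place of the projection of the unknown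
  source.\<close>

lemma \<Psi>_linear:
  obtains \<kappa> where "\<And>t. 0 < t \<Longrightarrow> t < T \<Longrightarrow> \<Psi> k t = \<kappa> * t"
proof -
  obtain M where M: "0 \<le> M" "\<And>t. t \<in> {0..T} \<Longrightarrow> \<bar>u k t\<bar> \<le> M"
    using u_bounded by metis
  \<comment> \<open>A fixed reference interval inside (0,T), from which the slope is read.\<close>
  define c d where "c = T / 3" and "d = 2 * T / 3"
  have cd: "0 < c" "c < d" "d < T" using T by (simp_all add: c_def d_def)
  define \<kappa> where "\<kappa> = (\<Psi> k d - \<Psi> k c) / (d - c)"
  have inc: "\<Psi> k b - \<Psi> k a = \<kappa> * (b - a)" if "0 < a" "a < b" "b < T" for a b
    using \<Psi>_increment[OF that cd] cd by (simp add: \<kappa>_def field_simps)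
  let ?b = "\<lambda>t. M * (t powr (1 - \<alpha>) / (1 - \<alpha>)) + Gamma (1 - \<alpha>) * (L k)\<^sup>2 * (M * t)"
  have lim0: "(\<Psi> k \<longlongrightarrow> 0) (at_right 0)"
  proof (rule Lim_null_comparison)
    show "\<forall>\<^sub>F t in at_right 0. norm (\<Psi> k t) \<le> ?b t"
      using eventually_at_right_real[OF T] by (rule eventually_mono) (use \<Psi>_bound[OF M(2)] in auto)
    have "((\<lambda>t. t powr (1 - \<alpha>)) \<longlongrightarrow> 0 powr (1 - \<alpha>)) (at_right 0)"
      using \<alpha> by (intro tendsto_powr2 tendsto_intros) (auto simp: eventually_at_filter)
    then have "(?b \<longlongrightarrow> M * (0 / (1 - \<alpha>)) + Gamma (1 - \<alpha>) * (L k)\<^sup>2 * (M * 0)) (at_right 0)"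
      using \<alpha> by (intro tendsto_intros) auto
    then show "(?b \<longlongrightarrow> 0) (at_right 0)" by simp
  qed
  have "\<Psi> k t = \<kappa> * t" if t: "0 < t" "t < T" for t
  proof -
    have "((\<lambda>a. \<Psi> k a + \<kappa> * (t - a)) \<longlongrightarrow> 0 + \<kappa> * (t - 0)) (at_right 0)"
      by (intro tendsto_intros lim0)
    moreover have "\<forall>\<^sub>F a in at_right 0. \<Psi> k a + \<kappa> * (t - a) = \<Psi> k t"
      using eventually_at_right_real[OF t(1)] by (rule eventually_mono) (use inc[of _ t] t in force)
    then have "((\<lambda>a. \<Psi> k a + \<kappa> * (t - a)) \<longlongrightarrow> \<Psi> k t) (at_right 0)"
      by (rule tendsto_eventually)
    ultimately have "\<Psi> k t = 0 + \<kappa> * (t - 0)"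
      by (intro tendsto_unique[of "at_right (0::real)"]) auto
    then show ?thesis by simp
  qed
  then show ?thesis by (rule that)
qed

text \<open>Integrating D^\<alpha> y = - c y shows that 1 - y solves the same linear equation as the
  projections, with an explicit slope.\<close>

lemma ml_mode_integrated:
  assumes t: "0 < t"
  shows "(LBINT s:{0<..<t}. (1 - ml_mode \<alpha> c s) * (t - s) powr (- \<alpha>))
      + Gamma (1 - \<alpha>) * c * integral {0..t} (\<lambda>s. 1 - ml_mode \<alpha> c s) = Gamma (1 - \<alpha>) * c * t"
proof -
  let ?y = "ml_mode \<alpha> c"
  \<comment> \<open>The horizon t + 1 puts t strictly inside, as \<open>caputo_integral\<close>
    requires.\<close>
  have cd: "caputo_differentiable \<alpha> (t + 1) ?y"
    by (rule caputo_differentiableI[where \<phi>' = "ml_mode' \<alpha> c"])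
      (auto intro: ml_mode_deriv[OF \<alpha>] ml_mode'_caputo[OF \<alpha>])
  have cy: "continuous_on A ?y" if "A \<subseteq> {0..}" for A
    by (rule continuous_on_subset[OF continuous_on_ml_mode[OF \<alpha>] that])
  have cap: "caputo \<alpha> ?y s = - c * ?y s" if "0 < s" for s
  proof -
    have "caputo \<alpha> ?y s = 1 / Gamma (1 - \<alpha>) * (LBINT r:{0<..<s}. ml_mode' \<alpha> c r * (s - r) powr (- \<alpha>))"
      by (rule caputo_cong) (auto intro: ml_mode_deriv[OF \<alpha>])
    then show ?thesis using Gamma_pos by (simp add: ml_mode'_caputo(2)[OF \<alpha> that])
  qed
  have yi: "set_integrable lborel {0<..<t} ?y"
    by (rule set_integrable_subset[OF borel_integrable_atLeastAtMost'[of 0 t]]) (auto intro: cy)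
  have "(LBINT s:{0<..<t}. caputo \<alpha> ?y s) = (LBINT s:{0<..<t}. - c * ?y s)"
    by (rule set_lebesgue_integral_cong) (auto simp: cap)
  also have "\<dots> = - c * (LBINT s:{0<..<t}. ?y s)"
    by (rule set_integral_mult_right)
  also have "\<dots> = - c * integral {0..t} ?y"
    using set_borel_integral_eq_integral(2)[OF yi] by (simp add: integral_open_interval_real)
  finally have "- c * integral {0..t} ?y
      = 1 / Gamma (1 - \<alpha>) * (LBINT s:{0<..<t}. (?y s - 1) * (t - s) powr (- \<alpha>))"
    using caputo_integral(2)[OF \<alpha> cd, of t] t by (simp add: cy ml_mode_0[OF \<alpha>])
  then have "(LBINT s:{0<..<t}. (?y s - 1) * (t - s) powr (- \<alpha>)) = - Gamma (1 - \<alpha>) * c * integral {0..t} ?y"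
    using Gamma_pos by (simp add: field_simps)
  moreover have "(LBINT s:{0<..<t}. (1 - ?y s) * (t - s) powr (- \<alpha>))
      = - (LBINT s:{0<..<t}. (?y s - 1) * (t - s) powr (- \<alpha>))"
    unfolding set_lebesgue_integral_def
    by (subst Bochner_Integration.integral_minus[symmetric]) (simp add: algebra_simps)
  moreover have "integral {0..t} (\<lambda>s. 1 - ?y s) = t - integral {0..t} ?y"
    using t by (subst Henstock_Kurzweil_Integration.integral_diff)
      (auto intro!: integrable_continuous_real cy)
  ultimately have "(LBINT s:{0<..<t}. (1 - ?y s) * (t - s) powr (- \<alpha>))
        = Gamma (1 - \<alpha>) * c * integral {0..t} ?y"
      and "integral {0..t} (\<lambda>s. 1 - ?y s) = t - integral {0..t} ?y"
    by simp_all
  then show ?thesis by (simp only: right_diff_distrib)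
qed

text \<open>For the primitive W of D the equation is Gamma (1 - \<alpha>) D^\<alpha> W + c W = 0
  with W(0) = 0. Comparison applied to W and to - W gives W = 0, and D is its derivative.\<close>

lemma volterra_zero:
  assumes D: "continuous_on {0..T} D" and c: "0 < c"
    and eq: "\<And>t. 0 < t \<Longrightarrow> t < T \<Longrightarrow>
      (LBINT s:{0<..<t}. D s * (t - s) powr (- \<alpha>)) + c * integral {0..t} D = 0"
    and t: "t \<in> {0..T}"
  shows "D t = 0"
proof -
  define W where "W t = integral {0..t} D" for t
  have W_within: "(W has_real_derivative D s) (at s within {0..T})" if "s \<in> {0..T}" for s
    unfolding W_def by (rule integral_has_real_derivative[OF D that])
  then have W_deriv: "(W has_real_derivative D s) (at s)" if "0 < s" "s < T" for s
    using that by (metis at_within_Icc_at atLeastAtMost_iff less_imp_le)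
  have cW: "continuous_on {0..b} W" if "b < T" for b
    using that by (intro continuous_on_subset[OF DERIV_continuous_on[OF W_within]]) auto
  have int: "set_integrable lborel {0<..<t} (\<lambda>s. D s * (t - s) powr (- \<alpha>))" if "0 < t" "t < T" for t
    using that by (intro kernel_mult_integrable continuous_on_subset[OF D]) auto
  have W0: "W b = 0" if b: "0 \<le> b" "b < T" for b
  proof (rule antisym)
    show "W b \<le> 0"
    proof (rule caputo_comparison[OF \<alpha> cW[OF b(2)], where \<phi>' = D])
      fix t assume t: "0 < t" "t \<le> b" "0 < W t"
      then have "0 < c * W t" using c by simp
      then show "(LBINT s:{0<..<t}. D s * (t - s) powr (- \<alpha>)) \<le> 0"
        using eq[of t] t b by (simp add: W_def)
    qed (use b in \<open>auto intro: W_deriv int simp: W_def\<close>)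
    have "- W b \<le> 0"
    proof (rule caputo_comparison[OF \<alpha>, where \<phi> = "\<lambda>t. - W t" and b = b and \<phi>' = "\<lambda>s. - D s"])
      show "continuous_on {0..b} (\<lambda>t. - W t)" by (intro continuous_intros cW b)
      show "((\<lambda>t. - W t) has_real_derivative - D s) (at s)" if "0 < s" "s \<le> b" for s
        using that b by (intro DERIV_minus W_deriv) auto
      show "set_integrable lborel {0<..<t} (\<lambda>s. - D s * (t - s) powr (- \<alpha>))" if "0 < t" "t \<le> b" for t
        using int[of t] that b by (simp add: set_integrable_def)
      fix t assume t: "0 < t" "t \<le> b" "0 < - W t"
      then have "c * W t < 0" using c by (simp add: mult_pos_neg)
      then show "(LBINT s:{0<..<t}. - D s * (t - s) powr (- \<alpha>)) \<le> 0"
        using eq[of t] t b by (simp add: W_def set_lebesgue_integral_def)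
    qed (use b in \<open>auto simp: W_def\<close>)
    then show "0 \<le> W b" by simp
  qed
  have "D s = 0" if s: "s \<in> {0<..<T}" for s
  proof -
    have "(W has_real_derivative 0) (at s)"
      by (rule has_field_derivative_transform_within_open[where f = "\<lambda>_. 0" and S = "{0<..<T}"])
        (use s W0 in auto)
    then show ?thesis using W_deriv[of s] s DERIV_unique by fastforce
  qed
  then show ?thesis
    using continuous_constant_on_closure[of "{0<..<T}" D 0 t] D t T by simp
qed

text \<open>Subtracting a multiple b of 1 - y removes the linear right side, so u = b (1 - y). The
  condition at time T then forces b = 0, because y(T) < 1.\<close>

lemma u_eq_0:
  assumes t: "t \<in> {0..T}"
  shows "u k t = 0"
proof -
  let ?G = "Gamma (1 - \<alpha>)"
  let ?y = "ml_mode \<alpha> ((L k)\<^sup>2)"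
  have Lk: "0 < (L k)\<^sup>2" using L_pos[of k] by simp
  obtain \<kappa> where \<kappa>: "\<And>t. 0 < t \<Longrightarrow> t < T \<Longrightarrow> \<Psi> k t = \<kappa> * t"
    using \<Psi>_linear by metis
  \<comment> \<open>Matches the slope \<kappa> with the slope Gamma (1 - \<alpha>) (L k)^2 from
    \<open>ml_mode_integrated\<close>.\<close>
  define b where "b = \<kappa> / (?G * (L k)\<^sup>2)"
  define D where "D t = u k t - b * (1 - ?y t)" for t
  have cy: "continuous_on A ?y" if "A \<subseteq> {0..}" for A
    by (rule continuous_on_subset[OF continuous_on_ml_mode[OF \<alpha>] that])
  have cD: "continuous_on {0..T} D"
    unfolding D_def by (intro continuous_intros u_cont cy) auto
  have D0: "D t = 0" if "t \<in> {0..T}" for t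
  proof (rule volterra_zero[OF cD _ _ that, where c = "?G * (L k)\<^sup>2"])
    show "0 < ?G * (L k)\<^sup>2" using Gamma_pos Lk by simp
    fix t assume t: "0 < t" "t < T"
    have cu: "continuous_on {0..t} (u k)" using t by (intro continuous_on_subset[OF u_cont]) auto
    have c1: "continuous_on {0..t} (\<lambda>s. 1 - ?y s)" by (intro continuous_intros cy) auto
    have "(LBINT s:{0<..<t}. D s * (t - s) powr (- \<alpha>))
        = (LBINT s:{0<..<t}. u k s * (t - s) powr (- \<alpha>) - b * ((1 - ?y s) * (t - s) powr (- \<alpha>)))"
      by (simp add: D_def left_diff_distrib mult.assoc)
    also have "\<dots> = v k t - b * (LBINT s:{0<..<t}. (1 - ?y s) * (t - s) powr (- \<alpha>))"
      using kernel_mult_integrable[OF cu t(1)] kernel_mult_integrable[OF c1 t(1)]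
      by (subst set_integral_diff(2)) (auto simp: v_def intro!: set_integrable_mult_right)
    finally have 1: "(LBINT s:{0<..<t}. D s * (t - s) powr (- \<alpha>))
        = v k t - b * (LBINT s:{0<..<t}. (1 - ?y s) * (t - s) powr (- \<alpha>))" .
    have "integral {0..t} D = integral {0..t} (u k) - integral {0..t} (\<lambda>s. b * (1 - ?y s))"
      unfolding D_def
      by (intro Henstock_Kurzweil_Integration.integral_diff integrable_continuous_real cu continuous_intros cy) auto
    then have 2: "integral {0..t} D = integral {0..t} (u k) - b * integral {0..t} (\<lambda>s. 1 - ?y s)"
      by (simp only: integral_mult_right)
    have "(LBINT s:{0<..<t}. D s * (t - s) powr (- \<alpha>)) + ?G * (L k)\<^sup>2 * integral {0..t} D
        = \<Psi> k t - b * ((LBINT s:{0<..<t}. (1 - ?y s) * (t - s) powr (- \<alpha>))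
          + ?G * (L k)\<^sup>2 * integral {0..t} (\<lambda>s. 1 - ?y s))"
      unfolding 1 2 \<Psi>_def by (simp only: algebra_simps)
    also have "\<dots> = \<kappa> * t - b * (?G * (L k)\<^sup>2 * t)"
      unfolding ml_mode_integrated[OF t(1)] \<kappa>[OF t] ..
    also have "\<dots> = 0" using Gamma_pos Lk by (simp add: b_def)
    finally show "(LBINT s:{0<..<t}. D s * (t - s) powr (- \<alpha>)) + ?G * (L k)\<^sup>2 * integral {0..t} D = 0" .
  qed
  have "u k T = 0"
  proof -
    have "U x T = 0" if "x \<in> {0..1}" for x
      using continuous_constant_on_closure[of "{0<..<1}" "\<lambda>x. U x T" 0 x] U_slice_x[of T] U_T that T
      by simp
    then have "u k T = wip (\<lambda>x. 0 * \<phi> k x + 0 * \<phi> k x) (\<phi> k)"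
      unfolding u_def by (intro wip_cong) auto
    also have "\<dots> = 0" by (subst wip_lincomb_left) (auto intro: continuous_on_\<phi>)
    finally show ?thesis .
  qed
  then have "b * (1 - ?y T) = 0" using D0[of T] T by (simp add: D_def)
  then have "b = 0" using ml_mode_less_1[OF \<alpha> Lk T] by simp
  then show ?thesis using D0[OF t] by (simp add: D_def)
qed

lemma U_eq_0:
  assumes "x \<in> {0..1}" "t \<in> {0..T}"
  shows "U x t = 0"
  by (rule \<phi>_complete[where v = "\<lambda>x. U x t", OF U_slice_x[OF assms(2)] _ assms(1)])
    (use u_eq_0[OF assms(2)] in \<open>simp add: u_def\<close>)

lemma H_eq_0:
  assumes x: "x \<in> {0<..<1}"
  shows "H x = 0"
proof -
  \<comment> \<open>Any interior time would do: with U = 0 every term of the equation except H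
    vanishes there.\<close>
  have t: "T / 2 \<in> {0<..<T}" using T by simp
  have dx0: "dx U z (T / 2) = 0" if z: "z \<in> {0<..<1}" for z
  proof -
    have "((\<lambda>y. U y (T / 2)) has_real_derivative 0) (at z)"
      by (rule has_field_derivative_transform_within_open[where f = "\<lambda>_. 0" and S = "{0<..<1}"])
        (use z t in \<open>auto simp: U_eq_0\<close>)
    then show ?thesis unfolding dx_def by (rule DERIV_imp_deriv)
  qed
  have "((\<lambda>y. dx U y (T / 2)) has_real_derivative 0) (at x)"
    by (rule has_field_derivative_transform_within_open[where f = "\<lambda>_. 0" and S = "{0<..<1}"])
      (use x in \<open>auto simp: dx0\<close>)
  then have "dx (dx U) x (T / 2) = 0" unfolding dx_def[of "dx U"] by (rule DERIV_imp_deriv)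
  moreover have "caputo \<alpha> (U x) (T / 2) = 0"
  proof -
    have "caputo \<alpha> (U x) (T / 2)
        = 1 / Gamma (1 - \<alpha>) * (LBINT s:{0<..<T / 2}. 0 * (T / 2 - s) powr (- \<alpha>))"
    proof (rule caputo_cong)
      fix s assume s: "s \<in> {0<..<T / 2}"
      show "(U x has_real_derivative 0) (at s)"
        by (rule has_field_derivative_transform_within_open[where f = "\<lambda>_. 0" and S = "{0<..<T}"])
          (use x s in \<open>auto simp: U_eq_0\<close>)
    qed
    then show ?thesis by simp
  qed
  ultimately show ?thesis using U_equation[OF x t] dx0[OF x] by simp
qed

end

section \<open>From the homogeneous problem to the given data\<close>

lemma inverse_problem_solution_diff:
  assumes 1: "inverse_problem_solution \<alpha> T g f u1 h1" and 2: "inverse_problem_solution \<alpha> T g f u2 h2"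
  shows "inverse_problem_solution \<alpha> T (\<lambda>_. 0) (\<lambda>_. 0) (\<lambda>x t. u1 x t - u2 x t) (\<lambda>x. h1 x - h2 x)"
proof -
  let ?u = "\<lambda>x t. u1 x t - u2 x t"
  have dux: "((\<lambda>y. ?u y t) has_real_derivative dx u1 x t - dx u2 x t) (at x)"
    if "x \<in> {0<..<1}" "t \<in> {0<..<T}" for x t
    using 1 2 that unfolding inverse_problem_solution_def dx_def
    by (intro DERIV_diff) (auto simp: DERIV_deriv_iff_field_differentiable)
  have dxu: "dx ?u x t = dx u1 x t - dx u2 x t" if "x \<in> {0<..<1}" "t \<in> {0<..<T}" for x t
    unfolding dx_def[of ?u] by (rule DERIV_imp_deriv[OF dux[OF that]])
  have duxx: "((\<lambda>y. dx ?u y t) has_real_derivative dx (dx u1) x t - dx (dx u2) x t) (at x)"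
    if x: "x \<in> {0<..<1}" and t: "t \<in> {0<..<T}" for x t
  proof -
    have "((\<lambda>y. dx u1 y t - dx u2 y t) has_real_derivative dx (dx u1) x t - dx (dx u2) x t) (at x)"
      using 1 2 x t unfolding inverse_problem_solution_def dx_def[of "dx _"]
      by (intro DERIV_diff) (auto simp: DERIV_deriv_iff_field_differentiable)
    then show ?thesis
      by (rule has_field_derivative_transform_within_open[where S = "{0<..<1}"])
        (use x t in \<open>auto simp: dxu\<close>)
  qed
  have dxxu: "dx (dx ?u) x t = dx (dx u1) x t - dx (dx u2) x t" if "x \<in> {0<..<1}" "t \<in> {0<..<T}" for x t
    unfolding dx_def[of "dx ?u"] by (rule DERIV_imp_deriv[OF duxx[OF that]])
  have cd: "caputo_differentiable \<alpha> T (u1 x)" "caputo_differentiable \<alpha> T (u2 x)" if "x \<in> {0<..<1}" for x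
    using 1 2 that unfolding inverse_problem_solution_def by auto
  have dut: "(?u x has_real_derivative deriv (u1 x) t - deriv (u2 x) t) (at t)"
    if "x \<in> {0<..<1}" "t \<in> {0<..<T}" for x t
    using cd[OF that(1)] that(2) unfolding caputo_differentiable_iff
    by (intro DERIV_diff) (auto simp: DERIV_deriv_iff_field_differentiable)
  have ki: "set_integrable lborel {0<..<t} (\<lambda>s. deriv (u1 x) s * (t - s) powr (- \<alpha>))"
    "set_integrable lborel {0<..<t} (\<lambda>s. deriv (u2 x) s * (t - s) powr (- \<alpha>))"
    if "x \<in> {0<..<1}" "t \<in> {0<..<T}" for x t
    using cd[OF that(1)] that(2) by (auto simp: caputo_differentiable_iff)
  have cap: "caputo \<alpha> (?u x) t = caputo \<alpha> (u1 x) t - caputo \<alpha> (u2 x) t"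
    if x: "x \<in> {0<..<1}" and t: "t \<in> {0<..<T}" for x t
  proof -
    have "caputo \<alpha> (?u x) t = 1 / Gamma (1 - \<alpha>) *
        (LBINT s:{0<..<t}. (deriv (u1 x) s - deriv (u2 x) s) * (t - s) powr (- \<alpha>))"
      by (rule caputo_cong) (use x t dut in auto)
    then show ?thesis
      unfolding left_diff_distrib set_integral_diff(2)[OF ki[OF x t]] caputo_eq
      by (simp add: right_diff_distrib)
  qed
  show ?thesis
    unfolding inverse_problem_solution_def
  proof (intro conjI ballI)
    show "continuous_on ({0..1} \<times> {0..T}) (\<lambda>(x, t). ?u x t)"
      using 1 2 unfolding inverse_problem_solution_def case_prod_unfold by (intro continuous_on_diff) auto
    show "caputo_differentiable \<alpha> T (?u x)" if "x \<in> {0<..<1}" for x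
      by (rule caputo_differentiableI[where \<phi>' = "\<lambda>t. deriv (u1 x) t - deriv (u2 x) t"])
        (use that dut ki in \<open>auto simp: left_diff_distrib intro!: set_integral_diff\<close>)
    show "(\<lambda>y. ?u y t) field_differentiable at x" "(\<lambda>y. dx ?u y t) field_differentiable at x"
      if "x \<in> {0<..<1}" "t \<in> {0<..<T}" for x t
      using dux[OF that] duxx[OF that] by (auto simp: field_differentiable_def)
    have "continuous_on ({0<..<1} \<times> {0<..<T}) (\<lambda>z. dx u1 (fst z) (snd z) - dx u2 (fst z) (snd z))"
      using 1 2 unfolding inverse_problem_solution_def case_prod_unfold by (intro continuous_on_diff) auto
    then show "continuous_on ({0<..<1} \<times> {0<..<T}) (\<lambda>(x, t). dx ?u x t)"
      unfolding case_prod_unfold by (rule continuous_on_cong[THEN iffD1, OF refl, rotated]) (auto simp: dxu)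
    have "continuous_on ({0<..<1} \<times> {0<..<T}) (\<lambda>z. dx (dx u1) (fst z) (snd z) - dx (dx u2) (fst z) (snd z))"
      using 1 2 unfolding inverse_problem_solution_def case_prod_unfold by (intro continuous_on_diff) auto
    then show "continuous_on ({0<..<1} \<times> {0<..<T}) (\<lambda>(x, t). dx (dx ?u) x t)"
      unfolding case_prod_unfold by (rule continuous_on_cong[THEN iffD1, OF refl, rotated]) (auto simp: dxxu)
    show "continuous_on {0<..<1} (\<lambda>x. h1 x - h2 x)"
      using 1 2 unfolding inverse_problem_solution_def by (intro continuous_on_diff) auto
    show "caputo \<alpha> (?u x) t = dx (dx ?u) x t + 1 / x * dx ?u x t + (h1 x - h2 x)"
      if "x \<in> {0<..<1}" "t \<in> {0<..<T}" for x t
    proof -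
      have "caputo \<alpha> (u1 x) t = dx (dx u1) x t + 1 / x * dx u1 x t + h1 x"
        "caputo \<alpha> (u2 x) t = dx (dx u2) x t + 1 / x * dx u2 x t + h2 x"
        using 1 2 that unfolding inverse_problem_solution_def by blast+
      then show ?thesis unfolding cap[OF that] dxu[OF that] dxxu[OF that] by (simp add: algebra_simps diff_divide_distrib)
    qed
    show "((\<lambda>x. x * dx ?u x t) \<longlongrightarrow> 0) (at_right 0)" if t: "t \<in> {0<..<T}" for t
    proof -
      have "((\<lambda>x. x * dx u1 x t - x * dx u2 x t) \<longlongrightarrow> 0 - 0) (at_right 0)"
        using 1 2 t unfolding inverse_problem_solution_def by (intro tendsto_diff) auto
      moreover have "\<forall>\<^sub>F x in at_right 0. x * dx u1 x t - x * dx u2 x t = x * dx ?u x t"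
        using eventually_at_right_real[OF zero_less_one]
        by (rule eventually_mono) (use t in \<open>auto simp: dxu algebra_simps\<close>)
      ultimately show ?thesis by (simp add: Lim_transform_eventually)
    qed
  qed (use 1 2 in \<open>auto simp: inverse_problem_solution_def\<close>)
qed


text \<open>The source begins with - (g'' + g'/x), where the prose has g''; this is what the
  equation yields for u = g - S. The functions \<open>dg i\<close> and \<open>df i\<close> are the
  successive derivatives, one-sided at the endpoints. The \<open>summable\<close> conjuncts guard
  against the default value of a divergent sum, and the pair is unique on the closed rectangle for u
  and on the open interval for h.\<close>

theorem theorem4p1:
  fixes \<alpha> T :: real and l :: "nat \<Rightarrow> real"
    and g f :: "real \<Rightarrow> real" and dg df :: "nat \<Rightarrow> real \<Rightarrow> real"
  assumes "0 < \<alpha>" "\<alpha> < 1" "0 < T"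
    and "strict_mono_on {1..} l"
    and "l ` {1..} = {x. 0 < x \<and> bessel_J 0 x = 0}"
    and "dg 0 = g" "df 0 = f"
    and "\<And>i x. i < 4 \<Longrightarrow> x \<in> {0..1} \<Longrightarrow>
           (dg i has_real_derivative dg (Suc i) x) (at x within {0..1})"
    and "\<And>i x. i < 4 \<Longrightarrow> x \<in> {0..1} \<Longrightarrow>
           (df i has_real_derivative df (Suc i) x) (at x within {0..1})"
    and "\<And>i. i \<in> {0, 1, 2, 3} \<Longrightarrow> dg i 0 = 0 \<and> df i 0 = 0"
    and "\<And>j. j \<in> {0, 1, 2} \<Longrightarrow> dg j 1 = 0 \<and> df j 1 = 0"
    and "bounded (dg 4 ` {0..1})" "bounded (df 4 ` {0..1})"
  shows "\<exists>u h.
    inverse_problem_solution \<alpha> T g f u h \<and>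
    (\<forall>u' h'. inverse_problem_solution \<alpha> T g f u' h' \<longrightarrow>
       (\<forall>x\<in>{0..1}. \<forall>t\<in>{0..T}. u' x t = u x t) \<and> (\<forall>x\<in>{0<..<1}. h' x = h x)) \<and>
    (\<forall>x\<in>{0..1}. \<forall>t\<in>{0..T}.
       (let S = (\<lambda>k. (1 - mittag_leffler \<alpha> (- (l k)\<^sup>2 * t powr \<alpha>))
                     / (1 - mittag_leffler \<alpha> (- (l k)\<^sup>2 * T powr \<alpha>))
                     * (fourier_bessel_coeff (l k) g - fourier_bessel_coeff (l k) f)
                     * bessel_J 0 (l k * x))
        in summable (\<lambda>k. S (Suc k)) \<and> u x t = g x - (\<Sum>k. S (Suc k)))) \<and>
    (\<forall>x\<in>{0<..<1}.
       (let S = (\<lambda>k. (l k)\<^sup>2 * (fourier_bessel_coeff (l k) g - fourier_bessel_coeff (l k) f)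
                     / (1 - mittag_leffler \<alpha> (- (l k)\<^sup>2 * T powr \<alpha>))
                     * bessel_J 0 (l k * x))
        in summable (\<lambda>k. S (Suc k)) \<and>
           h x = - (dg 2 x + 1 / x * dg 1 x) - (\<Sum>k. S (Suc k))))"
proof -
  \<comment> \<open>The zeros are numbered from 1 while series run from 0. The least zero thus gets
    index 0, where it supplies the uniform lower bounds.\<close>
  define L where "L k = l (Suc k)" for k
  have bz: "bessel_zeros L"
  proof
    have "inj_on l {1..}" using assms(4) by (rule strict_mono_on_imp_inj_on)
    then show "inj L" by (auto simp: L_def inj_def inj_on_def)
    have "range L = l ` {1..}"
    proof -
      have "range Suc = {1..}"
      proof (intro equalityI subsetI)
        fix n :: nat assume "n \<in> {1..}"
        then show "n \<in> range Suc" by (cases n) auto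
      qed auto
      moreover have "range L = l ` range Suc" by (auto simp: L_def)
      ultimately show ?thesis by (simp only:)
    qed
    then show "range L = {x. 0 < x \<and> bessel_J 0 x = 0}" using assms(5) by simp
    show "L 0 \<le> L k" for k
    proof (cases "k = 0")
      case False
      then have "l (Suc 0) < l (Suc k)" by (intro strict_mono_onD[OF assms(4)]) auto
      then show ?thesis by (simp add: L_def)
    qed simp
  qed
  define e where "e i x = dg i x - df i x" for i x
  have e_bnd: "bounded (e 4 ` {0..1})"
    unfolding e_def by (rule bounded_minus_comp[OF assms(12,13)])
  interpret mode_solution L e \<alpha> T
  proof (intro mode_solution.intro smooth_datum.intro bz)
    show "smooth_datum_axioms e"
    proof
      show "(e i has_real_derivative e (Suc i) x) (at x within {0..1})" if "i < 4" "x \<in> {0..1}" for i x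
        unfolding e_def by (intro DERIV_diff assms(8,9) that)
      show "e i 0 = 0" if "i < 4" for i
      proof -
        have "i \<in> {0, 1, 2, 3}" using that by auto
        then show ?thesis using assms(10) by (simp add: e_def)
      qed
      show "e i 1 = 0" if "i < 3" for i
      proof -
        have "i \<in> {0, 1, 2}" using that by auto
        then show ?thesis using assms(11) by (simp add: e_def)
      qed
    qed (rule e_bnd)
    show "mode_solution_axioms \<alpha> T" using assms(1-3) by unfold_locales
  qed
  let ?u = "\<lambda>x t. g x - S x t"
  let ?h = "\<lambda>x. - (dg 2 x + 1 / x * dg 1 x) - Q x"
  have cg: "continuous_on {0..1} g" and cf: "continuous_on {0..1} f"
    unfolding assms(6)[symmetric] assms(7)[symmetric]
    by (rule DERIV_continuous_on[OF assms(8)] DERIV_continuous_on[OF assms(9)]; simp)+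
  have cdg2: "continuous_on {0..1} (dg 2)"
    by (rule DERIV_continuous_on[OF assms(8)]) auto
  have sol: "inverse_problem_solution \<alpha> T g f ?u ?h"
  proof (rule inverse_problem_solvable[OF _ _ cdg2])
    show "(g has_real_derivative dg 1 x) (at x within {0..1})" if "x \<in> {0..1}" for x
      using assms(8)[of 0 x] that assms(6) by simp
    show "(dg 1 has_real_derivative dg 2 x) (at x within {0..1})" if "x \<in> {0..1}" for x
      using assms(8)[of 1 x] that by (simp add: numeral_2_eq_2)
    show "g 1 = 0" using assms(11)[of 0] assms(6) by simp
  qed (simp add: e_def assms(6,7))
  have unique: "(\<forall>x\<in>{0..1}. \<forall>t\<in>{0..T}. u' x t = ?u x t) \<and> (\<forall>x\<in>{0<..<1}. h' x = ?h x)"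
    if "inverse_problem_solution \<alpha> T g f u' h'" for u' h'
  proof -
    interpret homogeneous_problem L \<alpha> T "\<lambda>x t. u' x t - ?u x t" "\<lambda>x. h' x - ?h x"
      by unfold_locales (use assms(1-3) inverse_problem_solution_diff[OF that sol] in auto)
    show ?thesis using U_eq_0 H_eq_0 by force
  qed
  have coeff: "fourier_bessel_coeff (l (Suc k)) g - fourier_bessel_coeff (l (Suc k)) f = d k" for k
  proof -
    have l: "l (Suc k) \<noteq> 0" "bessel_J 0 (l (Suc k)) = 0"
      using L_pos[of k] L_zero[of k] by (auto simp: L_def)
    have "wip (e 0) (\<phi> k) = wip (\<lambda>x. 1 * g x + (- 1) * f x) (\<phi> k)"
      by (rule wip_cong) (simp_all add: e_def assms(6,7))
    also have "\<dots> = wip g (\<phi> k) - wip f (\<phi> k)"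
      by (subst wip_lincomb_left) (auto intro: cg cf continuous_on_\<phi>)
    finally show ?thesis
      using fourier_bessel_coeff_eq[OF l cg] fourier_bessel_coeff_eq[OF l cf]
      by (simp add: d_def \<phi>_abs L_def diff_divide_distrib)
  qed
  have ml: "mittag_leffler \<alpha> (- (l (Suc k))\<^sup>2 * t powr \<alpha>) = y k t" for k t
    by (simp add: y_def ml_mode_def L_def)
  have J: "bessel_J 0 (l (Suc k) * x) = \<phi> k x" for k x
    by (simp add: \<phi>_def L_def)
  have S_term: "(1 - y k t) / (1 - y k T) * d k * \<phi> k x = c k * (1 - y k t) * \<phi> k x" for k x t
    by (simp add: c_def)
  have Q_term: "(l (Suc k))\<^sup>2 * d k / (1 - y k T) * \<phi> k x = (L k)\<^sup>2 * c k * \<phi> k x" for k x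
    by (simp add: c_def L_def)
  have Q_summable: "summable (\<lambda>k. (L k)\<^sup>2 * c k * \<phi> k x)" if "x \<in> {0<..<1}" for x
    using summable_rabs_cancel[OF weighted_summable[of x "\<lambda>_. 1" 1]] that by simp
  show ?thesis
  proof (intro exI[of _ ?u] exI[of _ ?h] conjI sol allI impI)
    fix u' h' assume "inverse_problem_solution \<alpha> T g f u' h'"
    then show "\<forall>x\<in>{0..1}. \<forall>t\<in>{0..T}. u' x t = ?u x t" "\<forall>x\<in>{0<..<1}. h' x = ?h x"
      using unique by blast+
  qed (unfold Let_def coeff ml J S_term Q_term, auto simp: S_def Q_def S_summable Q_summable)
qed

end
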